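(* Let $G=\mathrm{SL}_2(\mathbb R)$ or $G=\mathrm{SL}_2(\mathbb C)$, let $\Gamma\subseteq G$ be any lattice with a cusp at infinity, let $\epsilon>0$, and let $f^{(\lambda)}\in C_c^\infty(Q\backslash G)$, $\lambda\in[1,\infty)$, be the family of functions attached to $\epsilon$ and a fixed smooth compactly supported function $\psi\ge 0$ as described in the context. Then there is a constant $C=C(\Gamma,\psi,\epsilon)$ such that $$\|\Theta_{f^{(\lambda)}}\|^2\le C\left(\|f^{(\lambda)}\|_2^2+\|f^{(\lambda)}\|_1^2\right)$$ uniformly for $\lambda\in[1,\infty)$.
   Context: Let $\mu=1$, $K=\mathrm{SO}(2)$ if $G=\mathrm{SL}_2(\mathbb R)$ and $\mu=2$, $K=\mathrm{SU}(2)$ if $G=\mathrm{SL}_2(\mathbb C)$. Let $P$ be the group of upper triangular matrices in $G$, $n_x=\begin{pmatrix}1&x\\0&1\end{pmatrix}$, $a_t=\mathrm{diag}(e^{t/2},e^{-t/2})$, and $Q=\left\{\begin{pmatrix}a&x\\0&a^{-1}\end{pmatrix}\in G: |a|=1\right\}$. Put $\Gamma_\infty=\Gamma\cap P$; $\Gamma$ has a cusp at infinity if $\Gamma_\infty$ contains a non-trivial unipotent element (then $\Gamma_\infty\subseteq Q$ and $\Gamma_\infty\backslash Q$ is relatively compact). Functions on $Q\backslash G$ are identified with left $Q$-invariant functions on $G$. The Haar measure on $Q\backslash G$ is given by $\int_{Q\backslash G}f\,dg=\int_{\mathbb R}\int_K f(a_{t/\mu}k)e^{-t}\,dk\,dt$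 with $dk$ the probability Haar measure on $K$, and $\|f\|_p$ are the corresponding norms. For $f\in C_c^\infty(Q\backslash G)$, $\Theta_f(g)=\sum_{\gamma\in\Gamma_\infty\backslash\Gamma}f(\gamma g)$ and $\|\Theta_f\|^2=\int_{\Gamma\backslash G}|\Theta_f|^2d\sigma$ with $\sigma$ the invariant probability measure on $\Gamma\backslash G$. The family $f^{(\lambda)}$: (i) $G=\mathrm{SL}_2(\mathbb R)$. With $k_\theta=\begin{pmatrix}\cos\theta&\sin\theta\\-\sin\theta&\cos\theta\end{pmatrix}$, $$f^{(\lambda)}(n_xa_tk_\theta)=v_\lambda(t)\,\psi(\lambda\theta),$$ where $v_\lambda\in C_c^\infty(\mathbb R)$ is supported on $[-(1+\epsilon)\log\lambda,0]$, takes values in $[0,1]$ and equals $1$ on $[-(1+\epsilon)\log\lambda+1,-1]$, and $\psi\in C_c^\infty(\mathbb R)$ is fixed with values in $[0,1]$. Here $\theta$ is taken in $(-\pi/2,\pi/2]$, i.e. modulo $\{\pm1\}$. (ii) $G=\mathrm{SL}_2(\mathbb C)$. With $k_{\theta,\alpha,\beta}=\begin{pmatrix}\cos(\theta)e^{i\alpha}&\sin(\theta)e^{i\beta}\\-\sin(\theta)e^{-i\beta}&\cos(\theta)e^{-i\alpha}\end{pmatrix}$, $$f^{(\lambda)}(n_xa_{t}k_{\theta,\alpha,\beta})=v_\lambda(2t)\,\psi(\lambda\sin\theta,\lambda(\alpha-\beta)),$$ where $v_\lambda\in C_c^\infty(\mathbb R)$ is supported on $[-(3+\epsilon)\log\lambda,0]$,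 takes values in $[0,1]$ and equals $1$ on $[-(3+\epsilon)\log\lambda+1,-1]$, and $\psi\in C_c^\infty(\mathbb R^2)$ is fixed and non-negative. Here $\theta\in[0,\pi/2]$ and $\alpha-\beta\in(-\pi,\pi]$. In both cases it is part of the setting that these formulas define elements $f^{(\lambda)}$ of $C_c^\infty(Q\backslash G)$; the bound is asserted for all such $\lambda\in[1,\infty)$. *)

theory Defs
  imports "HOL-Analysis.Analysis" "HOL-Probability.Probability_Measure" "HOL-Algebra.Coset"
begin

section \<open>Smooth functions\<close>

text \<open>Only meant for open \<open>S\<close>. All derivatives are real Frechet derivatives, also on complex spaces.\<close>

primrec cont_diff_on ::
    "nat \<Rightarrow> 'a::real_normed_vector set \<Rightarrow> ('a \<Rightarrow> 'b::real_normed_vector) \<Rightarrow> bool" where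
  "cont_diff_on 0 S f \<longleftrightarrow> continuous_on S f"
| "cont_diff_on (Suc k) S f \<longleftrightarrow>
     f differentiable_on S \<and> (\<forall>v. cont_diff_on k S (\<lambda>x. frechet_derivative f (at x) v))"

definition smooth_on :: "'a::real_normed_vector set \<Rightarrow> ('a \<Rightarrow> 'b::real_normed_vector) \<Rightarrow> bool" where
  "smooth_on S f \<longleftrightarrow> (\<forall>k. cont_diff_on k S f)"

definition test_function :: "('a::real_normed_vector \<Rightarrow> 'b::real_normed_vector) \<Rightarrow> bool" where
  "test_function f \<longleftrightarrow> smooth_on UNIV f \<and> compact (closure {x. f x \<noteq> 0})"


section \<open>The groups\<close>

definition mat2 :: "'a::zero \<Rightarrow> 'a \<Rightarrow> 'a \<Rightarrow> 'a \<Rightarrow> 'a^2^2" where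
  "mat2 a b c d = vector [vector [a, b], vector [c, d]]"

definition SL2 :: "('a::real_normed_field^2^2) monoid" where
  "SL2 = \<lparr>carrier = {A. det A = 1}, mult = (**), one = mat 1\<rparr>"

lemma group_SL2: "group (SL2 :: ('a::real_normed_field^2^2) monoid)"
proof (rule groupI)
  fix A :: "'a^2^2"
  assume "A \<in> carrier SL2"
  then have d: "det A = 1" by (simp add: SL2_def)
  then have "invertible A" by (simp add: invertible_det_nz)
  then obtain B where B: "A ** B = mat 1" "B ** A = mat 1"
    by (auto simp: invertible_def)
  have "det B * det A = 1" by (metis B(2) det_mul det_I)
  with d B show "\<exists>B\<in>carrier SL2. B \<otimes>\<^bsub>SL2\<^esub> A = \<one>\<^bsub>SL2\<^esub>"
    by (auto simp: SL2_def)
qed (auto simp: SL2_def det_mul matrix_mul_assoc)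

definition upper_P :: "('a::real_normed_field^2^2) set" where
  "upper_P = {A \<in> carrier SL2. A $ 2 $ 1 = 0}"

definition subgroup_Q :: "('a::real_normed_field^2^2) set" where
  "subgroup_Q = {mat2 a x 0 (inverse a) | a x. norm a = 1}"

definition n_mat :: "'a::real_normed_field \<Rightarrow> 'a^2^2" where
  "n_mat x = mat2 1 x 0 1"

definition a_mat :: "real \<Rightarrow> 'a::real_normed_field^2^2" where
  "a_mat t = mat2 (of_real (exp (t/2))) 0 0 (of_real (exp (- t/2)))"

definition k_real :: "real \<Rightarrow> real^2^2" where
  "k_real \<theta> = mat2 (cos \<theta>) (sin \<theta>) (- sin \<theta>) (cos \<theta>)"

definition k_complex :: "real \<Rightarrow> real \<Rightarrow> real \<Rightarrow> complex^2^2" where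
  "k_complex \<theta> \<alpha> \<beta> =
     mat2 (of_real (cos \<theta>) * cis \<alpha>) (of_real (sin \<theta>) * cis \<beta>)
          (- of_real (sin \<theta>) * cis (- \<beta>)) (of_real (cos \<theta>) * cis (- \<alpha>))"

definition SO2 :: "(real^2^2) set" where
  "SO2 = {A. orthogonal_matrix A \<and> det A = 1}"

definition SU2 :: "(complex^2^2) set" where
  "SU2 = {A. (\<chi> i j. cnj (A $ j $ i)) ** A = mat 1 \<and> det A = 1}"

definition haar_probability :: "('a::real_normed_field^2^2) set \<Rightarrow> ('a^2^2) measure \<Rightarrow> bool" where
  "haar_probability K \<kappa> \<longleftrightarrow>
     prob_space \<kappa> \<and> sets \<kappa> = sets (restrict_space borel K) \<and>
     (\<forall>k\<in>K. \<forall>B\<in>sets \<kappa>. emeasure \<kappa> ((\<lambda>x. k ** x) ` B) = emeasure \<kappa> B \<and>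
                        emeasure \<kappa> ((\<lambda>x. x ** k) ` B) = emeasure \<kappa> B)"


section \<open>Spaces of right cosets\<close>

text \<open>The quotient topology on \<open>H\G\<close>, whose points are the cosets \<open>H g\<close>.\<close>

definition coset_topology ::
    "('a::real_normed_field^2^2) set \<Rightarrow> ('a^2^2) set topology" where
  "coset_topology H = topology (\<lambda>\<U>. \<U> \<subseteq> rcosets\<^bsub>SL2\<^esub> H \<and>
     openin (top_of_set (carrier SL2)) {g \<in> carrier SL2. H #>\<^bsub>SL2\<^esub> g \<in> \<U>})"

lemma openin_coset_topology:
  "openin (coset_topology H) \<U> \<longleftrightarrow> \<U> \<subseteq> rcosets\<^bsub>SL2\<^esub> H \<and>
     openin (top_of_set (carrier SL2)) {g \<in> carrier SL2. H #>\<^bsub>SL2\<^esub> g \<in> \<U>}"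
proof -
  have "istopology (\<lambda>\<U>. \<U> \<subseteq> rcosets\<^bsub>SL2\<^esub> H \<and>
     openin (top_of_set (carrier SL2)) {g \<in> carrier SL2. H #>\<^bsub>SL2\<^esub> g \<in> \<U>})"
    (is "istopology ?T")
    unfolding istopology_def
  proof (intro conjI allI impI)
    fix S T assume "?T S" "?T T"
    moreover have "{g \<in> carrier SL2. H #>\<^bsub>SL2\<^esub> g \<in> S \<inter> T} =
      {g \<in> carrier SL2. H #>\<^bsub>SL2\<^esub> g \<in> S} \<inter> {g \<in> carrier SL2. H #>\<^bsub>SL2\<^esub> g \<in> T}" by auto
    ultimately show "S \<inter> T \<subseteq> rcosets\<^bsub>SL2\<^esub> H"
      "openin (top_of_set (carrier SL2)) {g \<in> carrier SL2. H #>\<^bsub>SL2\<^esub> g \<in> S \<inter> T}"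
      by (blast, simp only: openin_Int)
  next
    fix \<K> assume K: "\<forall>S\<in>\<K>. ?T S"
    then show "\<Union>\<K> \<subseteq> rcosets\<^bsub>SL2\<^esub> H" by blast
    have "{g \<in> carrier SL2. H #>\<^bsub>SL2\<^esub> g \<in> \<Union>\<K>} =
      \<Union>((\<lambda>S. {g \<in> carrier SL2. H #>\<^bsub>SL2\<^esub> g \<in> S}) ` \<K>)" by auto
    then show "openin (top_of_set (carrier SL2)) {g \<in> carrier SL2. H #>\<^bsub>SL2\<^esub> g \<in> \<Union>\<K>}"
      using K by (metis (no_types, lifting) imageE openin_Union)
  qed
  then show ?thesis by (simp add: coset_topology_def topology_inverse')
qed

lemma topspace_coset_topology: "topspace (coset_topology H) = rcosets\<^bsub>SL2\<^esub> H"
proof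
  show "topspace (coset_topology H) \<subseteq> rcosets\<^bsub>SL2\<^esub> H"
    using openin_coset_topology openin_topspace by blast
  have "{g \<in> carrier SL2. H #>\<^bsub>SL2\<^esub> g \<in> rcosets\<^bsub>SL2\<^esub> H} = carrier SL2"
    by (auto simp: RCOSETS_def)
  then have "openin (coset_topology H) (rcosets\<^bsub>SL2\<^esub> H)"
    by (simp add: openin_coset_topology)
  then show "rcosets\<^bsub>SL2\<^esub> H \<subseteq> topspace (coset_topology H)"
    by (rule openin_subset)
qed

lemma quotient_map_coset_topology:
  "quotient_map (top_of_set (carrier SL2)) (coset_topology H) (\<lambda>g. H #>\<^bsub>SL2\<^esub> g)"
  unfolding quotient_map_def topspace_coset_topology openin_coset_topology
  by (auto simp: RCOSETS_def)

text \<open>A right \<open>G\<close>-invariant probability measure on the Borel sets of \<open>\<Gamma>\G\<close>.\<close>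

definition invariant_probability ::
    "('a::real_normed_field^2^2) set \<Rightarrow> ('a^2^2) set measure \<Rightarrow> bool" where
  "invariant_probability \<Gamma> \<sigma> \<longleftrightarrow>
     prob_space \<sigma> \<and>
     sets \<sigma> = sets (sigma (rcosets\<^bsub>SL2\<^esub> \<Gamma>) {\<U>. openin (coset_topology \<Gamma>) \<U>}) \<and>
     (\<forall>g\<in>carrier SL2. \<forall>\<B>\<in>sets \<sigma>. emeasure \<sigma> ((\<lambda>c. c #>\<^bsub>SL2\<^esub> g) ` \<B>) = emeasure \<sigma> \<B>)"

text \<open>A lattice is a discrete subgroup of finite covolume, i.e. \<open>\<Gamma>\G\<close> carries a finite invariant measure.\<close>

text \<open>Finite covolume is expressed by the existence of a finite invariant measure, normalized to mass 1.\<close>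

definition SL2_lattice :: "('a::real_normed_field^2^2) set \<Rightarrow> bool" where
  "SL2_lattice \<Gamma> \<longleftrightarrow> subgroup \<Gamma> SL2 \<and> discrete \<Gamma> \<and> (\<exists>\<sigma>. invariant_probability \<Gamma> \<sigma>)"

definition unipotent :: "'a::real_normed_field^2^2 \<Rightarrow> bool" where
  "unipotent A \<longleftrightarrow> (\<exists>n. ((\<lambda>B. (A - mat 1) ** B) ^^ n) (mat 1) = 0)"

definition Gamma_inf :: "('a::real_normed_field^2^2) set \<Rightarrow> ('a^2^2) set" where
  "Gamma_inf \<Gamma> = \<Gamma> \<inter> upper_P"

definition cusp_at_infinity :: "('a::real_normed_field^2^2) set \<Rightarrow> bool" where
  "cusp_at_infinity \<Gamma> \<longleftrightarrow> (\<exists>u\<in>Gamma_inf \<Gamma>. unipotent u \<and> u \<noteq> mat 1)"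


section \<open>Functions on the quotient by Q and theta series\<close>

definition smooth_on_SL2 ::
    "('a::real_normed_field^2^2 \<Rightarrow> 'b::real_normed_vector) \<Rightarrow> bool" where
  "smooth_on_SL2 f \<longleftrightarrow> (\<forall>g\<in>carrier SL2. \<exists>U F. open U \<and> g \<in> U \<and> smooth_on U F \<and>
     (\<forall>x\<in>U \<inter> carrier SL2. F x = f x))"

text \<open>
  \<open>C\<^sub>c\<^sup>\<infinity>(Q\G)\<close>, as left \<open>Q\<close>-invariant functions on \<open>G\<close>; values outside \<open>G\<close> are
  unconstrained and never used.
\<close>

definition Cc_smooth_Q ::
    "('a::real_normed_field^2^2 \<Rightarrow> 'b::real_normed_vector) set" where
  "Cc_smooth_Q = {f. smooth_on_SL2 f \<and>
     (\<forall>q\<in>subgroup_Q. \<forall>g\<in>carrier SL2. f (q ** g) = f g) \<and>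
     compactin (coset_topology subgroup_Q)
       (coset_topology subgroup_Q closure_of
         {subgroup_Q #>\<^bsub>SL2\<^esub> g | g. g \<in> carrier SL2 \<and> f g \<noteq> 0})}"

text \<open>
  \<open>\<mu>\<close> is 1 in the real and 2 in the complex case, and \<open>\<kappa>\<close> is the Haar probability measure on \<open>K\<close>.
\<close>

definition Q_norm :: "real \<Rightarrow> ('a::real_normed_field^2^2) measure \<Rightarrow> real \<Rightarrow>
    ('a^2^2 \<Rightarrow> 'b::real_normed_vector) \<Rightarrow> real" where
  "Q_norm \<mu> \<kappa> p f =
     (LINT t|lborel. (LINT k|\<kappa>. norm (f (a_mat (t / \<mu>) ** k)) powr p * exp (- t))) powr (1 / p)"

text \<open>
  For \<open>f\<close> in \<open>C\<^sub>c\<^sup>\<infinity>(Q\G)\<close> the summand does not depend on the representative chosen in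
  \<open>\<Gamma>\<^sub>\<infinity>\<gamma>\<close>, and only finitely many terms are non-zero.
\<close>

definition Theta :: "('a::real_normed_field^2^2) set \<Rightarrow>
    ('a^2^2 \<Rightarrow> 'b::real_normed_vector) \<Rightarrow> 'a^2^2 \<Rightarrow> 'b" where
  "Theta \<Gamma> f g =
     (\<Sum>\<^sub>\<infinity>c\<in>(\<lambda>\<gamma>. Gamma_inf \<Gamma> #>\<^bsub>SL2\<^esub> \<gamma>) ` \<Gamma>. f ((SOME \<gamma>. \<gamma> \<in> c) ** g))"

text \<open>\<open>\<parallel>\<Theta>\<^sub>f\<parallel>\<^sup>2\<close>; the left \<open>\<Gamma>\<close>-invariant function \<open>\<Theta>\<^sub>f\<close> is evaluated at any representative.\<close>

definition Theta_norm_sq :: "('a::real_normed_field^2^2) set \<Rightarrow> ('a^2^2) set measure \<Rightarrow>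
    ('a^2^2 \<Rightarrow> 'b::real_normed_vector) \<Rightarrow> ennreal" where
  "Theta_norm_sq \<Gamma> \<sigma> f = (\<integral>\<^sup>+c. ennreal ((norm (Theta \<Gamma> f (SOME g. g \<in> c)))\<^sup>2) \<partial>\<sigma>)"


section \<open>The family of functions\<close>

definition cutoff :: "real \<Rightarrow> (real \<Rightarrow> real) \<Rightarrow> bool" where
  "cutoff L v \<longleftrightarrow> test_function v \<and> closure {t. v t \<noteq> 0} \<subseteq> {-L..0} \<and>
     (\<forall>t. 0 \<le> v t \<and> v t \<le> 1) \<and> (\<forall>t\<in>{-L+1..-1}. v t = 1)"

text \<open>
  The coordinates \<open>\<alpha>\<close>, \<open>\<beta>\<close> below are not determined by the matrix. Requiring the formula for all
  coordinates in the given range includes the condition that it is well defined.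
\<close>

definition f_lambda_real ::
    "real \<Rightarrow> (real \<Rightarrow> real) \<Rightarrow> real \<Rightarrow> (real^2^2 \<Rightarrow> real) \<Rightarrow> bool" where
  "f_lambda_real \<epsilon> \<psi> lam f \<longleftrightarrow> (\<exists>v. cutoff ((1 + \<epsilon>) * ln lam) v \<and>
     (\<forall>x t. \<forall>\<theta>\<in>{-pi/2<..pi/2}.
        f (n_mat x ** a_mat t ** k_real \<theta>) = v t * \<psi> (lam * \<theta>)))"

definition f_lambda_complex ::
    "real \<Rightarrow> (real \<times> real \<Rightarrow> real) \<Rightarrow> real \<Rightarrow> (complex^2^2 \<Rightarrow> real) \<Rightarrow> bool" where
  "f_lambda_complex \<epsilon> \<psi> lam f \<longleftrightarrow> (\<exists>v. cutoff ((3 + \<epsilon>) * ln lam) v \<and>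
     (\<forall>x t. \<forall>\<theta>\<in>{0..pi/2}. \<forall>\<alpha> \<beta>. \<alpha> - \<beta> \<in> {-pi<..pi} \<longrightarrow>
        f (n_mat x ** a_mat t ** k_complex \<theta> \<alpha> \<beta>) =
          v (2 * t) * \<psi> (lam * sin \<theta>, lam * (\<alpha> - \<beta>))))"

end

theory Submission
  imports Defs
begin

text \<open>
  No spectral theory is used. The summands of \<open>\<Theta>\<^sub>f(g)\<close> are indexed by bottom rows \<open>(c, d)\<close> of elements of
  \<open>\<Gamma>g\<close> modulo units, and by Shimizu's lemma two different ones have determinant bounded away from zero.
  In the coordinate \<open>c/d\<close> rows of height at most \<open>R\<close> are therefore separated by a multiple of \<open>1/R\<^sup>2\<close>,
  which bounds their number uniformly in \<open>g\<close>.

  As \<open>\<sigma>\<close> is an invariant probability measure, \<open>\<parallel>\<Theta>\<^sub>f\<parallel>\<^sup>2\<close> is at most the supremum over \<open>g\<close> of any average of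
  \<open>\<bar>\<Theta>\<^sub>f(gk)\<bar>\<^sup>2\<close> over \<open>k\<close>. For bounded \<open>\<lambda>\<close> boundedly many rows contribute, and averaging over a
  piece of \<open>NAK\<close> gives \<open>O(\<parallel>f\<parallel>\<^sub>2\<^sup>2)\<close>. For large \<open>\<lambda>\<close> one has
  \<open>\<parallel>f\<parallel>\<^sub>1 \<ge> c \<lambda>\<^sup>\<epsilon>\<close> unless \<open>f = 0\<close>. In the real case packing
  on a line gives \<open>\<Theta>\<^sub>f = O(\<lambda>\<^sup>\<epsilon>)\<close> pointwise. In the complex case \<open>f\<close> is supported over a strip of size
  \<open>\<lambda>\<^sup>-\<^sup>1 \<times> \<lambda>\<^sup>-\<^sup>2\<close> in the \<open>c/d\<close>-plane, too thin for this, and one averages \<open>\<Theta>\<^sub>f\<^sup>2\<close> over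
  rotations and translations of the plane, which again gives \<open>O(\<lambda>\<^sup>2\<^sup>\<epsilon>)\<close>.
\<close>

section \<open>Two by two matrices\<close>

text \<open>The exponents decide the shape. In \<open>Q_norm\<close> the weight exp(-t) over the
  support of the cutoff has mass about \<lambda>^(1+\<epsilon>), or \<lambda>^(3+\<epsilon>) in the
  complex case, while the angular support has Haar measure about \<lambda>^-1, or \<lambda>^-3;
  hence the order \<lambda>^\<epsilon>, called \<open>E\<close>, of the L1 norm. This lower bound
  rests on the plateau of the cutoff. For small \<lambda> the plateau is empty and the cutoff may be
  arbitrarily small, so there the estimate has to hold for arbitrary f of bounded height, and the L2
  norm provides it. Separation alone cannot finish the complex case: spacing
  \<lambda>^(-(3+\<epsilon>)/2) along a strip of length 1/\<lambda> admits
  \<lambda>^((1+\<epsilon>)/2) points, more than \<open>E\<close> if \<epsilon> < 1. In mean square,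
  about \<lambda>^3 \<open>E\<close> rows meet the strip with probability about \<lambda>^-3 each,
  and pairs are controlled by sums of 1/|z - z'|, which planar packing bounds; the totals are of
  order \<open>E\<close> and \<open>E\<close>^2.\<close>

lemma mat2_nth [simp]:
  "mat2 a b c d $ 1 $ 1 = a" "mat2 a b c d $ 1 $ 2 = b"
  "mat2 a b c d $ 2 $ 1 = c" "mat2 a b c d $ 2 $ 2 = d"
  by (simp_all add: mat2_def vector_2)

lemma matrix2_eq_iff:
  "A = B \<longleftrightarrow> A $ 1 $ 1 = B $ 1 $ 1 \<and> A $ 1 $ 2 = B $ 1 $ 2 \<and> A $ 2 $ 1 = B $ 2 $ 1 \<and> A $ 2 $ 2 = B $ 2 $ 2"
  for A B :: "'a^2^2"
  by (auto simp: vec_eq_iff forall_2)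

lemma matrix2_mult_nth [simp]:
  "(A ** B) $ i $ j = A $ i $ 1 * B $ 1 $ j + A $ i $ 2 * B $ 2 $ j" for A B :: "('a::semiring_1)^2^2"
  by (simp add: matrix_matrix_mult_def sum_2)

lemma mat_1_nth2 [simp]:
  "(mat 1 :: ('a::zero_neq_one)^2^2) $ 1 $ 1 = 1" "(mat 1 :: 'a^2^2) $ 1 $ 2 = 0"
  "(mat 1 :: 'a^2^2) $ 2 $ 1 = 0" "(mat 1 :: 'a^2^2) $ 2 $ 2 = 1"
  by (simp_all add: mat_def)

lemma carrier_SL2_iff:
  "g \<in> carrier SL2 \<longleftrightarrow> g $ 1 $ 1 * g $ 2 $ 2 - g $ 1 $ 2 * g $ 2 $ 1 = 1"
  by (simp add: SL2_def det_2)

lemma SL2_simps [simp]: "x \<otimes>\<^bsub>SL2\<^esub> y = x ** y" "\<one>\<^bsub>SL2\<^esub> = mat 1"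
  by (simp_all add: SL2_def)

lemma SL2_mult_closed [intro]:
  "g \<in> carrier SL2 \<Longrightarrow> h \<in> carrier SL2 \<Longrightarrow> g ** h \<in> carrier SL2"
  by (simp add: SL2_def det_mul)

lemma SL2_one_closed [simp]: "mat 1 \<in> carrier SL2"
  by (simp add: SL2_def)

text \<open>The adjugate is used as inverse on \<open>SL2\<close>: it is polynomial in the entries,
  so it is continuous and products with it expand by simplification.\<close>

definition adj2 :: "'a::real_normed_field^2^2 \<Rightarrow> 'a^2^2" where
  "adj2 g = mat2 (g $ 2 $ 2) (- g $ 1 $ 2) (- g $ 2 $ 1) (g $ 1 $ 1)"

lemma adj2_closed [intro]: "g \<in> carrier SL2 \<Longrightarrow> adj2 g \<in> carrier SL2"
  by (simp add: carrier_SL2_iff adj2_def algebra_simps)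

lemma adj2_mult [simp]:
  assumes "g \<in> carrier SL2"
  shows "adj2 g ** g = mat 1" "g ** adj2 g = mat 1"
  using assms by (simp_all add: carrier_SL2_iff adj2_def matrix2_eq_iff algebra_simps)

lemma inv_SL2_eq: "g \<in> carrier SL2 \<Longrightarrow> inv\<^bsub>SL2\<^esub> g = adj2 g"
  by (rule group.inv_equality[OF group_SL2]) auto

lemma subgroup_SL2D:
  assumes "subgroup \<Gamma> SL2"
  shows "\<And>g. g \<in> \<Gamma> \<Longrightarrow> g \<in> carrier SL2" "\<And>g h. g \<in> \<Gamma> \<Longrightarrow> h \<in> \<Gamma> \<Longrightarrow> g ** h \<in> \<Gamma>"
    "\<And>g. g \<in> \<Gamma> \<Longrightarrow> adj2 g \<in> \<Gamma>" "mat 1 \<in> \<Gamma>"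
  using assms subgroup.m_closed[OF assms] subgroup.m_inv_closed[OF assms] subgroup.subset[OF assms]
    subgroup.one_closed[OF assms]
  by (auto simp: inv_SL2_eq[symmetric] subset_iff)

lemma r_coset_SL2: "H #>\<^bsub>SL2\<^esub> g = (\<lambda>h. h ** g) ` H"
  by (auto simp: r_coset_def)

lemma rcosets_SL2: "rcosets\<^bsub>SL2\<^esub> H = (\<lambda>g. H #>\<^bsub>SL2\<^esub> g) ` carrier SL2"
  by (auto simp: RCOSETS_def)

lemma r_coset_translate: "(H #>\<^bsub>SL2\<^esub> g) #>\<^bsub>SL2\<^esub> h = H #>\<^bsub>SL2\<^esub> (g ** h)"
  by (auto simp: r_coset_SL2 image_image matrix_mul_assoc)

lemma r_coset_eq_SL2:
  assumes "subgroup H SL2" "h \<in> H"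
  shows "H #>\<^bsub>SL2\<^esub> (h ** g) = H #>\<^bsub>SL2\<^esub> g"
proof -
  have "(\<lambda>k. k ** h) ` H = H"
  proof (intro equalityI subsetI)
    fix k assume "k \<in> H"
    then have "k = (k ** adj2 h) ** h" "k ** adj2 h \<in> H"
      using assms subgroup_SL2D[OF assms(1)] by (auto simp flip: matrix_mul_assoc)
    then show "k \<in> (\<lambda>k. k ** h) ` H" by blast
  qed (use assms subgroup_SL2D[OF assms(1)] in auto)
  then have "(\<lambda>k. k ** g) ` ((\<lambda>k. k ** h) ` H) = (\<lambda>k. k ** g) ` H" by simp
  then show ?thesis by (simp add: r_coset_SL2 image_image matrix_mul_assoc)
qed

lemma SL2_cancel_right:
  assumes "k \<in> carrier SL2" "g ** k = h ** k"
  shows "g = h"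
  by (metis adj2_mult(2) assms matrix_mul_assoc matrix_mul_rid)

lemma n_mat_in_SL2 [simp]: "n_mat x \<in> carrier SL2"
  by (simp add: carrier_SL2_iff n_mat_def)

lemma a_mat_in_SL2 [simp]: "a_mat t \<in> carrier SL2"
  by (simp add: carrier_SL2_iff a_mat_def flip: of_real_mult exp_add)

text \<open>The space \<open>Q\G\<close> is the space of nonzero bottom rows modulo scalars of norm one.\<close>

lemma same_bottom_row:
  assumes "g \<in> carrier SL2" "h \<in> carrier SL2" "norm u = 1"
    and "g $ 2 $ 1 = u * h $ 2 $ 1" "g $ 2 $ 2 = u * h $ 2 $ 2"
  obtains q where "q \<in> subgroup_Q" "g = q ** h"
proof -
  \<comment> \<open>Its lower left entry is the determinant of the two bottom rows, which vanishes
    because they are proportional; the lower right entry is then the factor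
    \<open>u\<close>.\<close>
  define q where "q = g ** adj2 h"
  have u: "u \<noteq> 0" using assms(3) by auto
  have gh: "g = q ** h"
    using assms by (simp add: q_def flip: matrix_mul_assoc)
  have q: "q \<in> carrier SL2" using assms by (auto simp: q_def)
  have q21: "q $ 2 $ 1 = 0" unfolding q_def by (simp add: adj2_def assms)
  have "q $ 2 $ 2 = u * (h $ 1 $ 1 * h $ 2 $ 2 - h $ 1 $ 2 * h $ 2 $ 1)"
    unfolding q_def by (simp add: adj2_def assms algebra_simps)
  then have q22: "q $ 2 $ 2 = u" using assms(2) by (simp add: carrier_SL2_iff)
  have "q $ 1 $ 1 * u = 1" using q q21 q22 by (simp add: carrier_SL2_iff)
  then have q11: "q $ 1 $ 1 = inverse u" using u by (simp add: field_simps)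
  have "q = mat2 (inverse u) (q $ 1 $ 2) 0 (inverse (inverse u))"
    by (simp add: matrix2_eq_iff q11 q21 q22)
  then have "q \<in> subgroup_Q"
    unfolding subgroup_Q_def using assms(3)
    by (intro CollectI exI[of _ "inverse u"] exI[of _ "q $ 1 $ 2"]) (simp add: norm_inverse)
  then show thesis using gh that by blast
qed

lemma norm_row2: "norm (x :: 'a::real_normed_field^2) = sqrt ((norm (x $ 1))\<^sup>2 + (norm (x $ 2))\<^sup>2)"
  by (simp add: norm_vec_def L2_set_def sum_2)

section \<open>Averaging over translations\<close>

lemma continuous_on_matrix2_mult [continuous_intros]:
  fixes f g :: "'b::topological_space \<Rightarrow> 'a::real_normed_field^2^2"
  assumes "continuous_on S f" "continuous_on S g"
  shows "continuous_on S (\<lambda>x. f x ** g x)"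
  unfolding matrix_matrix_mult_def
  by (intro continuous_on_vec_lambda continuous_intros assms)

text \<open>The projection to the coset space is open: the preimage of the image of \<open>B\<close>
  is the union of the translates of \<open>B\<close> by \<Gamma>, each open because left
  multiplication is continuous.\<close>

lemma openin_translate_set:
  fixes \<Gamma> :: "('a::real_normed_field^2^2) set"
  assumes "subgroup \<Gamma> SL2" "open B"
  shows "openin (coset_topology \<Gamma>) ((\<lambda>g. \<Gamma> #>\<^bsub>SL2\<^esub> g) ` (B \<inter> carrier SL2))"
proof -
  note sg = subgroup_SL2D[OF assms(1)]
  define V where "V = (\<lambda>g. \<Gamma> #>\<^bsub>SL2\<^esub> g) ` (B \<inter> carrier SL2)"
  have "{g \<in> carrier SL2. \<Gamma> #>\<^bsub>SL2\<^esub> g \<in> V} = carrier SL2 \<inter> (\<Union>\<gamma>\<in>\<Gamma>. {g. \<gamma> ** g \<in> B})"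
  proof (intro equalityI subsetI)
    fix g assume "g \<in> {g \<in> carrier SL2. \<Gamma> #>\<^bsub>SL2\<^esub> g \<in> V}"
    then obtain b where g: "g \<in> carrier SL2" and b: "b \<in> B" "b \<in> carrier SL2"
      and eq: "\<Gamma> #>\<^bsub>SL2\<^esub> g = \<Gamma> #>\<^bsub>SL2\<^esub> b" by (auto simp: V_def)
    have "b \<in> \<Gamma> #>\<^bsub>SL2\<^esub> b" using sg(4) by (force simp: r_coset_SL2)
    then have "b \<in> (\<lambda>h. h ** g) ` \<Gamma>" using eq by (simp add: r_coset_SL2)
    then show "g \<in> carrier SL2 \<inter> (\<Union>\<gamma>\<in>\<Gamma>. {g. \<gamma> ** g \<in> B})" using g b by auto
  next
    fix g assume "g \<in> carrier SL2 \<inter> (\<Union>\<gamma>\<in>\<Gamma>. {g. \<gamma> ** g \<in> B})"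
    then obtain \<gamma> where g: "g \<in> carrier SL2" "\<gamma> \<in> \<Gamma>" "\<gamma> ** g \<in> B" by auto
    then have "\<Gamma> #>\<^bsub>SL2\<^esub> g = \<Gamma> #>\<^bsub>SL2\<^esub> (\<gamma> ** g)" by (simp add: r_coset_eq_SL2 assms(1))
    then show "g \<in> {g \<in> carrier SL2. \<Gamma> #>\<^bsub>SL2\<^esub> g \<in> V}" using g sg by (auto simp: V_def)
  qed
  moreover have "open {g. \<gamma> ** g \<in> B}" for \<gamma> :: "'a^2^2"
  proof -
    have "continuous_on UNIV (\<lambda>g :: 'a^2^2. \<gamma> ** g)" by (intro continuous_intros)
    then show ?thesis using open_vimage[OF assms(2), of "\<lambda>g. \<gamma> ** g"] by (simp add: vimage_def)
  qed
  ultimately have "openin (top_of_set (carrier SL2)) {g \<in> carrier SL2. \<Gamma> #>\<^bsub>SL2\<^esub> g \<in> V}"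
    by (auto intro!: openin_open_Int)
  moreover have "V \<subseteq> rcosets\<^bsub>SL2\<^esub> \<Gamma>" by (auto simp: V_def rcosets_SL2)
  ultimately show ?thesis by (simp add: openin_coset_topology V_def)
qed

lemma invariant_probabilityD:
  assumes "invariant_probability \<Gamma> \<sigma>"
  shows "prob_space \<sigma>" "space \<sigma> = rcosets\<^bsub>SL2\<^esub> \<Gamma>"
    "sets \<sigma> = sigma_sets (rcosets\<^bsub>SL2\<^esub> \<Gamma>) {\<U>. openin (coset_topology \<Gamma>) \<U>}"
    "\<And>g B. g \<in> carrier SL2 \<Longrightarrow> B \<in> sets \<sigma> \<Longrightarrow> emeasure \<sigma> ((\<lambda>c. c #>\<^bsub>SL2\<^esub> g) ` B) = emeasure \<sigma> B"
proof -
  have sub: "{\<U>. openin (coset_topology \<Gamma>) \<U>} \<subseteq> Pow (rcosets\<^bsub>SL2\<^esub> \<Gamma>)"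
    by (auto simp: openin_coset_topology)
  have s: "sets \<sigma> = sets (sigma (rcosets\<^bsub>SL2\<^esub> \<Gamma>) {\<U>. openin (coset_topology \<Gamma>) \<U>})"
    using assms by (simp add: invariant_probability_def)
  from sets_eq_imp_space_eq[OF this] show "space \<sigma> = rcosets\<^bsub>SL2\<^esub> \<Gamma>"
    by (simp add: space_measure_of[OF sub])
  show "sets \<sigma> = sigma_sets (rcosets\<^bsub>SL2\<^esub> \<Gamma>) {\<U>. openin (coset_topology \<Gamma>) \<U>}"
    using s by (simp add: sets_measure_of[OF sub])
qed (use assms in \<open>auto simp: invariant_probability_def\<close>)

text \<open>Tonelli needs joint measurability for the product sigma-algebra, which is generated by
  rectangles, whereas the open sets come from the quotient topology. A countable basis of the matrix
  space bridges the two: the preimage of an open set under multiplication is a countable union of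
  open rectangles, and the open projection carries their first factors to measurable sets of
  cosets.\<close>

lemma measurable_coset_action:
  fixes \<Gamma> :: "('a::{real_normed_field,euclidean_space}^2^2) set"
  assumes \<Gamma>: "subgroup \<Gamma> SL2" and \<sigma>: "invariant_probability \<Gamma> \<sigma>"
    and \<eta>: "\<eta> \<in> borel_measurable M" "\<And>m. m \<in> space M \<Longrightarrow> \<eta> m \<in> carrier SL2"
  shows "(\<lambda>(c, m). c #>\<^bsub>SL2\<^esub> \<eta> m) \<in> measurable (\<sigma> \<Otimes>\<^sub>M M) \<sigma>"
proof (rule measurable_sigma_sets)
  note \<sigma>' = invariant_probabilityD[OF \<sigma>]
  show "sets \<sigma> = sigma_sets (rcosets\<^bsub>SL2\<^esub> \<Gamma>) {\<U>. openin (coset_topology \<Gamma>) \<U>}" by (rule \<sigma>')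
  show "{\<U>. openin (coset_topology \<Gamma>) \<U>} \<subseteq> Pow (rcosets\<^bsub>SL2\<^esub> \<Gamma>)"
    by (auto simp: openin_coset_topology)
  show "(\<lambda>(c, m). c #>\<^bsub>SL2\<^esub> \<eta> m) \<in> space (\<sigma> \<Otimes>\<^sub>M M) \<rightarrow> rcosets\<^bsub>SL2\<^esub> \<Gamma>"
    using \<eta>(2) by (auto simp: space_pair_measure \<sigma>'(2) rcosets_SL2 r_coset_translate
      intro!: imageI SL2_mult_closed)
next
  note \<sigma>' = invariant_probabilityD[OF \<sigma>]
  fix \<U> assume "\<U> \<in> {\<U>. openin (coset_topology \<Gamma>) \<U>}"
  then have "openin (top_of_set (carrier SL2)) {g \<in> carrier SL2. \<Gamma> #>\<^bsub>SL2\<^esub> g \<in> \<U>}"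
    by (simp add: openin_coset_topology)
  then obtain W where W: "open W" "{g \<in> carrier SL2. \<Gamma> #>\<^bsub>SL2\<^esub> g \<in> \<U>} = carrier SL2 \<inter> W"
    by (auto simp: openin_open)
  have "open ((\<lambda>(g, h). g ** h) -` W :: (('a^2^2) \<times> ('a^2^2)) set)"
    by (intro open_vimage W(1)) (auto simp: split_beta intro!: continuous_intros)
  moreover obtain \<B> :: "('a^2^2) set set" where \<B>: "countable \<B>" "topological_basis \<B>"
    using ex_countable_basis by blast
  ultimately obtain \<R> where \<R>: "\<R> \<subseteq> (\<lambda>(A, B). A \<times> B) ` (\<B> \<times> \<B>)"
    "\<Union>\<R> = ((\<lambda>(g, h). g ** h) -` W :: (('a^2^2) \<times> ('a^2^2)) set)"
    using topological_basis_prod[OF \<B>(2) \<B>(2)] unfolding topological_basis_def by metis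
  define P where "P = {p \<in> \<B> \<times> \<B>. fst p \<times> snd p \<subseteq> (\<lambda>(g, h). g ** h) -` W}"
  have cP: "countable P" unfolding P_def using \<B>(1) by auto
  have eq: "(\<lambda>(c, m). c #>\<^bsub>SL2\<^esub> \<eta> m) -` \<U> \<inter> space (\<sigma> \<Otimes>\<^sub>M M) =
    (\<Union>p\<in>P. ((\<lambda>g. \<Gamma> #>\<^bsub>SL2\<^esub> g) ` (fst p \<inter> carrier SL2)) \<times> (\<eta> -` snd p \<inter> space M))" (is "?L = ?R")
  proof (intro equalityI subsetI)
    fix x assume x: "x \<in> ?L"
    then obtain g m where gm: "x = (\<Gamma> #>\<^bsub>SL2\<^esub> g, m)" "g \<in> carrier SL2" "m \<in> space M"
      by (auto simp: space_pair_measure \<sigma>'(2) rcosets_SL2)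
    have "g ** \<eta> m \<in> {g \<in> carrier SL2. \<Gamma> #>\<^bsub>SL2\<^esub> g \<in> \<U>}"
      using x gm \<eta>(2)[of m] by (auto simp: r_coset_translate)
    then have "(g, \<eta> m) \<in> \<Union>\<R>" unfolding \<R>(2) using W(2) by auto
    then obtain A B where AB: "A \<in> \<B>" "B \<in> \<B>" "A \<times> B \<in> \<R>" "g \<in> A" "\<eta> m \<in> B"
      using \<R>(1) by force
    then have "(A, B) \<in> P" unfolding P_def using \<R>(2) by auto
    then show "x \<in> ?R" using AB gm by (intro UN_I[of "(A, B)"]) auto
  next
    fix x assume "x \<in> ?R"
    then obtain A B g m where *: "(A, B) \<in> P" "x = (\<Gamma> #>\<^bsub>SL2\<^esub> g, m)" "g \<in> A" "g \<in> carrier SL2"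
      "\<eta> m \<in> B" "m \<in> space M" by fastforce
    then have "g ** \<eta> m \<in> W" unfolding P_def by auto
    then have "g ** \<eta> m \<in> {g \<in> carrier SL2. \<Gamma> #>\<^bsub>SL2\<^esub> g \<in> \<U>}"
      unfolding W(2) using * \<eta>(2)[of m] by auto
    then show "x \<in> ?L" using * by (auto simp: space_pair_measure \<sigma>'(2) rcosets_SL2 r_coset_translate)
  qed
  have "A \<in> \<B> \<Longrightarrow> open A" for A using \<B>(2) topological_basis_open by blast
  then have "((\<lambda>g. \<Gamma> #>\<^bsub>SL2\<^esub> g) ` (fst p \<inter> carrier SL2)) \<times> (\<eta> -` snd p \<inter> space M) \<in> sets (\<sigma> \<Otimes>\<^sub>M M)"
    if "p \<in> P" for p
  proof -
    from that have o: "open (fst p)" "open (snd p)"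
      using \<open>\<And>A. A \<in> \<B> \<Longrightarrow> open A\<close> unfolding P_def by auto
    have "(\<lambda>g. \<Gamma> #>\<^bsub>SL2\<^esub> g) ` (fst p \<inter> carrier SL2) \<in> sets \<sigma>"
      unfolding \<sigma>'(3) using openin_translate_set[OF \<Gamma> o(1)] by blast
    moreover have "\<eta> -` snd p \<inter> space M \<in> sets M"
      using \<eta>(1) o(2) by (auto intro: measurable_sets borel_open)
    ultimately show ?thesis by (rule pair_measureI)
  qed
  then show "(\<lambda>(c, m). c #>\<^bsub>SL2\<^esub> \<eta> m) -` \<U> \<inter> space (\<sigma> \<Otimes>\<^sub>M M) \<in> sets (\<sigma> \<Otimes>\<^sub>M M)"
    unfolding eq using cP by (intro sets.countable_UN') auto
qed

text \<open>Invariance of \<sigma> is given for images of sets; the preimage under translation by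
  \<open>h\<close> is the image under translation by \<open>adj2 h\<close>, which turns it into
  invariance of the push-forward.\<close>

lemma distr_coset_translate:
  fixes \<Gamma> :: "('a::{real_normed_field,euclidean_space}^2^2) set"
  assumes \<Gamma>: "subgroup \<Gamma> SL2" and \<sigma>: "invariant_probability \<Gamma> \<sigma>" and h: "h \<in> carrier SL2"
  shows "(\<lambda>c. c #>\<^bsub>SL2\<^esub> h) \<in> measurable \<sigma> \<sigma>" "distr \<sigma> \<sigma> (\<lambda>c. c #>\<^bsub>SL2\<^esub> h) = \<sigma>"
proof -
  note \<sigma>' = invariant_probabilityD[OF \<sigma>]
  have m: "(\<lambda>c. c #>\<^bsub>SL2\<^esub> k) \<in> measurable \<sigma> \<sigma>" if "k \<in> carrier SL2" for k
  proof -
    \<comment> \<open>A single translation is the joint action over a one-point parameter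
      space.\<close>
    have "(\<lambda>(c, m). c #>\<^bsub>SL2\<^esub> k) \<in> measurable (\<sigma> \<Otimes>\<^sub>M count_space {()}) \<sigma>"
      using that by (intro measurable_coset_action[OF \<Gamma> \<sigma>]) auto
    then have "(\<lambda>c. (\<lambda>(c, m). c #>\<^bsub>SL2\<^esub> k) (c, ())) \<in> measurable \<sigma> \<sigma>"
      by (rule measurable_compose[rotated]) auto
    then show ?thesis by simp
  qed
  show "(\<lambda>c. c #>\<^bsub>SL2\<^esub> h) \<in> measurable \<sigma> \<sigma>" by (rule m[OF h])
  show "distr \<sigma> \<sigma> (\<lambda>c. c #>\<^bsub>SL2\<^esub> h) = \<sigma>"
  proof (rule measure_eqI)
    fix B assume "B \<in> sets (distr \<sigma> \<sigma> (\<lambda>c. c #>\<^bsub>SL2\<^esub> h))"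
    then have B: "B \<in> sets \<sigma>" by simp
    have "(\<lambda>c. c #>\<^bsub>SL2\<^esub> h) -` B \<inter> space \<sigma> = (\<lambda>c. c #>\<^bsub>SL2\<^esub> adj2 h) ` B"
    proof (intro equalityI subsetI)
      fix c assume c: "c \<in> (\<lambda>c. c #>\<^bsub>SL2\<^esub> h) -` B \<inter> space \<sigma>"
      then obtain g where g: "c = \<Gamma> #>\<^bsub>SL2\<^esub> g" by (auto simp: \<sigma>'(2) rcosets_SL2)
      have "c = (c #>\<^bsub>SL2\<^esub> h) #>\<^bsub>SL2\<^esub> adj2 h"
        using h by (simp add: g r_coset_translate flip: matrix_mul_assoc)
      then show "c \<in> (\<lambda>c. c #>\<^bsub>SL2\<^esub> adj2 h) ` B" using c by blast
    next
      fix c assume "c \<in> (\<lambda>c. c #>\<^bsub>SL2\<^esub> adj2 h) ` B"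
      then obtain b where b: "b \<in> B" "c = b #>\<^bsub>SL2\<^esub> adj2 h" by auto
      then obtain g where g: "b = \<Gamma> #>\<^bsub>SL2\<^esub> g" "g \<in> carrier SL2"
        using sets.sets_into_space[OF B] by (auto simp: \<sigma>'(2) rcosets_SL2)
      then show "c \<in> (\<lambda>c. c #>\<^bsub>SL2\<^esub> h) -` B \<inter> space \<sigma>"
        using h b by (auto simp: \<sigma>'(2) rcosets_SL2 r_coset_translate simp flip: matrix_mul_assoc)
    qed
    then show "emeasure (distr \<sigma> \<sigma> (\<lambda>c. c #>\<^bsub>SL2\<^esub> h)) B = emeasure \<sigma> B"
      using B h \<sigma>'(4)[of "adj2 h" B] by (simp add: emeasure_distr[OF m[OF h]] adj2_closed)
  qed simp
qed

text \<open>
  The function \<open>u\<close> need not be measurable: its integral is the supremum of the integrals of the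
  simple functions below it, to which Tonelli's theorem applies.
\<close>

lemma nn_integral_le_of_averages:
  fixes \<Gamma> :: "('a::{real_normed_field,euclidean_space}^2^2) set"
  assumes \<Gamma>: "subgroup \<Gamma> SL2" and \<sigma>: "invariant_probability \<Gamma> \<sigma>" and "prob_space M"
    and \<eta>: "\<eta> \<in> borel_measurable M" "\<And>m. m \<in> space M \<Longrightarrow> \<eta> m \<in> carrier SL2"
    and u: "\<And>g. g \<in> carrier SL2 \<Longrightarrow> (\<integral>\<^sup>+m. u (\<Gamma> #>\<^bsub>SL2\<^esub> (g ** \<eta> m)) \<partial>M) \<le> C"
  shows "(\<integral>\<^sup>+c. u c \<partial>\<sigma>) \<le> C"
proof -
  note \<sigma>' = invariant_probabilityD[OF \<sigma>]
  interpret M: prob_space M by fact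
  interpret \<sigma>: prob_space \<sigma> by (rule \<sigma>'(1))
  interpret pair_sigma_finite \<sigma> M ..
  have "integral\<^sup>S \<sigma> s \<le> C" if s: "simple_function \<sigma> s" "s \<le> u" for s
  proof -
    have [measurable]: "s \<in> borel_measurable \<sigma>" using s(1) by (rule borel_measurable_simple_function)
    have "(\<lambda>x. s (case x of (c, m) \<Rightarrow> c #>\<^bsub>SL2\<^esub> \<eta> m)) \<in> borel_measurable (\<sigma> \<Otimes>\<^sub>M M)"
      by (rule measurable_compose[OF measurable_coset_action[OF \<Gamma> \<sigma> \<eta>]]) auto
    then have joint: "(\<lambda>(c, m). s (c #>\<^bsub>SL2\<^esub> \<eta> m)) \<in> borel_measurable (\<sigma> \<Otimes>\<^sub>M M)"
      by (simp add: split_beta')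
    have "integral\<^sup>S \<sigma> s = (\<integral>\<^sup>+c. s c \<partial>\<sigma>)" using s(1) by (simp add: nn_integral_eq_simple_integral)
    \<comment> \<open>Averaging a constant over \<open>M\<close> makes room for a different
      translation of \<open>c\<close> for each \<open>m\<close>, before the order of integration is
      exchanged.\<close>
    also have "\<dots> = (\<integral>\<^sup>+m. (\<integral>\<^sup>+c. s c \<partial>\<sigma>) \<partial>M)" by (simp add: M.emeasure_space_1)
    also have "\<dots> = (\<integral>\<^sup>+m. (\<integral>\<^sup>+c. s (c #>\<^bsub>SL2\<^esub> \<eta> m) \<partial>\<sigma>) \<partial>M)"
    proof (rule nn_integral_cong)
      fix m assume "m \<in> space M"
      note d = distr_coset_translate[OF \<Gamma> \<sigma> \<eta>(2)[OF this]]
      have "(\<integral>\<^sup>+c. s c \<partial>\<sigma>) = (\<integral>\<^sup>+c. s c \<partial>(distr \<sigma> \<sigma> (\<lambda>c. c #>\<^bsub>SL2\<^esub> \<eta> m)))" by (simp add: d(2))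
      also have "\<dots> = (\<integral>\<^sup>+c. s (c #>\<^bsub>SL2\<^esub> \<eta> m) \<partial>\<sigma>)"
        by (rule nn_integral_distr[OF d(1)]) simp
      finally show "(\<integral>\<^sup>+c. s c \<partial>\<sigma>) = (\<integral>\<^sup>+c. s (c #>\<^bsub>SL2\<^esub> \<eta> m) \<partial>\<sigma>)" .
    qed
    also have "\<dots> = (\<integral>\<^sup>+c. (\<integral>\<^sup>+m. s (c #>\<^bsub>SL2\<^esub> \<eta> m) \<partial>M) \<partial>\<sigma>)"
      using Fubini'[OF joint] .
    also have "\<dots> \<le> (\<integral>\<^sup>+c. C \<partial>\<sigma>)"
    proof (rule nn_integral_mono)
      fix c assume "c \<in> space \<sigma>"
      then obtain g where g: "g \<in> carrier SL2" "c = \<Gamma> #>\<^bsub>SL2\<^esub> g" by (auto simp: \<sigma>'(2) rcosets_SL2)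
      have "(\<integral>\<^sup>+m. s (c #>\<^bsub>SL2\<^esub> \<eta> m) \<partial>M) \<le> (\<integral>\<^sup>+m. u (\<Gamma> #>\<^bsub>SL2\<^esub> (g ** \<eta> m)) \<partial>M)"
        using s(2) by (intro nn_integral_mono) (auto simp: le_fun_def g r_coset_translate)
      also have "\<dots> \<le> C" by (rule u[OF g(1)])
      finally show "(\<integral>\<^sup>+m. s (c #>\<^bsub>SL2\<^esub> \<eta> m) \<partial>M) \<le> C" .
    qed
    also have "\<dots> = C" by (simp add: \<sigma>.emeasure_space_1)
    finally show ?thesis .
  qed
  then show ?thesis unfolding nn_integral_def by (intro SUP_least) auto
qed

section \<open>Lattices with a cusp at infinity\<close>

lemma tendsto_matrix2:
  fixes f :: "nat \<Rightarrow> 'a::real_normed_field^2^2"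
  assumes "\<And>i j. (\<lambda>n. f n $ i $ j) \<longlonglongrightarrow> A $ i $ j"
  shows "f \<longlonglongrightarrow> A"
  by (intro vec_tendstoI assms)

lemma discrete_eventually_eq:
  assumes "discrete \<Gamma>" "A \<in> \<Gamma>" "\<And>n. f n \<in> \<Gamma>" "f \<longlonglongrightarrow> A"
  shows "\<exists>n. f n = A"
proof -
  obtain T where T: "open T" "T \<inter> \<Gamma> = {A}"
    using assms(1,2) unfolding discrete_def isolated_in_def by blast
  then have "eventually (\<lambda>n. f n \<in> T) sequentially"
    using assms(4) by (auto simp: tendsto_def)
  then obtain n where "f n \<in> T" by (auto simp: eventually_sequentially)
  then show ?thesis using T(2) assms(3) by blast
qed

text \<open>Nilpotency of \<open>u - mat 1\<close> is read off the lower right entry of its powers,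
  which for an upper triangular matrix is a power of \<open>u $ 2 $ 2 - 1\<close>.\<close>

lemma cusp_translation:
  assumes "cusp_at_infinity \<Gamma>"
  obtains h where "h \<noteq> 0" "n_mat h \<in> \<Gamma>"
proof -
  from assms obtain u n where u: "u \<in> \<Gamma>" "u \<in> upper_P" "u \<noteq> mat 1"
    and n: "((\<lambda>B. (u - mat 1) ** B) ^^ n) (mat 1) = 0"
    by (auto simp: cusp_at_infinity_def Gamma_inf_def unipotent_def)
  have u21: "u $ 2 $ 1 = 0" and det: "u $ 1 $ 1 * u $ 2 $ 2 = 1"
    using u(2) by (auto simp: upper_P_def carrier_SL2_iff)
  have "((\<lambda>B. (u - mat 1) ** B) ^^ m) (mat 1) $ 2 $ 1 = 0 \<and>
      ((\<lambda>B. (u - mat 1) ** B) ^^ m) (mat 1) $ 2 $ 2 = (u $ 2 $ 2 - 1) ^ m" for m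
    by (induction m) (auto simp: u21)
  from this[of n] have "u $ 2 $ 2 = 1" by (simp add: n)
  with det have "u = n_mat (u $ 1 $ 2)"
    by (simp add: matrix2_eq_iff u21 n_mat_def)
  moreover from this have "u $ 1 $ 2 \<noteq> 0" using u(3) by (auto simp: matrix2_eq_iff n_mat_def)
  ultimately show thesis using u(1) that by metis
qed

lemma conj_n_mat:
  assumes "g \<in> carrier SL2"
  shows "g ** n_mat h ** adj2 g = mat2 (1 - g $ 1 $ 1 * g $ 2 $ 1 * h) ((g $ 1 $ 1)\<^sup>2 * h)
    (- ((g $ 2 $ 1)\<^sup>2 * h)) (1 + g $ 1 $ 1 * g $ 2 $ 1 * h)"
  using assms by (simp add: matrix2_eq_iff carrier_SL2_iff adj2_def n_mat_def algebra_simps power2_eq_square)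

text \<open>Shimizu's lemma: iterating \<open>g \<mapsto> g n\<^sub>h g\<^sup>-\<^sup>1\<close> from a small lower left entry converges to \<open>n\<^sub>h\<close>.\<close>

lemma lower_left_gap:
  assumes \<Gamma>: "subgroup \<Gamma> SL2" "discrete \<Gamma>" and h: "n_mat h \<in> \<Gamma>" "h \<noteq> 0"
    and g: "g \<in> \<Gamma>" "g $ 2 $ 1 \<noteq> 0"
  shows "1 \<le> norm (g $ 2 $ 1) * norm h"
proof (rule ccontr)
  assume neg: "\<not> 1 \<le> norm (g $ 2 $ 1) * norm h"
  note sg = subgroup_SL2D[OF \<Gamma>(1)]
  define q where "q = norm (g $ 2 $ 1) * norm h"
  have q: "0 \<le> q" "q < 1" using neg by (auto simp: q_def)
  define G where "G n = ((\<lambda>g. g ** n_mat h ** adj2 g) ^^ n) g" for n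
  have G0: "G 0 = g" and GS: "G (Suc n) = G n ** n_mat h ** adj2 (G n)" for n by (simp_all add: G_def)
  have Gin: "G n \<in> \<Gamma>" for n by (induction n) (auto simp: G0 GS g h intro!: sg)
  have rec: "G (Suc n) = mat2 (1 - G n $ 1 $ 1 * G n $ 2 $ 1 * h) ((G n $ 1 $ 1)\<^sup>2 * h)
    (- ((G n $ 2 $ 1)\<^sup>2 * h)) (1 + G n $ 1 $ 1 * G n $ 2 $ 1 * h)" for n
    unfolding GS by (rule conj_n_mat) (use sg Gin in auto)
  define c where "c n = G n $ 2 $ 1 * h" for n
  define a where "a n = G n $ 1 $ 1" for n
  have cS: "c (Suc n) = - (c n)\<^sup>2" and aS: "a (Suc n) = 1 - a n * c n" for n
    by (simp_all add: c_def a_def rec power2_eq_square algebra_simps)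
  have c0: "norm (c 0) = q" by (simp add: c_def G0 q_def norm_mult)
  have cn: "norm (c n) \<le> q ^ Suc n" for n
  proof (induction n)
    case (Suc n)
    have "norm (c (Suc n)) = (norm (c n))\<^sup>2" by (simp add: cS norm_power)
    also have "\<dots> \<le> (q ^ Suc n)\<^sup>2" using Suc by (intro power_mono) auto
    also have "\<dots> = q ^ (2 * Suc n)" by (simp only: power_mult[symmetric] mult.commute)
    also have "\<dots> \<le> q ^ Suc (Suc n)" using q by (intro power_decreasing) auto
    finally show ?case .
  qed (simp add: c0)
  have c_lim: "c \<longlonglongrightarrow> 0"
  proof (rule Lim_null_comparison)
    show "\<forall>\<^sub>F n in sequentially. norm (c n) \<le> q ^ Suc n" using cn by auto
    show "(\<lambda>n. q ^ Suc n) \<longlonglongrightarrow> 0" using q by (intro LIMSEQ_Suc LIMSEQ_realpow_zero) auto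
  qed
  \<comment> \<open>The bound must survive \<open>a (Suc n) = 1 - a n * c n\<close> with
    \<open>norm (c n) \<le> q\<close>; the fixed point of x = 1 + q x dictates 1 / (1 - q).\<close>
  define B where "B = max (norm (a 0)) (1 / (1 - q))"
  have aB: "norm (a n) \<le> B" for n
  proof (induction n)
    case (Suc n)
    have B: "1 / (1 - q) \<le> B" by (simp add: B_def)
    then have "1 \<le> B * (1 - q)" using q by (simp add: pos_divide_le_eq)
    then have B1: "1 + B * q \<le> B" by (simp add: algebra_simps)
    have B0: "0 \<le> B" unfolding B_def by (simp add: le_max_iff_disj)
    have "norm (c n) \<le> q" using cn[of n] power_decreasing[of 1 "Suc n" q] q by simp
    then have "norm (a n * c n) \<le> B * q" using Suc B0 by (simp add: norm_mult mult_mono)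
    then have "norm (a (Suc n)) \<le> 1 + B * q"
      unfolding aS using norm_triangle_ineq4[of 1 "a n * c n"] by simp
    then show ?case using B1 by simp
  qed (simp add: B_def)
  have ac: "(\<lambda>n. a n * c n) \<longlonglongrightarrow> 0"
  proof (rule Lim_null_comparison)
    show "\<forall>\<^sub>F n in sequentially. norm (a n * c n) \<le> B * norm (c n)"
      using aB by (simp add: norm_mult mult_right_mono)
    show "(\<lambda>n. B * norm (c n)) \<longlonglongrightarrow> 0" using tendsto_mult[OF tendsto_const tendsto_norm_zero[OF c_lim], of B] by simp
  qed
  have "(\<lambda>n. a (Suc n)) \<longlonglongrightarrow> 1" unfolding aS using tendsto_diff[OF tendsto_const[of 1] ac] by simp
  then have a_lim: "a \<longlonglongrightarrow> 1" by (rule LIMSEQ_imp_Suc)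
  have Gc: "G n $ 2 $ 1 \<noteq> 0" for n
    by (induction n) (use g h in \<open>auto simp: G0 rec\<close>)
  have "(\<lambda>n. G (Suc n)) \<longlonglongrightarrow> n_mat h"
  proof (rule tendsto_matrix2)
    fix i j :: 2
    have l11: "(\<lambda>n. 1 - a n * c n) \<longlonglongrightarrow> 1" "(\<lambda>n. 1 + a n * c n) \<longlonglongrightarrow> 1"
      using tendsto_diff[OF tendsto_const[of 1] ac] tendsto_add[OF tendsto_const[of 1] ac] by simp_all
    have l12: "(\<lambda>n. (a n)\<^sup>2 * h) \<longlonglongrightarrow> h"
      using tendsto_mult[OF tendsto_power[OF a_lim, of 2] tendsto_const[of h]] by simp
    have l21: "(\<lambda>n. - (c n * c n / h)) \<longlonglongrightarrow> 0"
      using tendsto_minus[OF tendsto_divide[OF tendsto_mult[OF c_lim c_lim] tendsto_const[of h] h(2)]] by simp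
    have *: "(\<lambda>n. - ((G n $ 2 $ 1)\<^sup>2 * h)) = (\<lambda>n. - (c n * c n / h))"
      using h(2) by (simp add: c_def power2_eq_square field_simps)
    show "(\<lambda>n. G (Suc n) $ i $ j) \<longlonglongrightarrow> n_mat h $ i $ j"
      using exhaust_2[of i] exhaust_2[of j] l11 l12 l21
      by (auto simp: rec n_mat_def * a_def[symmetric] c_def mult.assoc)
  qed
  \<comment> \<open>Discreteness makes some iterate equal to \<open>n_mat h\<close>, but squaring
    never turns a nonzero lower left entry into zero.\<close>
  then obtain n where "G (Suc n) = n_mat h"
    using discrete_eventually_eq[OF \<Gamma>(2) h(1), of "\<lambda>n. G (Suc n)"] Gin by blast
  then show False using Gc[of "Suc n"] by (simp add: n_mat_def)
qed

text \<open>Conjugation by \<open>p\<close> multiplies the translation length by the square of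
  \<open>p $ 1 $ 1\<close>. If this has norm below one, iteration produces nontrivial translations
  in \<Gamma> tending to the identity, against discreteness. The same applied to the inverse leaves
  only norm one.\<close>

lemma parabolic_norm_one:
  assumes \<Gamma>: "subgroup \<Gamma> SL2" "discrete \<Gamma>" and h: "n_mat h \<in> \<Gamma>" "h \<noteq> 0" and g: "g \<in> \<Gamma>" "g $ 2 $ 1 = 0"
  shows "g \<in> subgroup_Q"
proof -
  note sg = subgroup_SL2D[OF \<Gamma>(1)]
  have ge: "1 \<le> norm (p $ 1 $ 1)" if p: "p \<in> \<Gamma>" "p $ 2 $ 1 = 0" for p
  proof (rule ccontr)
    assume "\<not> 1 \<le> norm (p $ 1 $ 1)"
    then have lt: "norm ((p $ 1 $ 1)\<^sup>2) < 1" by (simp add: norm_power power_less_one_iff)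
    define a where "a = (p $ 1 $ 1)\<^sup>2"
    have a0: "a \<noteq> 0" using sg(1)[OF p(1)] p(2) by (auto simp: carrier_SL2_iff a_def)
    have step: "n_mat (a ^ n * h) \<in> \<Gamma>" for n
    proof (induction n)
      case (Suc n)
      have "p ** n_mat (a ^ n * h) ** adj2 p \<in> \<Gamma>" using Suc p sg by auto
      also have "p ** n_mat (a ^ n * h) ** adj2 p = n_mat (a ^ Suc n * h)"
        using p sg by (subst conj_n_mat) (auto simp: n_mat_def a_def mult.assoc)
      finally show ?case .
    qed (simp add: h)
    have "(\<lambda>n. a ^ n * h) \<longlonglongrightarrow> 0"
      using tendsto_mult[OF LIMSEQ_power_zero[OF lt] tendsto_const[of h]] by (simp add: a_def)
    then have "(\<lambda>n. n_mat (a ^ n * h)) \<longlonglongrightarrow> mat 1"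
    proof (intro tendsto_matrix2)
      fix i j :: 2
      assume "(\<lambda>n. a ^ n * h) \<longlonglongrightarrow> 0"
      then show "(\<lambda>n. n_mat (a ^ n * h) $ i $ j) \<longlonglongrightarrow> mat 1 $ i $ j"
        using exhaust_2[of i] exhaust_2[of j] by (auto simp: n_mat_def)
    qed
    then obtain n where "n_mat (a ^ n * h) = (mat 1 :: 'a^2^2)"
      using discrete_eventually_eq[OF \<Gamma>(2) sg(4), of "\<lambda>n. n_mat (a ^ n * h)"] step by blast
    then show False using a0 h(2) by (auto simp: n_mat_def matrix2_eq_iff)
  qed
  have det: "g $ 1 $ 1 * g $ 2 $ 2 = 1" using sg(1)[OF g(1)] g(2) by (simp add: carrier_SL2_iff)
  have "1 \<le> norm (g $ 1 $ 1)" using ge g by blast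
  moreover have "1 \<le> norm (g $ 2 $ 2)" using ge[OF sg(3)[OF g(1)]] g(2) by (simp add: adj2_def)
  moreover have "norm (g $ 1 $ 1) * norm (g $ 2 $ 2) = 1" using det by (metis norm_mult norm_one)
  ultimately have n1: "norm (g $ 1 $ 1) = 1"
    by (smt (verit) mult_left_le mult_less_cancel_left2)
  have "g $ 1 $ 1 \<noteq> 0" using det by auto
  then have "g $ 2 $ 2 = inverse (g $ 1 $ 1)" using det by (simp add: field_simps)
  then have "g = mat2 (g $ 1 $ 1) (g $ 1 $ 2) 0 (inverse (g $ 1 $ 1))"
    by (simp add: matrix2_eq_iff g(2))
  then show ?thesis unfolding subgroup_Q_def using n1 by blast
qed

section \<open>Packing\<close>

text \<open>Balls of radius \<rho>/2 about the points are disjoint and lie in the ball of radius T +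
  \<rho>/2; comparing volumes gives the count.\<close>

lemma packing_bound:
  fixes S :: "'b::euclidean_space set"
  assumes "finite S" "S \<subseteq> cball z T" "\<rho> > 0" "T \<ge> 0"
    and sep: "\<And>x y. x \<in> S \<Longrightarrow> y \<in> S \<Longrightarrow> x \<noteq> y \<Longrightarrow> \<rho> \<le> dist x y"
  shows "real (card S) \<le> (2 * T / \<rho> + 1) ^ DIM('b)"
proof -
  let ?\<omega> = "unit_ball_vol (real DIM('b))"
  have \<omega>: "?\<omega> > 0" by simp
  have disj: "disjoint_family_on (\<lambda>x. ball x (\<rho>/2)) S"
    unfolding disjoint_family_on_def
  proof (intro ballI impI)
    fix x y assume xy: "x \<in> S" "y \<in> S" "x \<noteq> y"
    show "ball x (\<rho>/2) \<inter> ball y (\<rho>/2) = {}"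
      using sep[OF xy] by (intro disjoint_ballI) auto
  qed
  have "real (card S) * (?\<omega> * (\<rho>/2) ^ DIM('b)) = (\<Sum>x\<in>S. measure lborel (ball x (\<rho>/2)))"
    using assms(3) by (simp add: content_ball)
  also have "\<dots> = measure lborel (\<Union>x\<in>S. ball x (\<rho>/2))"
    using disj assms(1) by (intro measure_finite_Union[symmetric]) (auto simp: emeasure_ball less_imp_le[OF assms(3)])
  also have "\<dots> \<le> measure lborel (cball z (T + \<rho>/2))"
  proof (rule measure_mono_fmeasurable)
    show "(\<Union>x\<in>S. ball x (\<rho>/2)) \<in> sets lborel" using assms(1) by auto
    show "cball z (T + \<rho>/2) \<in> fmeasurable lborel"
      using assms(3,4) by (intro fmeasurableI) (auto simp: emeasure_cball)
    show "(\<Union>x\<in>S. ball x (\<rho>/2)) \<subseteq> cball z (T + \<rho>/2)"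
    proof
      fix y assume "y \<in> (\<Union>x\<in>S. ball x (\<rho>/2))"
      then obtain x where x: "x \<in> S" "dist x y < \<rho>/2" by auto
      then have "dist z x \<le> T" using assms(2) by auto
      then show "y \<in> cball z (T + \<rho>/2)" using x dist_triangle[of z y x] by auto
    qed
  qed
  also have "\<dots> = ?\<omega> * (T + \<rho>/2) ^ DIM('b)" using assms by (simp add: content_cball)
  finally have "real (card S) * (\<rho>/2) ^ DIM('b) \<le> (T + \<rho>/2) ^ DIM('b)"
    using \<omega> by (simp add: mult.left_commute)
  then have "real (card S) \<le> (T + \<rho>/2) ^ DIM('b) / (\<rho>/2) ^ DIM('b)"
    using assms(3) by (simp add: field_simps)
  also have "\<dots> = ((T + \<rho>/2) / (\<rho>/2)) ^ DIM('b)" by (simp only: power_divide)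
  also have "(T + \<rho>/2) / (\<rho>/2) = 2 * T / \<rho> + 1"
    using assms(3) by (simp add: add_divide_distrib)
  finally show ?thesis .
qed

text \<open>Every finite subset obeys the same packing bound.\<close>

lemma finite_packing:
  fixes S :: "'b::euclidean_space set"
  assumes "S \<subseteq> cball z T" "\<rho> > 0" "T \<ge> 0"
    and sep: "\<And>x y. x \<in> S \<Longrightarrow> y \<in> S \<Longrightarrow> x \<noteq> y \<Longrightarrow> \<rho> \<le> dist x y"
  shows "finite S"
proof (rule conjunct1[OF finite_if_finite_subsets_card_bdd])
  fix F assume F: "F \<subseteq> S" "finite F"
  have "real (card F) \<le> (2 * T / \<rho> + 1) ^ DIM('b)"
    using F assms(1-3) by (intro packing_bound[of F z T]) (auto intro!: sep)
  then show "card F \<le> nat \<lfloor>(2 * T / \<rho> + 1) ^ DIM('b)\<rfloor>" by linarith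
qed

text \<open>Dyadic annuli: between T/2 and T there are at most 9 T^2/\<rho>^2 points of weight at
  most 2/T, a contribution of 18 T/\<rho>^2, and halving T repeatedly gives a geometric series with
  sum 36 T/\<rho>^2. The linear growth in T reflects dimension two.\<close>

lemma sum_inverse_dist_le:
  fixes z :: "'b::euclidean_space"
  assumes "finite S" "DIM('b) = 2" "\<rho> > 0" "T \<ge> 0"
    and sep: "\<And>x y. x \<in> insert z S \<Longrightarrow> y \<in> insert z S \<Longrightarrow> x \<noteq> y \<Longrightarrow> \<rho> \<le> dist x y"
  shows "(\<Sum>x\<in>{x \<in> S. x \<noteq> z \<and> dist z x \<le> T}. 1 / dist z x) \<le> 36 * T / \<rho>\<^sup>2"
proof -
  \<comment> \<open>Induction on the number of halvings after which the radius falls below the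
    separation, where the sum is empty.\<close>
  have main: "T < \<rho> * 2 ^ n \<Longrightarrow> T \<ge> 0 \<Longrightarrow>
    (\<Sum>x\<in>{x \<in> S. x \<noteq> z \<and> dist z x \<le> T}. 1 / dist z x) \<le> 36 * T / \<rho>\<^sup>2" for n T
  proof (induction n arbitrary: T)
    case 0
    have "{x \<in> S. x \<noteq> z \<and> dist z x \<le> T} = {}" using sep[of z] 0 by force
    then show ?case using 0 by (simp only:) (simp add: assms(3))
  next
    case (Suc n)
    show ?case
    proof (cases "T < \<rho>")
      case True
      then have "{x \<in> S. x \<noteq> z \<and> dist z x \<le> T} = {}" using sep[of z] by force
      then show ?thesis using Suc.prems by (simp only:) (simp add: assms(3))
    next
      case False
      let ?A = "{x \<in> S. x \<noteq> z \<and> dist z x \<le> T}"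
      let ?B = "{x \<in> S. x \<noteq> z \<and> dist z x \<le> T/2}"
      have "(\<Sum>x\<in>?A. 1 / dist z x) = (\<Sum>x\<in>?B. 1 / dist z x) + (\<Sum>x\<in>?A-?B. 1 / dist z x)"
        using assms(1) Suc.prems by (subst sum.subset_diff[of ?B ?A]) auto
      also have "(\<Sum>x\<in>?B. 1 / dist z x) \<le> 36 * (T/2) / \<rho>\<^sup>2"
        using Suc.prems by (intro Suc.IH) auto
      also have "(\<Sum>x\<in>?A-?B. 1 / dist z x) \<le> (\<Sum>x\<in>?A-?B. 2 / T)"
        using False assms(3) by (intro sum_mono) (auto simp: field_simps)
      also have "\<dots> = real (card (?A - ?B)) * (2 / T)" by simp
      also have "\<dots> \<le> (9 * T\<^sup>2 / \<rho>\<^sup>2) * (2 / T)"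
      proof (rule mult_right_mono)
        have "real (card (?A - ?B)) \<le> (2 * T / \<rho> + 1) ^ DIM('b)"
          using assms(1,3) Suc.prems sep by (intro packing_bound[of _ z]) auto
        also have "\<dots> \<le> (3 * T / \<rho>)\<^sup>2"
          unfolding assms(2) using False assms(3) by (intro power_mono) (auto simp: field_simps)
        finally show "real (card (?A - ?B)) \<le> 9 * T\<^sup>2 / \<rho>\<^sup>2" by (simp add: power_divide power_mult_distrib)
      qed (use Suc.prems in auto)
      also have "36 * (T/2) / \<rho>\<^sup>2 + (9 * T\<^sup>2 / \<rho>\<^sup>2) * (2 / T) = 36 * T / \<rho>\<^sup>2"
        using False assms(3) by (simp add: field_simps power2_eq_square)
      finally show ?thesis by simp
    qed
  qed
  obtain n where "T / \<rho> < 2 ^ n" using real_arch_pow[of 2 "T / \<rho>"] by auto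
  then show ?thesis using assms(3,4) by (intro main[of _ n]) (auto simp: field_simps)
qed

section \<open>Averaging a radial function\<close>

text \<open>Reflection turns the decreasing substitution into an increasing one. Equality weakens to
  an inequality because \<open>g\<close> covers only part of the line; an empty or one-point
  interval contributes nothing.\<close>

lemma nn_integral_substitution_antimono:
  fixes \<Phi> :: "real \<Rightarrow> ennreal"
  assumes \<Phi>: "\<Phi> \<in> borel_measurable borel"
    and deriv: "\<And>x. x \<in> {a..b} \<Longrightarrow> (g has_real_derivative g' x) (at x)"
    and cont: "continuous_on {a..b} g'" and neg: "\<And>x. x \<in> {a..b} \<Longrightarrow> g' x \<le> 0"
  shows "(\<integral>\<^sup>+x. \<Phi> (g x) * ennreal \<bar>g' x\<bar> * indicator {a..b} x \<partial>lborel) \<le> (\<integral>\<^sup>+x. \<Phi> x \<partial>lborel)"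
proof (cases "a < b")
  case True
  have "(\<integral>\<^sup>+x. \<Phi> (g x) * ennreal \<bar>g' x\<bar> * indicator {a..b} x \<partial>lborel) =
    (\<integral>\<^sup>+x. \<Phi> (- (- g x)) * ennreal (- g' x) * indicator {a..b} x \<partial>lborel)"
    using neg by (intro nn_integral_cong) (auto split: split_indicator)
  also have "\<dots> = (\<integral>\<^sup>+x. \<Phi> (- x) * indicator {- g a..- g b} x \<partial>lborel)"
    using \<Phi> deriv neg cont True
    by (intro nn_integral_substitution_aux[symmetric])
      (auto intro!: derivative_eq_intros continuous_intros)
  also have "\<dots> \<le> (\<integral>\<^sup>+x. \<Phi> (- x) \<partial>lborel)"
    by (intro nn_integral_mono) (auto split: split_indicator)
  also have "\<dots> = (\<integral>\<^sup>+x. \<Phi> x \<partial>lborel)"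
    using nn_integral_real_affine[OF \<Phi>, of "-1" 0] by simp
  finally show ?thesis .
next
  case False
  then have "(\<integral>\<^sup>+x. \<Phi> (g x) * ennreal \<bar>g' x\<bar> * indicator {a..b} x \<partial>lborel) =
    (\<integral>\<^sup>+x. \<Phi> (g x) * ennreal \<bar>g' x\<bar> * indicator {a} x * (if a = b then 1 else 0) \<partial>lborel)"
    by (intro nn_integral_cong) (auto split: split_indicator)
  also have "\<dots> \<le> (\<integral>\<^sup>+x. \<Phi> (g a) * ennreal \<bar>g' a\<bar> * indicator {a} x \<partial>lborel)"
    by (intro nn_integral_mono) (auto split: split_indicator)
  also have "\<dots> = 0" by (simp add: nn_integral_cmult_indicator)
  finally show ?thesis by simp
qed

lemma nn_integral_substitution_mono:
  fixes \<Phi> :: "real \<Rightarrow> ennreal"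
  assumes \<Phi>: "\<Phi> \<in> borel_measurable borel"
    and deriv: "\<And>x. x \<in> {a..b} \<Longrightarrow> (g has_real_derivative g' x) (at x)"
    and cont: "continuous_on {a..b} g'" and pos: "\<And>x. x \<in> {a..b} \<Longrightarrow> g' x \<ge> 0"
  shows "(\<integral>\<^sup>+x. \<Phi> (g x) * ennreal \<bar>g' x\<bar> * indicator {a..b} x \<partial>lborel) \<le> (\<integral>\<^sup>+x. \<Phi> x \<partial>lborel)"
proof -
  have "(\<integral>\<^sup>+x. (\<lambda>y. \<Phi> (- y)) (- g x) * ennreal \<bar>- g' x\<bar> * indicator {a..b} x \<partial>lborel)
    \<le> (\<integral>\<^sup>+x. \<Phi> (- x) \<partial>lborel)"
    using \<Phi> deriv cont pos
    by (intro nn_integral_substitution_antimono[where \<Phi> = "\<lambda>y. \<Phi> (- y)" and g = "\<lambda>x. - g x" and g' = "\<lambda>x. - g' x"])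
      (auto intro!: derivative_eq_intros continuous_intros)
  also have "\<dots> = (\<integral>\<^sup>+x. \<Phi> x \<partial>lborel)"
    using nn_integral_real_affine[OF \<Phi>, of "-1" 0] by simp
  finally show ?thesis by simp
qed

text \<open>The derivative of \<open>g\<close> has the sign opposite to that of the increasing
  function \<open>k\<close>, so \<open>g\<close> rises up to one point and falls after it. Each
  monotone branch contributes at most one copy of the integral.\<close>

lemma nn_integral_substitution_unimodal:
  fixes \<Phi> :: "real \<Rightarrow> ennreal"
  assumes \<Phi>[measurable]: "\<Phi> \<in> borel_measurable borel"
    and deriv: "\<And>x. x \<in> {0..1} \<Longrightarrow> (g has_real_derivative - k x * w x) (at x)"
    and cont: "continuous_on {0..1} k" "continuous_on {0..1} w"
    and k: "mono_on {0..1} k" and w: "\<And>x. x \<in> {0..1} \<Longrightarrow> w x \<ge> 0"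
  shows "(\<integral>\<^sup>+x. \<Phi> (g x) * ennreal \<bar>k x * w x\<bar> * indicator {0..1} x \<partial>lborel) \<le> 2 * (\<integral>\<^sup>+x. \<Phi> x \<partial>lborel)"
proof -
  \<comment> \<open>The turning point; if \<open>k\<close> has constant sign it is an endpoint and
    one of the two branches degenerates to a point.\<close>
  obtain p where p: "p \<in> {0..1}" "\<And>x. x \<in> {0..p} \<Longrightarrow> k x \<le> 0 \<or> p = 0" "\<And>x. x \<in> {p..1} \<Longrightarrow> k x \<ge> 0 \<or> p = 1"
  proof -
    consider "k 0 \<ge> 0" | "k 1 \<le> 0" | "k 0 \<le> 0" "0 \<le> k 1" by linarith
    then show thesis
    proof cases
      case 1
      then have "k x \<ge> 0" if "x \<in> {0..1}" for x using mono_onD[OF k, of 0 x] that by auto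
      then show thesis by (intro that[of 0]) auto
    next
      case 2
      then have "k x \<le> 0" if "x \<in> {0..1}" for x using mono_onD[OF k, of x 1] that by auto
      then show thesis by (intro that[of 1]) auto
    next
      case 3
      then obtain p where p: "0 \<le> p" "p \<le> 1" "k p = 0" using IVT'[of k 0 0 1] cont(1) by auto
      then have "k x \<le> 0" if "x \<in> {0..p}" for x using mono_onD[OF k, of x p] that by auto
      moreover have "k x \<ge> 0" if "x \<in> {p..1}" for x using mono_onD[OF k, of p x] that p by auto
      ultimately show thesis using p by (intro that[of p]) auto
    qed
  qed
  let ?f = "\<lambda>a b x. \<Phi> (g x) * ennreal \<bar>- k x * w x\<bar> * indicator {a..b} x"
  have g: "continuous_on {0..1} g"
    by (rule has_real_derivative_imp_continuous_on[OF deriv])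
  have piece: "?f a b \<in> borel_measurable lborel" if "0 \<le> a" "b \<le> 1" for a b
  proof -
    have sub: "{a..b} \<subseteq> {0..1}" using that by auto
    have [measurable]: "(\<lambda>x. indicator {a..b} x *\<^sub>R g x) \<in> borel_measurable borel"
      "(\<lambda>x. indicator {a..b} x *\<^sub>R \<bar>- k x * w x\<bar>) \<in> borel_measurable borel"
      by (intro borel_measurable_continuous_on_indicator continuous_intros
          continuous_on_subset[OF g sub] continuous_on_subset[OF cont(1) sub] continuous_on_subset[OF cont(2) sub]; simp)+
    have eq: "?f a b = (\<lambda>x. \<Phi> (indicator {a..b} x *\<^sub>R g x) * ennreal (indicator {a..b} x *\<^sub>R \<bar>- k x * w x\<bar>))"
      by (auto simp: fun_eq_iff split: split_indicator)
    show ?thesis unfolding eq by measurable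
  qed
  have "(\<integral>\<^sup>+x. \<Phi> (g x) * ennreal \<bar>k x * w x\<bar> * indicator {0..1} x \<partial>lborel) \<le> (\<integral>\<^sup>+x. ?f 0 p x + ?f p 1 x \<partial>lborel)"
    using p(1) by (intro nn_integral_mono) (auto split: split_indicator)
  also have "\<dots> = (\<integral>\<^sup>+x. ?f 0 p x \<partial>lborel) + (\<integral>\<^sup>+x. ?f p 1 x \<partial>lborel)"
    using p(1) by (intro nn_integral_add piece) auto
  also have "(\<integral>\<^sup>+x. ?f 0 p x \<partial>lborel) \<le> (\<integral>\<^sup>+x. \<Phi> x \<partial>lborel)"
  proof (cases "p = 0")
    case True
    have "(\<integral>\<^sup>+x. ?f 0 p x \<partial>lborel) = (\<integral>\<^sup>+x. \<Phi> (g 0) * ennreal \<bar>- k 0 * w 0\<bar> * indicator {0::real} x \<partial>lborel)"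
      unfolding True by (intro nn_integral_cong) (auto split: split_indicator)
    also have "\<dots> = 0" by (simp add: nn_integral_cmult_indicator)
    finally show ?thesis by simp
  next
    case False
    then show ?thesis
      using p w by (intro nn_integral_substitution_mono \<Phi> deriv continuous_intros
          continuous_on_subset[OF cont(1)] continuous_on_subset[OF cont(2)])
        (auto intro: mult_nonpos_nonneg)
  qed
  also have "(\<integral>\<^sup>+x. ?f p 1 x \<partial>lborel) \<le> (\<integral>\<^sup>+x. \<Phi> x \<partial>lborel)"
  proof (cases "p = 1")
    case True
    have "(\<integral>\<^sup>+x. ?f p 1 x \<partial>lborel) = (\<integral>\<^sup>+x. \<Phi> (g 1) * ennreal \<bar>- k 1 * w 1\<bar> * indicator {1::real} x \<partial>lborel)"
      unfolding True by (intro nn_integral_cong) (auto split: split_indicator)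
    also have "\<dots> = 0" by (simp add: nn_integral_cmult_indicator)
    finally show ?thesis by simp
  next
    case False
    then show ?thesis
      using p w by (intro nn_integral_substitution_antimono \<Phi> deriv continuous_intros
          continuous_on_subset[OF cont(1)] continuous_on_subset[OF cont(2)])
        (auto intro: mult_nonneg_nonneg)
  qed
  finally show ?thesis by (simp add: mult_2 add_mono)
qed

text \<open>Kept as a measure on the whole line, so that Borel functions on the line are measurable
  for it without restriction. The price is that membership in [0,1] holds only almost
  everywhere.\<close>

definition unit_interval :: "real measure" where
  "unit_interval = uniform_measure lborel {0..1}"

lemma sets_unit_interval [simp, measurable_cong]: "sets unit_interval = sets borel"
  by (simp add: unit_interval_def)

lemma space_unit_interval [simp]: "space unit_interval = UNIV"
  by (simp add: unit_interval_def)

lemma prob_space_unit_interval: "prob_space unit_interval"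
  unfolding unit_interval_def by (rule prob_space_uniform_measure) auto

lemma nn_integral_unit_interval:
  "f \<in> borel_measurable borel \<Longrightarrow> (\<integral>\<^sup>+x. f x \<partial>unit_interval) = (\<integral>\<^sup>+x. f x * indicator {0..1} x \<partial>lborel)"
  unfolding unit_interval_def by (subst nn_integral_uniform_measure) (auto simp: divide_ennreal_def)

lemma nn_integral_prob_le:
  assumes "prob_space M" "\<And>x. x \<in> space M \<Longrightarrow> f x \<le> C"
  shows "(\<integral>\<^sup>+x. f x \<partial>M) \<le> C"
proof -
  interpret prob_space M by fact
  have "(\<integral>\<^sup>+x. f x \<partial>M) \<le> (\<integral>\<^sup>+x. C \<partial>M)" using assms(2) by (rule nn_integral_mono)
  then show ?thesis by (simp add: emeasure_space_1)
qed

lemma measurable_compose3: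
  assumes "(\<lambda>(s, x, y). F s x y) \<in> measurable (A \<Otimes>\<^sub>M B \<Otimes>\<^sub>M C) D"
    and "f \<in> measurable M A" "g \<in> measurable M B" "h \<in> measurable M C"
  shows "(\<lambda>p. F (f p) (g p) (h p)) \<in> measurable M D"
  using measurable_compose[OF measurable_Pair[OF assms(2) measurable_Pair[OF assms(3,4)]] assms(1)] by simp

text \<open>Tonelli moves the estimated variable to the inside; averaging a constant bound over the
  other two does not change it.\<close>

lemma triple_integral_le:
  fixes F :: "real \<Rightarrow> real \<Rightarrow> real \<Rightarrow> ennreal"
  assumes F: "(\<lambda>(s, x, y). F s x y) \<in> borel_measurable (borel \<Otimes>\<^sub>M borel \<Otimes>\<^sub>M borel)"
  defines "U \<equiv> unit_interval"
  shows "(\<And>s x. (\<integral>\<^sup>+y. F s x y \<partial>U) \<le> C) \<Longrightarrow> (\<integral>\<^sup>+s. \<integral>\<^sup>+x. \<integral>\<^sup>+y. F s x y \<partial>U \<partial>U \<partial>U) \<le> C"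
    and "(\<And>s y. (\<integral>\<^sup>+x. F s x y \<partial>U) \<le> C) \<Longrightarrow> (\<integral>\<^sup>+s. \<integral>\<^sup>+x. \<integral>\<^sup>+y. F s x y \<partial>U \<partial>U \<partial>U) \<le> C"
    and "(\<And>x y. (\<integral>\<^sup>+s. F s x y \<partial>U) \<le> C) \<Longrightarrow> (\<integral>\<^sup>+s. \<integral>\<^sup>+x. \<integral>\<^sup>+y. F s x y \<partial>U \<partial>U \<partial>U) \<le> C"
proof -
  have [measurable_cong, simp]: "sets U = sets borel" by (simp add: U_def)
  note [measurable (raw)] = measurable_compose3[OF F]
  have U: "prob_space U" unfolding U_def by (rule prob_space_unit_interval)
  interpret prob_space U by (rule U)
  interpret pair_sigma_finite U U ..
  have swap_inner: "(\<integral>\<^sup>+x. \<integral>\<^sup>+y. G x y \<partial>U \<partial>U) = (\<integral>\<^sup>+y. \<integral>\<^sup>+x. G x y \<partial>U \<partial>U)"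
    if "(\<lambda>(x, y). G x y) \<in> borel_measurable (U \<Otimes>\<^sub>M U)" for G :: "real \<Rightarrow> real \<Rightarrow> ennreal"
    using Fubini'[OF that] by simp
  {
    assume *: "\<And>s x. (\<integral>\<^sup>+y. F s x y \<partial>U) \<le> C"
    show "(\<integral>\<^sup>+s. \<integral>\<^sup>+x. \<integral>\<^sup>+y. F s x y \<partial>U \<partial>U \<partial>U) \<le> C"
      by (rule nn_integral_prob_le[OF U], rule nn_integral_prob_le[OF U], rule *)
  next
    assume *: "\<And>s y. (\<integral>\<^sup>+x. F s x y \<partial>U) \<le> C"
    have "(\<integral>\<^sup>+s. \<integral>\<^sup>+x. \<integral>\<^sup>+y. F s x y \<partial>U \<partial>U \<partial>U) = (\<integral>\<^sup>+s. \<integral>\<^sup>+y. \<integral>\<^sup>+x. F s x y \<partial>U \<partial>U \<partial>U)"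
      by (intro nn_integral_cong swap_inner) measurable
    also have "\<dots> \<le> C" by (rule nn_integral_prob_le[OF U], rule nn_integral_prob_le[OF U], rule *)
    finally show "(\<integral>\<^sup>+s. \<integral>\<^sup>+x. \<integral>\<^sup>+y. F s x y \<partial>U \<partial>U \<partial>U) \<le> C" .
  next
    assume *: "\<And>x y. (\<integral>\<^sup>+s. F s x y \<partial>U) \<le> C"
    have "(\<integral>\<^sup>+s. \<integral>\<^sup>+x. \<integral>\<^sup>+y. F s x y \<partial>U \<partial>U \<partial>U) = (\<integral>\<^sup>+x. \<integral>\<^sup>+s. \<integral>\<^sup>+y. F s x y \<partial>U \<partial>U \<partial>U)"
      by (rule swap_inner) measurable
    also have "\<dots> = (\<integral>\<^sup>+x. \<integral>\<^sup>+y. \<integral>\<^sup>+s. F s x y \<partial>U \<partial>U \<partial>U)"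
      by (intro nn_integral_cong swap_inner) measurable
    also have "\<dots> \<le> C" by (rule nn_integral_prob_le[OF U], rule nn_integral_prob_le[OF U], rule *)
    finally show "(\<integral>\<^sup>+s. \<integral>\<^sup>+x. \<integral>\<^sup>+y. F s x y \<partial>U \<partial>U \<partial>U) \<le> C" .
  }
qed

text \<open>
  By the hypothesis \<open>hopf\<close> the gradient of \<open>N\<close> never vanishes, and \<open>N\<close> is convex in each variable.
\<close>

lemma radial_average_le:
  fixes c d e :: "'b::euclidean_space" and \<Phi> :: "real \<Rightarrow> ennreal"
  assumes \<Phi>[measurable]: "\<Phi> \<in> borel_measurable borel"
    and nz: "\<And>x y. c \<noteq> 0 \<or> d + x *\<^sub>R c + y *\<^sub>R e \<noteq> 0"
    and hopf: "\<And>u t. t > 0 \<Longrightarrow> t * (norm c)\<^sup>2 + (norm u)\<^sup>2 / t \<le>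
      \<bar>t * (norm c)\<^sup>2 - (norm u)\<^sup>2 / t\<bar> + 2 * \<bar>u \<bullet> c\<bar> + 2 * \<bar>u \<bullet> e\<bar>"
  defines "U \<equiv> unit_interval"
    and "N \<equiv> \<lambda>s x y. exp s * (norm c)\<^sup>2 + exp (- s) * (norm (d + x *\<^sub>R c + y *\<^sub>R e))\<^sup>2"
  shows "(\<integral>\<^sup>+s. \<integral>\<^sup>+x. \<integral>\<^sup>+y. \<Phi> (- ln (N s x y)) \<partial>U \<partial>U \<partial>U) \<le> 14 * (\<integral>\<^sup>+t. \<Phi> t \<partial>lborel)"
proof -
  have [measurable_cong, simp]: "sets U = sets borel" by (simp add: U_def)
  define q where "q x y = d + x *\<^sub>R c + y *\<^sub>R e" for x y :: real
  have Nq: "N s x y = exp s * (norm c)\<^sup>2 + exp (- s) * (norm (q x y))\<^sup>2" for s x y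
    by (simp add: N_def q_def)
  have N0: "N s x y > 0" for s x y
    using nz[of x y] unfolding Nq q_def[symmetric] by (auto intro: add_pos_nonneg add_nonneg_pos)
  \<comment> \<open>\<open>k1\<close>, \<open>k2\<close> and \<open>k3\<close> are the partial
    derivatives of \<open>N\<close> in \<open>s\<close>, \<open>x\<close> and
    \<open>y\<close>.\<close>
  define k1 where "k1 s x y = exp s * (norm c)\<^sup>2 - exp (- s) * (norm (q x y))\<^sup>2" for s x y
  define k2 where "k2 s x y = 2 * exp (- s) * (q x y \<bullet> c)" for s x y
  define k3 where "k3 s x y = 2 * exp (- s) * (q x y \<bullet> e)" for s x y
  have "continuous_on UNIV (\<lambda>(s, x, y). N s x y)" "continuous_on UNIV (\<lambda>(s, x, y). k1 s x y)"
    "continuous_on UNIV (\<lambda>(s, x, y). k2 s x y)" "continuous_on UNIV (\<lambda>(s, x, y). k3 s x y)"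
    unfolding N_def k1_def k2_def k3_def q_def split_beta' by (intro continuous_intros)+
  from this[THEN borel_measurable_continuous_onI] have m:
    "(\<lambda>(s, x, y). N s x y) \<in> borel_measurable (borel \<Otimes>\<^sub>M borel \<Otimes>\<^sub>M borel)"
    "(\<lambda>(s, x, y). k1 s x y) \<in> borel_measurable (borel \<Otimes>\<^sub>M borel \<Otimes>\<^sub>M borel)"
    "(\<lambda>(s, x, y). k2 s x y) \<in> borel_measurable (borel \<Otimes>\<^sub>M borel \<Otimes>\<^sub>M borel)"
    "(\<lambda>(s, x, y). k3 s x y) \<in> borel_measurable (borel \<Otimes>\<^sub>M borel \<Otimes>\<^sub>M borel)"
    by (simp_all add: borel_prod)
  note [measurable (raw)] = m[THEN measurable_compose3]
  \<comment> \<open>The weight is the modulus of a partial derivative of - ln \<open>N\<close>, as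
    one-variable substitution requires.\<close>
  define F where "F k s x y = \<Phi> (- ln (N s x y)) * ennreal \<bar>k s x y * (1 / N s x y)\<bar>"
    for k :: "real \<Rightarrow> real \<Rightarrow> real \<Rightarrow> real" and s x y
  let ?I = "\<lambda>G :: real \<Rightarrow> real \<Rightarrow> real \<Rightarrow> ennreal. \<integral>\<^sup>+s. \<integral>\<^sup>+x. \<integral>\<^sup>+y. G s x y \<partial>U \<partial>U \<partial>U"
  let ?J = "\<integral>\<^sup>+t. \<Phi> t \<partial>lborel"
  have Fm: "(\<lambda>(s, x, y). F k1 s x y) \<in> borel_measurable (borel \<Otimes>\<^sub>M borel \<Otimes>\<^sub>M borel)"
    "(\<lambda>(s, x, y). F k2 s x y) \<in> borel_measurable (borel \<Otimes>\<^sub>M borel \<Otimes>\<^sub>M borel)"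
    "(\<lambda>(s, x, y). F k3 s x y) \<in> borel_measurable (borel \<Otimes>\<^sub>M borel \<Otimes>\<^sub>M borel)"
    unfolding F_def split_beta' by measurable
  note [measurable (raw)] = Fm[THEN measurable_compose3]
  have qx: "(norm (q x y))\<^sup>2 = (norm (d + y *\<^sub>R e))\<^sup>2 + 2 * x * ((d + y *\<^sub>R e) \<bullet> c) + x\<^sup>2 * (norm c)\<^sup>2"
    and qy: "(norm (q x y))\<^sup>2 = (norm (d + x *\<^sub>R c))\<^sup>2 + 2 * y * ((d + x *\<^sub>R c) \<bullet> e) + y\<^sup>2 * (norm e)\<^sup>2" for x y
    unfolding q_def power2_norm_eq_inner
    by (simp_all add: inner_add_left inner_add_right inner_commute power2_eq_square algebra_simps)
  have b1: "?I (F k1) \<le> 2 * ?J"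
  proof -
    have "(\<integral>\<^sup>+s. F k1 s x y \<partial>unit_interval) \<le> 2 * ?J" for x y
    proof (subst nn_integral_unit_interval)
      have "mono_on {0..1} (\<lambda>s. k1 s x y)"
        unfolding k1_def by (intro mono_onI diff_mono mult_right_mono) auto
      moreover have "continuous_on {0..1} (\<lambda>s. k1 s x y)"
        unfolding k1_def q_def by (intro continuous_intros)
      moreover have "continuous_on {0..1} (\<lambda>s. N s x y)"
        unfolding N_def by (intro continuous_intros)
      then have "continuous_on {0..1} (\<lambda>s. 1 / N s x y)"
        using N0 by (intro continuous_on_divide continuous_on_const) (auto simp: less_imp_neq[THEN not_sym])
      moreover have "((\<lambda>s. - ln (N s x y)) has_real_derivative - k1 s x y * (1 / N s x y)) (at s)" for s
        using N0[of s x y] unfolding k1_def Nq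
        by (auto intro!: derivative_eq_intros simp: divide_simps)
      ultimately show "(\<integral>\<^sup>+s. F k1 s x y * indicator {0..1} s \<partial>lborel) \<le> 2 * ?J"
        unfolding F_def using N0[of _ x y]
        by (intro nn_integral_substitution_unimodal[OF \<Phi>]) (auto simp: less_imp_le)
    qed measurable
    then show ?thesis unfolding U_def by (rule triple_integral_le(3)[OF Fm(1)])
  qed
  have b2: "?I (F k2) \<le> 2 * ?J"
  proof -
    have "(\<integral>\<^sup>+x. F k2 s x y \<partial>unit_interval) \<le> 2 * ?J" for s y
    proof (subst nn_integral_unit_interval)
      have "mono_on {0..1} (\<lambda>x. k2 s x y)"
        unfolding k2_def q_def
        by (intro mono_onI) (auto simp: inner_add_left intro!: mult_right_mono)
      moreover have "continuous_on {0..1} (\<lambda>x. k2 s x y)"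
        unfolding k2_def q_def by (intro continuous_intros)
      moreover have "continuous_on {0..1} (\<lambda>x. N s x y)"
        unfolding N_def by (intro continuous_intros)
      then have "continuous_on {0..1} (\<lambda>x. 1 / N s x y)"
        using N0 by (intro continuous_on_divide continuous_on_const) (auto simp: less_imp_neq[THEN not_sym])
      moreover have "((\<lambda>x. - ln (N s x y)) has_real_derivative - k2 s x y * (1 / N s x y)) (at x)" for x
      proof -
        have "((\<lambda>x. N s x y) has_real_derivative k2 s x y) (at x)"
          unfolding k2_def Nq qx
          by (auto intro!: derivative_eq_intros simp: q_def inner_add_left inner_commute power2_norm_eq_inner algebra_simps)
        then show ?thesis using N0[of s x y] by (auto intro!: derivative_eq_intros simp: divide_simps)
      qed
      ultimately show "(\<integral>\<^sup>+x. F k2 s x y * indicator {0..1} x \<partial>lborel) \<le> 2 * ?J"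
        unfolding F_def using N0[of s _ y]
        by (intro nn_integral_substitution_unimodal[OF \<Phi>]) (auto simp: less_imp_le)
    qed measurable
    then show ?thesis unfolding U_def by (rule triple_integral_le(2)[OF Fm(2)])
  qed
  have b3: "?I (F k3) \<le> 2 * ?J"
  proof -
    have "(\<integral>\<^sup>+y. F k3 s x y \<partial>unit_interval) \<le> 2 * ?J" for s x
    proof (subst nn_integral_unit_interval)
      have "mono_on {0..1} (\<lambda>y. k3 s x y)"
        unfolding k3_def q_def
        by (intro mono_onI) (auto simp: inner_add_left intro!: mult_right_mono)
      moreover have "continuous_on {0..1} (\<lambda>y. k3 s x y)"
        unfolding k3_def q_def by (intro continuous_intros)
      moreover have "continuous_on {0..1} (\<lambda>y. N s x y)"
        unfolding N_def by (intro continuous_intros)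
      then have "continuous_on {0..1} (\<lambda>y. 1 / N s x y)"
        using N0 by (intro continuous_on_divide continuous_on_const) (auto simp: less_imp_neq[THEN not_sym])
      moreover have "((\<lambda>y. - ln (N s x y)) has_real_derivative - k3 s x y * (1 / N s x y)) (at y)" for y
      proof -
        have "((\<lambda>y. N s x y) has_real_derivative k3 s x y) (at y)"
          unfolding k3_def Nq qy
          by (auto intro!: derivative_eq_intros simp: q_def inner_add_left inner_commute power2_norm_eq_inner algebra_simps)
        then show ?thesis using N0[of s x y] by (auto intro!: derivative_eq_intros simp: divide_simps)
      qed
      ultimately show "(\<integral>\<^sup>+y. F k3 s x y * indicator {0..1} y \<partial>lborel) \<le> 2 * ?J"
        unfolding F_def using N0[of s x]
        by (intro nn_integral_substitution_unimodal[OF \<Phi>]) (auto simp: less_imp_le)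
    qed measurable
    then show ?thesis unfolding U_def by (rule triple_integral_le(1)[OF Fm(3)])
  qed
  \<comment> \<open>At t = exp s, \<open>hopf\<close> bounds \<open>N\<close> by |k1| and multiples
    of |k2| and |k3|. The factor 3 bounds exp s, which compensates the exp(-s) inside
    \<open>k2\<close> and \<open>k3\<close>.\<close>
  have grad: "1 \<le> \<bar>k1 s x y * (1 / N s x y)\<bar> + 3 * \<bar>k2 s x y * (1 / N s x y)\<bar> + 3 * \<bar>k3 s x y * (1 / N s x y)\<bar>"
    if s: "s \<in> {0..1}" for s x y
  proof -
    have "exp s \<le> exp 1" using s by simp
    then have es: "exp s \<le> 3" using exp_le by linarith
    have "N s x y \<le> \<bar>k1 s x y\<bar> + 2 * \<bar>q x y \<bullet> c\<bar> + 2 * \<bar>q x y \<bullet> e\<bar>"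
      using hopf[of "exp s" "q x y"] by (simp add: Nq k1_def exp_minus divide_inverse mult.commute)
    also have "2 * \<bar>q x y \<bullet> c\<bar> = exp s * \<bar>k2 s x y\<bar>" by (simp add: k2_def abs_mult exp_minus)
    also have "2 * \<bar>q x y \<bullet> e\<bar> = exp s * \<bar>k3 s x y\<bar>" by (simp add: k3_def abs_mult exp_minus)
    also have "\<bar>k1 s x y\<bar> + exp s * \<bar>k2 s x y\<bar> + exp s * \<bar>k3 s x y\<bar> \<le> \<bar>k1 s x y\<bar> + 3 * \<bar>k2 s x y\<bar> + 3 * \<bar>k3 s x y\<bar>"
      using es by (intro add_mono mult_right_mono) auto
    finally have "1 \<le> (\<bar>k1 s x y\<bar> + 3 * \<bar>k2 s x y\<bar> + 3 * \<bar>k3 s x y\<bar>) / N s x y"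
      using N0[of s x y] by simp
    moreover have "\<bar>k * (1 / N s x y)\<bar> = \<bar>k\<bar> / N s x y" for k
      using N0[of s x y] by (simp add: abs_mult)
    ultimately show ?thesis by (simp only: add_divide_distrib times_divide_eq_right)
  qed
  have split3: "X * ennreal (a + 3 * b + 3 * c) = X * ennreal a + 3 * (X * ennreal b) + 3 * (X * ennreal c)"
    if "a \<ge> 0" "b \<ge> 0" "c \<ge> 0" for X a b c
    using that by (simp add: ennreal_mult distrib_left mult.left_commute)
  have U: "prob_space U" unfolding U_def by (rule prob_space_unit_interval)
  interpret prob_space U by (rule U)
  have "?I (\<lambda>s x y. \<Phi> (- ln (N s x y))) \<le> ?I (\<lambda>s x y. F k1 s x y + 3 * F k2 s x y + 3 * F k3 s x y)"
  proof -
    have "(\<integral>\<^sup>+s. \<integral>\<^sup>+x. \<integral>\<^sup>+y. \<Phi> (- ln (N s x y)) \<partial>U \<partial>U \<partial>U) =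
      (\<integral>\<^sup>+s. (\<integral>\<^sup>+x. \<integral>\<^sup>+y. \<Phi> (- ln (N s x y)) \<partial>U \<partial>U) * indicator {0..1} s \<partial>lborel)"
      by (rule nn_integral_unit_interval[folded U_def]) measurable
    also have "\<dots> \<le> (\<integral>\<^sup>+s. (\<integral>\<^sup>+x. \<integral>\<^sup>+y. F k1 s x y + 3 * F k2 s x y + 3 * F k3 s x y \<partial>U \<partial>U) * indicator {0..1} s \<partial>lborel)"
    proof (intro nn_integral_mono)
      fix s :: real
      have "\<Phi> (- ln (N s x y)) \<le> F k1 s x y + 3 * F k2 s x y + 3 * F k3 s x y" if "s \<in> {0..1}" for x y
      proof -
        have "\<Phi> (- ln (N s x y)) * ennreal 1 \<le> \<Phi> (- ln (N s x y)) *
          ennreal (\<bar>k1 s x y * (1 / N s x y)\<bar> + 3 * \<bar>k2 s x y * (1 / N s x y)\<bar> + 3 * \<bar>k3 s x y * (1 / N s x y)\<bar>)"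
          by (intro mult_left_mono ennreal_leI grad that) auto
        also have "\<dots> = F k1 s x y + 3 * F k2 s x y + 3 * F k3 s x y"
          unfolding F_def by (intro split3) auto
        finally show ?thesis by simp
      qed
      then show "(\<integral>\<^sup>+x. \<integral>\<^sup>+y. \<Phi> (- ln (N s x y)) \<partial>U \<partial>U) * indicator {0..1} s \<le>
        (\<integral>\<^sup>+x. \<integral>\<^sup>+y. F k1 s x y + 3 * F k2 s x y + 3 * F k3 s x y \<partial>U \<partial>U) * indicator {0..1} s"
        by (auto split: split_indicator intro!: nn_integral_mono)
    qed
    also have "\<dots> = ?I (\<lambda>s x y. F k1 s x y + 3 * F k2 s x y + 3 * F k3 s x y)"
      by (rule nn_integral_unit_interval[folded U_def, symmetric]) measurable
    finally show ?thesis .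
  qed
  also have "\<dots> = ?I (F k1) + 3 * ?I (F k2) + 3 * ?I (F k3)"
  proof -
    show ?thesis by (simp add: nn_integral_add nn_integral_cmult)
  qed
  \<comment> \<open>Each weighted integral is at most twice that of \<Phi>, and \<open>grad\<close>
    has the weights 1, 3 and 3; this is the 14.\<close>
  also have "\<dots> \<le> 2 * ?J + 3 * (2 * ?J) + 3 * (2 * ?J)"
    by (intro add_mono mult_left_mono b1 b2 b3) auto
  also have "\<dots> = (2 + 3 * 2 + 3 * 2) * ?J" by (simp only: distrib_right mult.assoc)
  also have "\<dots> = 14 * ?J" by simp
  finally show ?thesis .
qed

section \<open>Theta series as finite sums\<close>

locale cusp_lattice =
  fixes \<Gamma> :: "('a::{real_normed_field,euclidean_space}^2^2) set" and \<sigma> :: "('a^2^2) set measure" and h :: 'a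
  assumes subgroup: "subgroup \<Gamma> SL2" and discrete: "discrete \<Gamma>"
    and n_mat_h: "n_mat h \<in> \<Gamma>" and h_nonzero: "h \<noteq> 0"
    and invariant: "invariant_probability \<Gamma> \<sigma>"
begin

lemmas \<Gamma>_closed = subgroup_SL2D[OF subgroup]

definition cosets :: "('a^2^2) set set" where
  "cosets = (\<lambda>\<gamma>. Gamma_inf \<Gamma> #>\<^bsub>SL2\<^esub> \<gamma>) ` \<Gamma>"

definition rep :: "('a^2^2) set \<Rightarrow> 'a^2^2" where
  "rep c = (SOME \<gamma>. \<gamma> \<in> c)"

lemma Theta_eq: "Theta \<Gamma> f g = (\<Sum>\<^sub>\<infinity>c\<in>cosets. f (rep c ** g))"
  by (simp add: Theta_def cosets_def rep_def)

lemma Gamma_inf_iff: "g \<in> Gamma_inf \<Gamma> \<longleftrightarrow> g \<in> \<Gamma> \<and> g $ 2 $ 1 = 0"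
  using \<Gamma>_closed(1) by (auto simp: Gamma_inf_def upper_P_def)

lemma subgroup_Gamma_inf: "subgroup (Gamma_inf \<Gamma>) SL2"
proof (rule subgroup.intro)
  show "Gamma_inf \<Gamma> \<subseteq> carrier SL2" using \<Gamma>_closed(1) by (auto simp: Gamma_inf_iff)
  show "\<one>\<^bsub>SL2\<^esub> \<in> Gamma_inf \<Gamma>" using \<Gamma>_closed(4) by (simp add: Gamma_inf_iff)
  fix x y assume "x \<in> Gamma_inf \<Gamma>" "y \<in> Gamma_inf \<Gamma>"
  then show "x \<otimes>\<^bsub>SL2\<^esub> y \<in> Gamma_inf \<Gamma>" using \<Gamma>_closed(2) by (simp add: Gamma_inf_iff)
next
  fix x assume x: "x \<in> Gamma_inf \<Gamma>"
  then have "inv\<^bsub>SL2\<^esub> x = adj2 x" using \<Gamma>_closed(1) by (auto simp: Gamma_inf_iff intro: inv_SL2_eq)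
  then show "inv\<^bsub>SL2\<^esub> x \<in> Gamma_inf \<Gamma>"
    using x \<Gamma>_closed(3)[of x] by (auto simp: Gamma_inf_iff) (simp add: adj2_def)
qed

lemma Gamma_inf_subset_Q: "Gamma_inf \<Gamma> \<subseteq> subgroup_Q"
  using parabolic_norm_one[OF subgroup discrete n_mat_h h_nonzero] by (auto simp: Gamma_inf_iff)

lemma rep_in_coset: "\<gamma> \<in> \<Gamma> \<Longrightarrow> \<exists>q\<in>Gamma_inf \<Gamma>. rep (Gamma_inf \<Gamma> #>\<^bsub>SL2\<^esub> \<gamma>) = q ** \<gamma>"
proof -
  assume "\<gamma> \<in> \<Gamma>"
  have "mat 1 \<in> Gamma_inf \<Gamma>" using subgroup_SL2D(4)[OF subgroup_Gamma_inf] .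
  then have "mat 1 ** \<gamma> \<in> Gamma_inf \<Gamma> #>\<^bsub>SL2\<^esub> \<gamma>" unfolding r_coset_SL2 by blast
  then have "rep (Gamma_inf \<Gamma> #>\<^bsub>SL2\<^esub> \<gamma>) \<in> Gamma_inf \<Gamma> #>\<^bsub>SL2\<^esub> \<gamma>" unfolding rep_def by (rule someI)
  then show ?thesis by (auto simp: r_coset_SL2)
qed

lemma rep_in_\<Gamma>: "c \<in> cosets \<Longrightarrow> rep c \<in> \<Gamma>"
  using rep_in_coset \<Gamma>_closed(2) by (fastforce simp: cosets_def Gamma_inf_iff)

lemma coset_rep: "c \<in> cosets \<Longrightarrow> Gamma_inf \<Gamma> #>\<^bsub>SL2\<^esub> rep c = c"
  using rep_in_coset r_coset_eq_SL2[OF subgroup_Gamma_inf] by (fastforce simp: cosets_def)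

lemma rep_in_SL2: "c \<in> cosets \<Longrightarrow> rep c \<in> carrier SL2"
  using rep_in_\<Gamma> \<Gamma>_closed(1) by blast

text \<open>Right multiplication by \<open>g\<close> does not change the determinant of two bottom
  rows, and for \<open>rep c'\<close> and \<open>rep c\<close> it is the lower left entry of their
  quotient in \<Gamma>. It is nonzero since the cosets differ, so \<open>lower_left_gap\<close>
  applies.\<close>

lemma bottom_rows_gap:
  assumes c: "c \<in> cosets" "c' \<in> cosets" "c \<noteq> c'" and g: "g \<in> carrier SL2"
  defines "x \<equiv> rep c ** g" and "y \<equiv> rep c' ** g"
  shows "1 \<le> norm (y $ 2 $ 1 * x $ 2 $ 2 - y $ 2 $ 2 * x $ 2 $ 1) * norm h"
proof -
  let ?d = "rep c' ** adj2 (rep c)"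
  have d: "?d \<in> \<Gamma>" using c rep_in_\<Gamma> \<Gamma>_closed by blast
  have "?d $ 2 $ 1 \<noteq> 0"
  proof
    assume "?d $ 2 $ 1 = 0"
    then have "?d \<in> Gamma_inf \<Gamma>" using d by (simp add: Gamma_inf_iff)
    then have "Gamma_inf \<Gamma> #>\<^bsub>SL2\<^esub> (?d ** rep c) = Gamma_inf \<Gamma> #>\<^bsub>SL2\<^esub> rep c"
      by (rule r_coset_eq_SL2[OF subgroup_Gamma_inf])
    moreover have "?d ** rep c = rep c'" using rep_in_SL2[OF c(1)] by (simp flip: matrix_mul_assoc)
    ultimately show False using c coset_rep by metis
  qed
  then have "1 \<le> norm (?d $ 2 $ 1) * norm h"
    by (rule lower_left_gap[OF subgroup discrete n_mat_h h_nonzero d])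
  moreover have "?d $ 2 $ 1 = (rep c' $ 2 $ 1 * rep c $ 2 $ 2 - rep c' $ 2 $ 2 * rep c $ 2 $ 1) *
      (g $ 1 $ 1 * g $ 2 $ 2 - g $ 1 $ 2 * g $ 2 $ 1)"
    using g by (simp add: carrier_SL2_iff adj2_def algebra_simps)
  then have "?d $ 2 $ 1 = y $ 2 $ 1 * x $ 2 $ 2 - y $ 2 $ 2 * x $ 2 $ 1"
    by (simp add: x_def y_def algebra_simps)
  ultimately show ?thesis by simp
qed

text \<open>The difference of two ratios c/d is the determinant of the rows divided by the product
  of their second entries, so \<open>bottom_rows_gap\<close> separates the ratios by at least 1/(R^2
  |h|), and packing counts them.\<close>

lemma count_chart:
  fixes z0 :: 'a
  assumes g: "g \<in> carrier SL2" and R: "R > 0" and T: "T \<ge> 0"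
  defines "z \<equiv> \<lambda>c. (rep c ** g) $ 2 $ 1 / (rep c ** g) $ 2 $ 2"
  defines "A \<equiv> {c \<in> cosets. (rep c ** g) $ 2 $ 2 \<noteq> 0 \<and> norm ((rep c ** g) $ 2 $ 2) \<le> R \<and> dist z0 (z c) \<le> T}"
  shows "finite (A)" "real (card (A)) \<le> (2 * T * R\<^sup>2 * norm h + 1) ^ DIM('a)" "inj_on z (A)"
    and "\<And>c c'. c \<in> A \<Longrightarrow> c' \<in> A \<Longrightarrow> c \<noteq> c' \<Longrightarrow> 1 / (R\<^sup>2 * norm h) \<le> dist (z c) (z c')"
proof -
  have h: "norm h > 0" using h_nonzero by simp
  let ?\<rho> = "1 / (R\<^sup>2 * norm h)"
  show sep: "?\<rho> \<le> dist (z c) (z c')" if c: "c \<in> A" "c' \<in> A" "c \<noteq> c'" for c c'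
  proof -
    define x where "x = rep c ** g"
    define y where "y = rep c' ** g"
    have d: "x $ 2 $ 2 \<noteq> 0" "y $ 2 $ 2 \<noteq> 0" "norm (x $ 2 $ 2) \<le> R" "norm (y $ 2 $ 2) \<le> R"
      using c(1,2) unfolding A_def x_def y_def by blast+
    have cc: "c \<in> cosets" "c' \<in> cosets" using c by (auto simp: A_def)
    have zz: "z c = x $ 2 $ 1 / x $ 2 $ 2" "z c' = y $ 2 $ 1 / y $ 2 $ 2" by (simp_all only: z_def x_def y_def)
    let ?D = "y $ 2 $ 1 * x $ 2 $ 2 - y $ 2 $ 2 * x $ 2 $ 1"
    have "1 \<le> norm ?D * norm h"
      using bottom_rows_gap[OF cc c(3) g] by (simp only: x_def y_def)
    moreover have "?D = (z c' - z c) * (y $ 2 $ 2 * x $ 2 $ 2)"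
      using d by (simp add: zz field_simps)
    ultimately have "1 \<le> dist (z c) (z c') * (norm (y $ 2 $ 2) * norm (x $ 2 $ 2)) * norm h"
      by (simp add: norm_mult dist_norm norm_minus_commute)
    also have "\<dots> \<le> dist (z c) (z c') * (R * R) * norm h"
      using d R by (intro mult_right_mono mult_left_mono mult_mono) auto
    finally show ?thesis using R h by (simp add: field_simps power2_eq_square)
  qed
  have \<rho>: "?\<rho> > 0" using R h by simp
  show inj: "inj_on z (A)"
  proof (rule inj_onI, rule ccontr)
    fix c c' assume "c \<in> A" "c' \<in> A" "z c = z c'" "c \<noteq> c'"
    then show False using sep[of c c'] \<rho> by simp
  qed
  have S: "z ` A \<subseteq> cball z0 T" by (auto simp: A_def)
  have sep': "?\<rho> \<le> dist x y" if "x \<in> z ` A" "y \<in> z ` A" "x \<noteq> y" for x y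
    using that sep by blast
  have fin: "finite (z ` A)" by (rule finite_packing[OF S \<rho> T sep'])
  then show "finite (A)" using inj by (rule finite_imageD)
  have "real (card (z ` A)) \<le> (2 * T / ?\<rho> + 1) ^ DIM('a)"
    by (rule packing_bound[OF fin S \<rho> T sep'])
  then show "real (card (A)) \<le> (2 * T * R\<^sup>2 * norm h + 1) ^ DIM('a)"
    using inj by (simp add: card_image mult.assoc)
qed

text \<open>Rows with small second entry have no useful ratio c/d. The Weyl element \<open>w\<close>
  exchanges the entries up to sign, so one of the two charts always sees a ratio of norm at most
  one; hence the leading factor 2 and the use of radius 1.\<close>

lemma count_ball:
  assumes g: "g \<in> carrier SL2" and R: "R > 0"
  defines "A \<equiv> {c \<in> cosets. norm ((rep c ** g) $ 2) \<le> R}"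
  shows "finite A" "real (card A) \<le> 2 * (2 * R\<^sup>2 * norm h + 1) ^ DIM('a)"
proof -
  define w :: "'a^2^2" where "w = mat2 0 1 (-1) 0"
  have w: "w \<in> carrier SL2" by (simp add: w_def carrier_SL2_iff)
  define B where "B g = {c \<in> cosets. (rep c ** g) $ 2 $ 2 \<noteq> 0 \<and> norm ((rep c ** g) $ 2 $ 2) \<le> R \<and>
    dist 0 ((rep c ** g) $ 2 $ 1 / (rep c ** g) $ 2 $ 2) \<le> 1}" for g :: "'a^2^2"
  have B: "finite (B g)" "real (card (B g)) \<le> (2 * R\<^sup>2 * norm h + 1) ^ DIM('a)" if "g \<in> carrier SL2" for g
    using count_chart(1,2)[OF that R, of 1 0] by (simp_all add: B_def)
  have sub: "A \<subseteq> B g \<union> B (g ** w)"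
  proof
    fix c assume c: "c \<in> A"
    define x where "x = rep c ** g"
    have cc: "c \<in> cosets" and nx: "norm (x $ 2) \<le> R" using c by (auto simp: A_def x_def)
    have x: "x \<in> carrier SL2" unfolding x_def using rep_in_SL2[OF cc] g by blast
    have xi: "norm (x $ 2 $ 1) \<le> R" "norm (x $ 2 $ 2) \<le> R"
      using Finite_Cartesian_Product.norm_nth_le[of "x $ 2"] nx by (meson order_trans)+
    have xw: "(rep c ** (g ** w)) $ 2 $ 1 = - x $ 2 $ 2" "(rep c ** (g ** w)) $ 2 $ 2 = x $ 2 $ 1"
      unfolding matrix_mul_assoc x_def[symmetric] by (simp_all add: w_def)
    show "c \<in> B g \<union> B (g ** w)"
    proof (cases "norm (x $ 2 $ 1) \<le> norm (x $ 2 $ 2)")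
      case True
      have "x $ 2 $ 2 \<noteq> 0"
      proof
        assume "x $ 2 $ 2 = 0"
        then show False using True x by (simp add: carrier_SL2_iff)
      qed
      then have "c \<in> B g" unfolding B_def mem_Collect_eq x_def[symmetric] using cc xi True by (simp add: norm_divide)
      then show ?thesis by simp
    next
      case False
      then have "x $ 2 $ 1 \<noteq> 0" by auto
      then have "c \<in> B (g ** w)" unfolding B_def mem_Collect_eq xw using cc xi False by (simp add: norm_divide)
      then show ?thesis by simp
    qed
  qed
  have fin: "finite (B g \<union> B (g ** w))" using B(1) g w by blast
  show "finite A" by (rule finite_subset[OF sub fin])
  have "card A \<le> card (B g) + card (B (g ** w))"
    using card_mono[OF fin sub] card_Un_le[of "B g" "B (g ** w)"] by linarith
  then show "real (card A) \<le> 2 * (2 * R\<^sup>2 * norm h + 1) ^ DIM('a)"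
    using B(2)[OF g] B(2)[OF SL2_mult_closed[OF g w]] by linarith
qed

lemma Theta_finite_sum:
  assumes "finite A" "A \<subseteq> cosets" "\<And>c. c \<in> cosets \<Longrightarrow> f (rep c ** g) \<noteq> 0 \<Longrightarrow> c \<in> A"
  shows "Theta \<Gamma> f g = (\<Sum>c\<in>A. f (rep c ** g))"
proof -
  have "Theta \<Gamma> f g = (\<Sum>\<^sub>\<infinity>c\<in>A. f (rep c ** g))"
    unfolding Theta_eq using assms by (intro infsum_cong_neutral) auto
  then show ?thesis using assms(1) by simp
qed

text \<open>Right translation by \<gamma> permutes the cosets; the chosen representatives change by
  elements of \<open>Gamma_inf \<Gamma>\<close>, which lies in Q and is invisible to
  \<open>f\<close>.\<close>

lemma Theta_invariant:
  assumes f: "\<And>q g. q \<in> subgroup_Q \<Longrightarrow> g \<in> carrier SL2 \<Longrightarrow> f (q ** g) = f g"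
    and g: "g \<in> carrier SL2" and \<gamma>: "\<gamma> \<in> \<Gamma>"
  shows "Theta \<Gamma> f (\<gamma> ** g) = Theta \<Gamma> f g"
proof -
  have ad: "(c #>\<^bsub>SL2\<^esub> \<gamma>) #>\<^bsub>SL2\<^esub> adj2 \<gamma> = c" "(c #>\<^bsub>SL2\<^esub> adj2 \<gamma>) #>\<^bsub>SL2\<^esub> \<gamma> = c" if "c \<in> cosets" for c
    using that \<Gamma>_closed(1)[OF \<gamma>] by (auto simp: cosets_def r_coset_translate simp flip: matrix_mul_assoc)
  have cl: "c #>\<^bsub>SL2\<^esub> \<delta> \<in> cosets" if "c \<in> cosets" "\<delta> \<in> \<Gamma>" for c \<delta>
    using that \<Gamma>_closed(2) by (auto simp: cosets_def r_coset_translate)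
  have bij: "bij_betw (\<lambda>c. c #>\<^bsub>SL2\<^esub> \<gamma>) cosets cosets"
    using ad cl \<gamma> \<Gamma>_closed(3)[OF \<gamma>] by (intro bij_betw_byWitness[where f' = "\<lambda>c. c #>\<^bsub>SL2\<^esub> adj2 \<gamma>"]) auto
  have "Theta \<Gamma> f (\<gamma> ** g) = (\<Sum>\<^sub>\<infinity>c\<in>cosets. f (rep (c #>\<^bsub>SL2\<^esub> \<gamma>) ** g))"
    unfolding Theta_eq
  proof (rule infsum_cong)
    fix c assume c: "c \<in> cosets"
    have "c #>\<^bsub>SL2\<^esub> \<gamma> = Gamma_inf \<Gamma> #>\<^bsub>SL2\<^esub> (rep c ** \<gamma>)"
      using coset_rep[OF c] r_coset_translate by metis
    then obtain q where q: "q \<in> Gamma_inf \<Gamma>" "rep (c #>\<^bsub>SL2\<^esub> \<gamma>) = q ** (rep c ** \<gamma>)"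
      using rep_in_coset[of "rep c ** \<gamma>"] rep_in_\<Gamma>[OF c] \<gamma> \<Gamma>_closed(2) by auto
    have "rep c ** (\<gamma> ** g) \<in> carrier SL2" using rep_in_SL2[OF c] \<gamma> g \<Gamma>_closed(1) by blast
    then have "f (q ** (rep c ** (\<gamma> ** g))) = f (rep c ** (\<gamma> ** g))"
      using f q(1) Gamma_inf_subset_Q by blast
    then show "f (rep c ** (\<gamma> ** g)) = f (rep (c #>\<^bsub>SL2\<^esub> \<gamma>) ** g)"
      by (simp add: q(2) matrix_mul_assoc)
  qed
  also have "\<dots> = (\<Sum>\<^sub>\<infinity>c\<in>cosets. f (rep c ** g))"
    by (rule infsum_reindex_bij_betw[OF bij, where f = "\<lambda>c. f (rep c ** g)"])
  finally show ?thesis by (simp add: Theta_eq)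
qed

text \<open>\<open>Theta_norm_sq\<close> evaluates at chosen representatives; invariance under
  \<Gamma> makes the choice immaterial, so the averages can be taken on the group.\<close>

lemma Theta_norm_sq_le_of_averages:
  fixes f :: "'a^2^2 \<Rightarrow> real"
  assumes f: "\<And>q g. q \<in> subgroup_Q \<Longrightarrow> g \<in> carrier SL2 \<Longrightarrow> f (q ** g) = f g"
    and M: "prob_space M" "\<eta> \<in> borel_measurable M" "\<And>m. m \<in> space M \<Longrightarrow> \<eta> m \<in> carrier SL2"
    and bound: "\<And>g. g \<in> carrier SL2 \<Longrightarrow> (\<integral>\<^sup>+m. ennreal ((Theta \<Gamma> f (g ** \<eta> m))\<^sup>2) \<partial>M) \<le> C"
  shows "Theta_norm_sq \<Gamma> \<sigma> f \<le> C"
  unfolding Theta_norm_sq_def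
proof (rule nn_integral_le_of_averages[OF subgroup invariant M])
  fix g :: "'a^2^2" assume g: "g \<in> carrier SL2"
  have "Theta \<Gamma> f (SOME k. k \<in> \<Gamma> #>\<^bsub>SL2\<^esub> k') = Theta \<Gamma> f k'" if "k' \<in> carrier SL2" for k'
  proof -
    have "mat 1 ** k' \<in> \<Gamma> #>\<^bsub>SL2\<^esub> k'" unfolding r_coset_SL2 using \<Gamma>_closed(4) by blast
    then have "(SOME k. k \<in> \<Gamma> #>\<^bsub>SL2\<^esub> k') \<in> \<Gamma> #>\<^bsub>SL2\<^esub> k'" by (rule someI)
    then obtain \<gamma> where "\<gamma> \<in> \<Gamma>" "(SOME k. k \<in> \<Gamma> #>\<^bsub>SL2\<^esub> k') = \<gamma> ** k'" by (auto simp: r_coset_SL2)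
    then show ?thesis using Theta_invariant[OF f that] by simp
  qed
  then have "(\<integral>\<^sup>+m. ennreal ((norm (Theta \<Gamma> f (SOME k. k \<in> \<Gamma> #>\<^bsub>SL2\<^esub> (g ** \<eta> m))))\<^sup>2) \<partial>M) =
      (\<integral>\<^sup>+m. ennreal ((Theta \<Gamma> f (g ** \<eta> m))\<^sup>2) \<partial>M)"
    using g M(3) by (intro nn_integral_cong) (auto simp: SL2_mult_closed)
  then show "(\<integral>\<^sup>+m. ennreal ((norm (Theta \<Gamma> f (SOME k. k \<in> \<Gamma> #>\<^bsub>SL2\<^esub> (g ** \<eta> m))))\<^sup>2) \<partial>M) \<le> C"
    using bound[OF g] by simp
qed

end

section \<open>The bound for bounded parameters\<close>

lemma bottom_row_nonzero:
  fixes g :: "'a::real_normed_field^2^2"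
  assumes "g \<in> carrier SL2"
  shows "g $ 2 \<noteq> 0"
proof
  assume "g $ 2 = 0"
  then have "g $ 2 $ 1 = 0" "g $ 2 $ 2 = 0" by simp_all
  then show False using assms unfolding carrier_SL2_iff by simp
qed

lemma exp_half_ln_square:
  assumes "0 < r"
  shows "exp (- (- ln (r\<^sup>2)) / 2) = (r :: real)"
proof -
  have "ln (r\<^sup>2) = real 2 * ln r" using assms ln_realpow[of r 2] by simp
  then have "- (- ln (r\<^sup>2)) / 2 = ln r" by linarith
  then show ?thesis by (simp only: exp_ln assms)
qed

lemma upper_row [simp]:
  "(x ** n_mat z) $ 2 $ 1 = x $ 2 $ 1" "(x ** n_mat z) $ 2 $ 2 = x $ 2 $ 1 * z + x $ 2 $ 2"
  "(x ** a_mat s) $ 2 $ 1 = x $ 2 $ 1 * of_real (exp (s/2))"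
  "(x ** a_mat s) $ 2 $ 2 = x $ 2 $ 2 * of_real (exp (- s/2))"
  for x :: "'a::real_normed_field^2^2"
  by (simp_all add: n_mat_def a_mat_def)

lemma norm_row2_a_mat:
  "(norm ((x ** a_mat s) $ 2))\<^sup>2 = exp s * (norm (x $ 2 $ 1))\<^sup>2 + exp (- s) * (norm (x $ 2 $ 2))\<^sup>2"
  for x :: "'a::real_normed_field^2^2"
proof -
  have "(exp (s/2))\<^sup>2 = exp s" "(exp (- s/2))\<^sup>2 = exp (- s)"
    using exp_double[of "s/2"] exp_double[of "- s/2"] by simp_all
  then show ?thesis
    unfolding norm_row2 upper_row norm_mult norm_of_real
    by (simp add: power_mult_distrib mult.commute)
qed

section \<open>Measurability of matrix coordinates and product probability spaces\<close>

lemma continuous_on_mat2 [continuous_intros]: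
  fixes a b c d :: "'b::topological_space \<Rightarrow> 'a::real_normed_field"
  assumes "continuous_on S a" "continuous_on S b" "continuous_on S c" "continuous_on S d"
  shows "continuous_on S (\<lambda>x. mat2 (a x) (b x) (c x) (d x))"
proof -
  have eq: "(\<lambda>x. mat2 (a x) (b x) (c x) (d x)) =
    (\<lambda>x. \<chi> i j. if i = 1 then (if j = 1 then a x else b x) else (if j = 1 then c x else d x))"
    by (auto simp: matrix2_eq_iff)
  have "continuous_on S (\<lambda>x. if i = 1 then (if j = 1 then a x else b x) else (if j = 1 then c x else d x))"
    for i j :: 2 using assms by (cases "i = 1"; cases "j = 1") auto
  then show ?thesis unfolding eq by (intro continuous_on_vec_lambda)
qed

lemma borel_measurable_matrix2_mult [measurable (raw)]:
  fixes A B :: "'m \<Rightarrow> 'a::{real_normed_field,euclidean_space}^2^2"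
  assumes "A \<in> borel_measurable M" "B \<in> borel_measurable M"
  shows "(\<lambda>m. A m ** B m) \<in> borel_measurable M"
  using assms by (rule borel_measurable_continuous_Pair) (auto simp: split_beta' intro!: continuous_intros)

lemma borel_measurable_n_mat [measurable]:
  "(n_mat :: 'a::{real_normed_field,euclidean_space} \<Rightarrow> _) \<in> borel_measurable borel"
  unfolding n_mat_def by (intro borel_measurable_continuous_onI continuous_intros)

lemma borel_measurable_a_mat [measurable]:
  "(a_mat :: real \<Rightarrow> 'a::{real_normed_field,euclidean_space}^2^2) \<in> borel_measurable borel"
  unfolding a_mat_def by (intro borel_measurable_continuous_onI continuous_intros) auto

lemma prob_space_pair_measure:
  assumes "prob_space A" "prob_space B"
  shows "prob_space (A \<Otimes>\<^sub>M B)"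
proof -
  interpret A: prob_space A by fact
  interpret B: prob_space B by fact
  interpret pair_prob_space A B ..
  show ?thesis by unfold_locales
qed

lemma AE_pair_prob_space:
  assumes "prob_space A" "prob_space B"
    and P: "AE x in A. P x" "{x \<in> space A. P x} \<in> sets A"
    and Q: "AE y in B. Q y" "{y \<in> space B. Q y} \<in> sets B"
  shows "AE p in A \<Otimes>\<^sub>M B. P (fst p) \<and> Q (snd p)"
    "{p \<in> space (A \<Otimes>\<^sub>M B). P (fst p) \<and> Q (snd p)} \<in> sets (A \<Otimes>\<^sub>M B)"
proof -
  interpret A: prob_space A by fact
  interpret B: prob_space B by fact
  interpret pair_prob_space A B ..
  have eq: "{p \<in> space (A \<Otimes>\<^sub>M B). P (fst p) \<and> Q (snd p)} = {x \<in> space A. P x} \<times> {y \<in> space B. Q y}"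
    by (auto simp: space_pair_measure)
  show m: "{p \<in> space (A \<Otimes>\<^sub>M B). P (fst p) \<and> Q (snd p)} \<in> sets (A \<Otimes>\<^sub>M B)"
    unfolding eq using P Q by (intro pair_measureI)
  have "AE x in A. AE y in B. P x \<and> Q y"
    using P(1) by eventually_elim (use Q(1) in auto)
  then show "AE p in A \<Otimes>\<^sub>M B. P (fst p) \<and> Q (snd p)"
    using m by (intro AE_pair_measure) auto
qed

text \<open>The common features of SO(2) and SU(2) on which both cases rest: right multiplication
  preserves the norm of a bottom row, and every unit row occurs.\<close>

locale maximal_compact =
  fixes K :: "('a::{real_normed_field,euclidean_space}^2^2) set" and \<kappa> :: "('a^2^2) measure"
  assumes K_SL2: "K \<subseteq> carrier SL2"
    and K_closed: "\<And>k l. k \<in> K \<Longrightarrow> l \<in> K \<Longrightarrow> k ** l \<in> K" "\<And>k. k \<in> K \<Longrightarrow> adj2 k \<in> K"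
    and K_norm: "\<And>(x :: 'a^2^2) k. k \<in> K \<Longrightarrow> norm ((x ** k) $ 2) = norm (x $ 2)"
    and K_transitive: "\<And>w :: 'a^2. norm w = 1 \<Longrightarrow> \<exists>k\<in>K. k $ 2 = w"
    and haar: "haar_probability K \<kappa>"
begin

lemma prob_\<kappa>: "prob_space \<kappa>"
  using haar by (simp add: haar_probability_def)

lemma sets_\<kappa>: "sets \<kappa> = sets (restrict_space borel K)"
  using haar by (simp add: haar_probability_def)

lemma space_\<kappa>: "space \<kappa> = K"
  using sets_eq_imp_space_eq[OF sets_\<kappa>] by (simp add: space_restrict_space)

lemma id_measurable_\<kappa>: "(\<lambda>k. k) \<in> borel_measurable \<kappa>"
  by (subst measurable_cong_sets[OF sets_\<kappa> refl]) (rule measurable_restrict_space1, simp)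

lemma distr_\<kappa>:
  assumes k: "k \<in> K"
  shows "(\<lambda>x. k ** x) \<in> measurable \<kappa> \<kappa>" "distr \<kappa> \<kappa> (\<lambda>x. k ** x) = \<kappa>"
    "(\<lambda>x. x ** k) \<in> measurable \<kappa> \<kappa>" "distr \<kappa> \<kappa> (\<lambda>x. x ** k) = \<kappa>"
proof -
  have inv: "emeasure \<kappa> ((\<lambda>x. k ** x) ` B) = emeasure \<kappa> B" "emeasure \<kappa> ((\<lambda>x. x ** k) ` B) = emeasure \<kappa> B"
    if "k \<in> K" "B \<in> sets \<kappa>" for k B using haar that by (auto simp: haar_probability_def)
  have m: "f \<in> measurable \<kappa> \<kappa>" if "continuous_on UNIV f" "\<And>x. x \<in> K \<Longrightarrow> f x \<in> K" for f
  proof -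
    have "(\<lambda>x. f x) \<in> borel_measurable \<kappa>"
      by (rule measurable_compose[OF id_measurable_\<kappa> borel_measurable_continuous_onI[OF that(1)]])
    then have "f \<in> measurable \<kappa> (restrict_space borel K)"
      using that(2) by (intro measurable_restrict_space2) (auto simp: space_\<kappa>)
    then show ?thesis by (subst measurable_cong_sets[OF refl sets_\<kappa>])
  qed
  show ml: "(\<lambda>x. k ** x) \<in> measurable \<kappa> \<kappa>" by (rule m) (auto intro!: continuous_intros K_closed k)
  show mr: "(\<lambda>x. x ** k) \<in> measurable \<kappa> \<kappa>" by (rule m) (auto intro!: continuous_intros K_closed k)
  have sub: "B \<subseteq> K" if "B \<in> sets \<kappa>" for B using sets.sets_into_space[OF that] by (simp add: space_\<kappa>)
  have ak: "adj2 k \<in> K" "k \<in> carrier SL2" using k K_closed K_SL2 by auto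
  have "(\<lambda>x. k ** x) -` B \<inter> space \<kappa> = (\<lambda>x. adj2 k ** x) ` B" if "B \<in> sets \<kappa>" for B
  proof (intro equalityI subsetI)
    fix x assume "x \<in> (\<lambda>x. k ** x) -` B \<inter> space \<kappa>"
    then have "x = adj2 k ** (k ** x)" "k ** x \<in> B" using ak by (auto simp: matrix_mul_assoc)
    then show "x \<in> (\<lambda>x. adj2 k ** x) ` B" by blast
  next
    fix x assume "x \<in> (\<lambda>x. adj2 k ** x) ` B"
    then show "x \<in> (\<lambda>x. k ** x) -` B \<inter> space \<kappa>"
      using ak sub[OF that] by (auto simp: matrix_mul_assoc space_\<kappa> intro!: K_closed)
  qed
  then show "distr \<kappa> \<kappa> (\<lambda>x. k ** x) = \<kappa>"
    using ml inv(1)[OF ak(1)] by (intro measure_eqI) (auto simp: emeasure_distr)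
  have "(\<lambda>x. x ** k) -` B \<inter> space \<kappa> = (\<lambda>x. x ** adj2 k) ` B" if "B \<in> sets \<kappa>" for B
  proof (intro equalityI subsetI)
    fix x assume "x \<in> (\<lambda>x. x ** k) -` B \<inter> space \<kappa>"
    then have "x = (x ** k) ** adj2 k" "x ** k \<in> B" using ak by (auto simp flip: matrix_mul_assoc)
    then show "x \<in> (\<lambda>x. x ** adj2 k) ` B" by blast
  next
    fix x assume "x \<in> (\<lambda>x. x ** adj2 k) ` B"
    then show "x \<in> (\<lambda>x. x ** k) -` B \<inter> space \<kappa>"
      using ak sub[OF that] by (auto simp: space_\<kappa> simp flip: matrix_mul_assoc intro!: K_closed)
  qed
  then show "distr \<kappa> \<kappa> (\<lambda>x. x ** k) = \<kappa>"
    using mr inv(2)[OF ak(1)] by (intro measure_eqI) (auto simp: emeasure_distr)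
qed

text \<open>The bottom row of \<open>a_mat t ** k\<close> has norm exp(-t/2), which dictates
  \<open>t\<close>; transitivity on unit rows supplies \<open>k\<close>, and agreement of bottom
  rows supplies \<open>q\<close>.\<close>

lemma iwasawa:
  assumes g: "g \<in> carrier SL2"
  obtains q k where "q \<in> subgroup_Q" "k \<in> K" "g = q ** (a_mat (- ln ((norm (g $ 2))\<^sup>2)) ** k)"
proof -
  let ?N = "norm (g $ 2)"
  have "g $ 2 \<noteq> 0" by (rule bottom_row_nonzero[OF g])
  then have N: "?N > 0" by simp
  then have "norm ((1 / ?N) *\<^sub>R (g $ 2)) = 1" by simp
  then obtain k where k: "k \<in> K" "k $ 2 = (1 / ?N) *\<^sub>R (g $ 2)" using K_transitive by blast
  define t where "t = - ln (?N\<^sup>2)"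
  have e: "exp (- t / 2) = ?N" unfolding t_def using N by (rule exp_half_ln_square)
  have ak: "a_mat t ** k \<in> carrier SL2"
    by (intro SL2_mult_closed a_mat_in_SL2 subsetD[OF K_SL2] k(1))
  have row: "g $ 2 $ i = 1 * (a_mat t ** k) $ 2 $ i" for i
  proof -
    have "(a_mat t ** k) $ 2 $ i = of_real (exp (- t / 2)) * k $ 2 $ i" by (simp add: a_mat_def)
    also have "\<dots> = of_real ?N * ((1 / ?N) *\<^sub>R g $ 2 $ i)" unfolding e k(2) by simp
    also have "\<dots> = g $ 2 $ i" using N by (simp add: scaleR_conv_of_real)
    finally show ?thesis by simp
  qed
  obtain q where "q \<in> subgroup_Q" "g = q ** (a_mat t ** k)"
    by (rule same_bottom_row[OF g ak norm_one row row])
  then show thesis using k(1) that unfolding t_def by blast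
qed

end

text \<open>Off the group \<open>f\<close> is unconstrained, so it is replaced by zero there; the
  group is closed, being given by a polynomial equation.\<close>

lemma borel_measurable_on_SL2:
  fixes f :: "'a::{real_normed_field,euclidean_space}^2^2 \<Rightarrow> real"
  assumes "continuous_on (carrier SL2) f"
  shows "(\<lambda>g. if g \<in> carrier SL2 then f g else 0) \<in> borel_measurable borel"
proof -
  have "continuous_on UNIV (\<lambda>g :: 'a^2^2. g $ 1 $ 1 * g $ 2 $ 2 - g $ 1 $ 2 * g $ 2 $ 1)"
    by (intro continuous_intros)
  then have "closed {g :: 'a^2^2. g $ 1 $ 1 * g $ 2 $ 2 - g $ 1 $ 2 * g $ 2 $ 1 = 1}"
    by (rule closed_Collect_eq) (rule continuous_on_const)
  also have "{g :: 'a^2^2. g $ 1 $ 1 * g $ 2 $ 2 - g $ 1 $ 2 * g $ 2 $ 1 = 1} = carrier SL2"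
    by (auto simp: carrier_SL2_iff)
  finally have "(\<lambda>g. indicator (carrier SL2) g *\<^sub>R f g) \<in> borel_measurable borel"
    by (rule borel_measurable_continuous_on_indicator[OF borel_closed assms])
  also have "(\<lambda>g. indicator (carrier SL2) g *\<^sub>R f g) = (\<lambda>g. if g \<in> carrier SL2 then f g else 0)"
    by (rule ext) (simp only: indicator_def if_distrib scaleR_one scaleR_zero_left mult_1 of_bool_def split: if_split, simp)
  finally show ?thesis .
qed

text \<open>\<open>\<iota>\<close> is 1 in the real case and the imaginary unit in the complex case:
  unipotent translations move the second entry of a row with first entry a in the directions a and
  \<open>a * \<iota>\<close>. By \<open>hopf\<close>, the derivatives of the squared row norm along
  these directions and along the diagonal subgroup cannot all be small.\<close>

locale cusp_lattice_compact = cusp_lattice \<Gamma> \<sigma> h + maximal_compact K \<kappa>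
  for \<Gamma> :: "('a::{real_normed_field,euclidean_space}^2^2) set" and \<sigma>
    and h :: "'a::{real_normed_field,euclidean_space}" and K :: "('a::{real_normed_field,euclidean_space}^2^2) set" and \<kappa> +
  fixes \<iota> :: "'a::{real_normed_field,euclidean_space}"
  assumes \<iota>: "norm \<iota> = 1"
    and hopf: "\<And>a b :: 'a::{real_normed_field,euclidean_space}. (norm a)\<^sup>2 + (norm b)\<^sup>2 \<le>
      \<bar>(norm a)\<^sup>2 - (norm b)\<^sup>2\<bar> + 2 * \<bar>b \<bullet> a\<bar> + 2 * \<bar>b \<bullet> (a * \<iota>)\<bar>"
begin

text \<open>At most \<open>n\<close> rows contribute over the whole averaging region, so
  Cauchy-Schwarz reduces the square of the sum to \<open>n\<close> times a sum of squares. Averaged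
  over \<open>K\<close>, each square depends only on the norm of its row, and
  \<open>radial_average_le\<close> bounds the remaining average by 14 times the integral over all
  heights.\<close>

lemma Theta_norm_sq_le_bounded_height:
  fixes f :: "'a^2^2 \<Rightarrow> real"
  assumes cont: "continuous_on (carrier SL2) f"
    and f: "\<And>q g. q \<in> subgroup_Q \<Longrightarrow> g \<in> carrier SL2 \<Longrightarrow> f (q ** g) = f g"
    and supp: "\<And>t k. k \<in> K \<Longrightarrow> f (a_mat t ** k) \<noteq> 0 \<Longrightarrow> - T \<le> t"
  defines "n \<equiv> 2 * (2 * (5 * exp (T/2))\<^sup>2 * norm h + 1) ^ DIM('a)"
  shows "Theta_norm_sq \<Gamma> \<sigma> f \<le>
    ennreal (14 * n\<^sup>2) * (\<integral>\<^sup>+t. \<integral>\<^sup>+k. ennreal ((f (a_mat t ** k))\<^sup>2) \<partial>\<kappa> \<partial>lborel)"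
proof -
  define U where "U = unit_interval"
  have [measurable_cong, simp]: "sets U = sets borel" "space U = UNIV" by (simp_all add: U_def)
  have U: "prob_space U" unfolding U_def by (rule prob_space_unit_interval)
  interpret U: prob_space U by (rule U)
  interpret \<kappa>: prob_space \<kappa> by (rule prob_\<kappa>)
  define M where "M = U \<Otimes>\<^sub>M U \<Otimes>\<^sub>M U \<Otimes>\<^sub>M \<kappa>"
  have M3: "prob_space (U \<Otimes>\<^sub>M \<kappa>)" by (intro prob_space_pair_measure U prob_\<kappa>)
  have M2: "prob_space (U \<Otimes>\<^sub>M U \<Otimes>\<^sub>M \<kappa>)" by (intro prob_space_pair_measure U M3)
  have M: "prob_space M" unfolding M_def by (intro prob_space_pair_measure U M2)
  interpret M3: prob_space "U \<Otimes>\<^sub>M \<kappa>" by (rule M3)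
  interpret M2: prob_space "U \<Otimes>\<^sub>M U \<Otimes>\<^sub>M \<kappa>" by (rule M2)
  define p where "p s x y = n_mat (of_real x + \<iota> * of_real y) ** (a_mat s :: 'a^2^2)" for s x y
  define \<eta> where "\<eta> = (\<lambda>(s, x, y, k :: 'a^2^2). p s x y ** k)"
  have p_SL2: "p s x y \<in> carrier SL2" for s x y unfolding p_def by (intro SL2_mult_closed) auto
  have \<eta>_SL2: "\<eta> m \<in> carrier SL2" if "m \<in> space M" for m
    using that K_SL2 p_SL2 by (auto simp: M_def space_pair_measure space_\<kappa> \<eta>_def)
  define F where "F g = ennreal ((if g \<in> carrier SL2 then f g else 0)\<^sup>2)" for g
  have F: "F \<in> borel_measurable borel"
    unfolding F_def using borel_measurable_on_SL2[OF cont] by measurable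
  note id_measurable_\<kappa>[measurable] F[measurable]
  have FQ: "F (q ** g) = F g" if "q \<in> subgroup_Q" "g \<in> carrier SL2" for q g
  proof -
    have "q \<in> carrier SL2" using that(1) by (auto simp: subgroup_Q_def carrier_SL2_iff intro!: right_inverse)
    then show ?thesis using that f by (auto simp: F_def SL2_mult_closed)
  qed
  have F_SL2: "F g = ennreal ((f g)\<^sup>2)" if "g \<in> carrier SL2" for g using that by (simp add: F_def)
  have "continuous_on UNIV (\<lambda>(s, x, y). p s x y)"
    unfolding p_def n_mat_def a_mat_def split_beta' by (intro continuous_intros) auto
  from borel_measurable_continuous_onI[OF this]
  have "(\<lambda>(s, x, y). p s x y) \<in> borel_measurable (borel \<Otimes>\<^sub>M borel \<Otimes>\<^sub>M borel)"
    by (simp add: borel_prod)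
  note [measurable (raw)] = measurable_compose3[OF this]
  have \<eta>m: "\<eta> \<in> borel_measurable M"
    unfolding \<eta>_def M_def split_beta' by measurable
  define \<Phi> where "\<Phi> t = (\<integral>\<^sup>+k. F (a_mat t ** k) \<partial>\<kappa>)" for t
  have \<Phi> [measurable]: "\<Phi> \<in> borel_measurable borel"
    unfolding \<Phi>_def using F by measurable
  \<comment> \<open>The \<open>K\<close>-part of the Iwasawa decomposition is absorbed by invariance
    of the Haar measure, leaving only the row norm.\<close>
  have inner: "(\<integral>\<^sup>+k. F (g ** k) \<partial>\<kappa>) = \<Phi> (- ln ((norm (g $ 2))\<^sup>2))" if g: "g \<in> carrier SL2" for g
  proof -
    obtain q k0 where qk: "q \<in> subgroup_Q" "k0 \<in> K" "g = q ** (a_mat (- ln ((norm (g $ 2))\<^sup>2)) ** k0)"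
      using iwasawa[OF g] by metis
    define t where "t = - ln ((norm (g $ 2))\<^sup>2)"
    have "(\<integral>\<^sup>+k. F (g ** k) \<partial>\<kappa>) = (\<integral>\<^sup>+k. F (a_mat t ** (k0 ** k)) \<partial>\<kappa>)"
    proof (rule nn_integral_cong)
      fix k assume "k \<in> space \<kappa>"
      then have "a_mat t ** (k0 ** k) \<in> carrier SL2"
        using qk(2) K_SL2 by (intro SL2_mult_closed) (auto simp: space_\<kappa>)
      moreover have "g ** k = q ** (a_mat t ** (k0 ** k))"
        by (subst qk(3)) (simp only: t_def matrix_mul_assoc)
      ultimately show "F (g ** k) = F (a_mat t ** (k0 ** k))" using FQ qk(1) by simp
    qed
    also have "\<dots> = (\<integral>\<^sup>+k. F (a_mat t ** k) \<partial>distr \<kappa> \<kappa> (\<lambda>k. k0 ** k))"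
      by (rule nn_integral_distr[OF distr_\<kappa>(1)[OF qk(2)], symmetric]) measurable
    finally show ?thesis by (simp add: distr_\<kappa>(2)[OF qk(2)] \<Phi>_def t_def)
  qed
  have mean: "(\<integral>\<^sup>+m. F (g ** \<eta> m) \<partial>M) \<le> 14 * (\<integral>\<^sup>+t. \<Phi> t \<partial>lborel)" if g: "g \<in> carrier SL2" for g
  proof -
    define c where "c = g $ 2 $ 1"
    define d where "d = g $ 2 $ 2"
    have cd: "c \<noteq> 0 \<or> d \<noteq> 0" using g by (auto simp: carrier_SL2_iff c_def d_def)
    have row: "(norm ((g ** p s x y) $ 2))\<^sup>2 =
      exp s * (norm c)\<^sup>2 + exp (- s) * (norm (d + x *\<^sub>R c + y *\<^sub>R (c * \<iota>)))\<^sup>2" for s x y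
    proof -
      have "c * (of_real x + \<iota> * of_real y) + d = d + x *\<^sub>R c + y *\<^sub>R (c * \<iota>)"
        by (simp add: scaleR_conv_of_real algebra_simps)
      then show ?thesis
        unfolding p_def matrix_mul_assoc norm_row2_a_mat upper_row c_def[symmetric] d_def[symmetric]
        by (simp only:)
    qed
    have meas: "(\<lambda>m. F (g ** \<eta> m)) \<in> borel_measurable (U \<Otimes>\<^sub>M U \<Otimes>\<^sub>M U \<Otimes>\<^sub>M \<kappa>)"
      using F \<eta>m unfolding M_def by measurable
    have meas1: "(\<lambda>m. F (g ** \<eta> (s, m))) \<in> borel_measurable (U \<Otimes>\<^sub>M U \<Otimes>\<^sub>M \<kappa>)" for s
      by (rule measurable_compose[OF measurable_Pair1' meas]) simp
    have meas2: "(\<lambda>m. F (g ** \<eta> (s, x, m))) \<in> borel_measurable (U \<Otimes>\<^sub>M \<kappa>)" for s x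
      by (rule measurable_compose[OF measurable_Pair1' meas1]) simp
    have "(\<integral>\<^sup>+m. F (g ** \<eta> m) \<partial>M) = (\<integral>\<^sup>+s. \<integral>\<^sup>+m. F (g ** \<eta> (s, m)) \<partial>(U \<Otimes>\<^sub>M U \<Otimes>\<^sub>M \<kappa>) \<partial>U)"
      unfolding M_def by (rule M2.nn_integral_fst[OF meas, symmetric])
    also have "\<dots> = (\<integral>\<^sup>+s. \<integral>\<^sup>+x. \<integral>\<^sup>+m. F (g ** \<eta> (s, x, m)) \<partial>(U \<Otimes>\<^sub>M \<kappa>) \<partial>U \<partial>U)"
      by (intro nn_integral_cong M3.nn_integral_fst[symmetric] meas1)
    also have "\<dots> = (\<integral>\<^sup>+s. \<integral>\<^sup>+x. \<integral>\<^sup>+y. \<integral>\<^sup>+k. F (g ** \<eta> (s, x, y, k)) \<partial>\<kappa> \<partial>U \<partial>U \<partial>U)"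
      by (intro nn_integral_cong \<kappa>.nn_integral_fst[symmetric] meas2)
    also have "\<dots> = (\<integral>\<^sup>+s. \<integral>\<^sup>+x. \<integral>\<^sup>+y. \<Phi> (- ln ((norm ((g ** p s x y) $ 2))\<^sup>2)) \<partial>U \<partial>U \<partial>U)"
      using g p_SL2 by (intro nn_integral_cong) (simp add: \<eta>_def matrix_mul_assoc inner SL2_mult_closed del: matrix2_mult_nth)
    also have "\<dots> \<le> 14 * (\<integral>\<^sup>+t. \<Phi> t \<partial>lborel)"
      unfolding row U_def
    proof (rule radial_average_le[OF \<Phi>])
      show "c \<noteq> 0 \<or> d + x *\<^sub>R c + y *\<^sub>R (c * \<iota>) \<noteq> 0" for x y using cd by auto
      fix u :: 'a and t :: real assume t: "t > 0"
      have "(norm (sqrt t *\<^sub>R c))\<^sup>2 = t * (norm c)\<^sup>2" "(norm ((1 / sqrt t) *\<^sub>R u))\<^sup>2 = (norm u)\<^sup>2 / t"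
        using t by (simp_all add: power_mult_distrib power_divide)
      moreover have "((1 / sqrt t) *\<^sub>R u) \<bullet> (sqrt t *\<^sub>R c) = u \<bullet> c" "((1 / sqrt t) *\<^sub>R u) \<bullet> ((sqrt t *\<^sub>R c) * \<iota>) = u \<bullet> (c * \<iota>)"
        using t by simp_all
      ultimately show "t * (norm c)\<^sup>2 + (norm u)\<^sup>2 / t \<le>
          \<bar>t * (norm c)\<^sup>2 - (norm u)\<^sup>2 / t\<bar> + 2 * \<bar>u \<bullet> c\<bar> + 2 * \<bar>u \<bullet> (c * \<iota>)\<bar>"
        using hopf[of "sqrt t *\<^sub>R c" "(1 / sqrt t) *\<^sub>R u"] by simp
    qed
    finally show ?thesis .
  qed
  \<comment> \<open>Undoing translation and dilation: the first entry costs a factor 1, the second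
    at most 2 + 2, because exp(s/2) and the translation are bounded by 2. This is the 5 in the
    radius.\<close>
  have row_le: "norm (g $ 2) \<le> 5 * norm ((g ** p s x y) $ 2)"
    if "s \<in> {0..1}" "x \<in> {0..1}" "y \<in> {0..1}" for g :: "'a^2^2" and s x y
  proof -
    define v where "v = (g ** p s x y) $ 2"
    define z where "z = of_real x + \<iota> * of_real y"
    have z: "norm z \<le> 2"
      unfolding z_def using that \<iota> by (intro norm_triangle_le) (simp add: norm_mult)
    have v: "v $ 1 = g $ 2 $ 1 * of_real (exp (s/2))" "v $ 2 = (g $ 2 $ 1 * z + g $ 2 $ 2) * of_real (exp (- s/2))"
      unfolding v_def p_def matrix_mul_assoc upper_row z_def by simp_all
    have nv: "norm (v $ 1) \<le> norm v" "norm (v $ 2) \<le> norm v" by (rule Finite_Cartesian_Product.norm_nth_le)+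
    have "norm (g $ 2 $ 1) * 1 \<le> norm (g $ 2 $ 1) * exp (s/2)" using that by (intro mult_left_mono) auto
    then have c: "norm (g $ 2 $ 1) \<le> norm v" using nv(1) by (simp add: v norm_mult)
    have "exp (s/2) \<le> exp (1/2)" using that by simp
    also have "exp (1/2 :: real) \<le> 2" using exp_half_le2 .
    finally have e: "exp (s/2) \<le> 2" .
    have "norm (g $ 2 $ 1 * z + g $ 2 $ 2) = exp (s/2) * norm (v $ 2)"
      unfolding v norm_mult norm_of_real abs_exp_cancel by (simp add: exp_minus)
    also have "\<dots> \<le> 2 * norm v" using e nv(2) by (intro mult_mono) auto
    finally have "norm (g $ 2 $ 1 * z + g $ 2 $ 2) \<le> 2 * norm v" .
    moreover have "norm (g $ 2 $ 1 * z) \<le> norm v * 2" unfolding norm_mult using c z by (intro mult_mono) auto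
    moreover have "norm (g $ 2 $ 2) \<le> norm (g $ 2 $ 1 * z + g $ 2 $ 2) + norm (g $ 2 $ 1 * z)"
      using norm_triangle_ineq4[of "g $ 2 $ 1 * z + g $ 2 $ 2" "g $ 2 $ 1 * z"] by simp
    ultimately have d: "norm (g $ 2 $ 2) \<le> 4 * norm v" by linarith
    have "norm (g $ 2) \<le> norm (g $ 2 $ 1) + norm (g $ 2 $ 2)"
      unfolding norm_row2 by (rule sqrt_sum_squares_le_sum) auto
    then show ?thesis using c d by (simp add: v_def)
  qed
  have AE_U: "AE s in U. s \<in> {0..1}"
    unfolding U_def unit_interval_def by (rule AE_uniform_measureI) auto
  show ?thesis
  proof (rule Theta_norm_sq_le_of_averages[OF f M \<eta>m \<eta>_SL2])
    fix g :: "'a^2^2" assume g: "g \<in> carrier SL2"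
    define R where "R = 5 * exp (T/2)"
    define A where "A = {c \<in> cosets. norm ((rep c ** g) $ 2) \<le> R}"
    have R: "R > 0" by (simp add: R_def)
    have A: "finite A" "real (card A) \<le> n"
      using count_ball[OF g R] by (simp_all add: A_def n_def R_def del: matrix2_mult_nth)
    have xg: "rep c ** g ** \<eta> m \<in> carrier SL2" if "c \<in> cosets" "m \<in> space M" for c m
      using that rep_in_SL2 g \<eta>_SL2 by blast
    have pt: "ennreal ((Theta \<Gamma> f (g ** \<eta> m))\<^sup>2) \<le> ennreal n * (\<Sum>c\<in>A. F (rep c ** g ** \<eta> m))"
      if m: "m = (s, x, y, k)" "m \<in> space M" "s \<in> {0..1}" "x \<in> {0..1}" "y \<in> {0..1}" for m s x y k
    proof -
      have "Theta \<Gamma> f (g ** \<eta> m) = (\<Sum>c\<in>A. f (rep c ** (g ** \<eta> m)))"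
      proof (rule Theta_finite_sum)
        fix c assume c: "c \<in> cosets" "f (rep c ** (g ** \<eta> m)) \<noteq> 0"
        define X where "X = rep c ** g ** \<eta> m"
        have X: "X \<in> carrier SL2" "f X \<noteq> 0" using c xg m by (auto simp: X_def matrix_mul_assoc)
        obtain q k0 where qk: "q \<in> subgroup_Q" "k0 \<in> K" "X = q ** (a_mat (- ln ((norm (X $ 2))\<^sup>2)) ** k0)"
          using iwasawa[OF X(1)] by metis
        have "f X = f (a_mat (- ln ((norm (X $ 2))\<^sup>2)) ** k0)"
          by (subst qk(3), rule f) (use qk K_SL2 in auto)
        then have "- T \<le> - ln ((norm (X $ 2))\<^sup>2)" using X(2) by (intro supp[OF qk(2)]) simp
        moreover have "X $ 2 \<noteq> 0" by (rule bottom_row_nonzero[OF X(1)])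
        ultimately have "exp (- (- ln ((norm (X $ 2))\<^sup>2)) / 2) \<le> exp (T/2)" "0 < norm (X $ 2)" by simp_all
        then have "norm (X $ 2) \<le> exp (T/2)" by (simp only: exp_half_ln_square)
        moreover have "norm (X $ 2) = norm ((rep c ** g ** p s x y) $ 2)"
          using m by (simp only: X_def \<eta>_def prod.case matrix_mul_assoc)
            (rule K_norm, auto simp: M_def space_pair_measure space_\<kappa>)
        moreover have "norm ((rep c ** g) $ 2) \<le> 5 * norm ((rep c ** g ** p s x y) $ 2)"
          using row_le m by blast
        ultimately show "c \<in> A" using c by (simp add: A_def R_def del: matrix2_mult_nth)
      qed (use A in \<open>auto simp: A_def\<close>)
      then have "(Theta \<Gamma> f (g ** \<eta> m))\<^sup>2 \<le> real (card A) * (\<Sum>c\<in>A. (f (rep c ** (g ** \<eta> m)))\<^sup>2)"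
        using sum_squared_le_sum_of_squares[of "\<lambda>c. f (rep c ** (g ** \<eta> m))" A] by (simp add: mult.commute del: matrix2_mult_nth)
      also have "\<dots> \<le> n * (\<Sum>c\<in>A. (f (rep c ** (g ** \<eta> m)))\<^sup>2)"
        using A by (intro mult_right_mono sum_nonneg) auto
      finally have "ennreal ((Theta \<Gamma> f (g ** \<eta> m))\<^sup>2) \<le> ennreal n * (\<Sum>c\<in>A. ennreal ((f (rep c ** (g ** \<eta> m)))\<^sup>2))"
        using A(2) by (subst sum_ennreal) (auto simp: ennreal_leI sum_nonneg simp flip: ennreal_mult)
      also have "(\<Sum>c\<in>A. ennreal ((f (rep c ** (g ** \<eta> m)))\<^sup>2)) = (\<Sum>c\<in>A. F (rep c ** g ** \<eta> m))"
        using xg m by (intro sum.cong) (auto simp: F_SL2 A_def matrix_mul_assoc simp del: matrix2_mult_nth)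
      finally show ?thesis .
    qed
    have AE_M: "AE m in M. fst m \<in> {0..1} \<and> fst (snd m) \<in> {0..1} \<and> fst (snd (snd m)) \<in> {0..1}"
    proof -
      have ms: "{s \<in> space U. s \<in> {0..1}} \<in> sets U" by simp
      have mt: "AE k in \<kappa>. True" "{k \<in> space \<kappa>. True} \<in> sets \<kappa>" by simp_all
      note 1 = AE_pair_prob_space[OF U prob_\<kappa> AE_U ms mt]
      note 2 = AE_pair_prob_space[OF U M3 AE_U ms 1]
      show ?thesis unfolding M_def using AE_pair_prob_space(1)[OF U M2 AE_U ms 2] by simp
    qed
    have "(\<integral>\<^sup>+m. ennreal ((Theta \<Gamma> f (g ** \<eta> m))\<^sup>2) \<partial>M) \<le>
        (\<integral>\<^sup>+m. ennreal n * (\<Sum>c\<in>A. F (rep c ** g ** \<eta> m)) \<partial>M)"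
    proof (rule nn_integral_mono_AE)
      show "AE m in M. ennreal ((Theta \<Gamma> f (g ** \<eta> m))\<^sup>2) \<le> ennreal n * (\<Sum>c\<in>A. F (rep c ** g ** \<eta> m))"
        using AE_M AE_space
      proof eventually_elim
        case (elim m)
        then show ?case using pt[of m "fst m" "fst (snd m)" "fst (snd (snd m))" "snd (snd (snd m))"] by simp
      qed
    qed
    also have "\<dots> = ennreal n * (\<Sum>c\<in>A. \<integral>\<^sup>+m. F (rep c ** g ** \<eta> m) \<partial>M)"
    proof -
      have [measurable]: "(\<lambda>m. F (rep c ** g ** \<eta> m)) \<in> borel_measurable M" for c
        using F \<eta>m by measurable
      show ?thesis by (subst nn_integral_cmult) (auto simp: nn_integral_sum simp del: matrix2_mult_nth)
    qed
    also have "\<dots> \<le> ennreal n * (\<Sum>c\<in>A. 14 * (\<integral>\<^sup>+t. \<Phi> t \<partial>lborel))"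
      using rep_in_SL2 g by (intro mult_left_mono sum_mono mean) (auto simp: A_def)
    also have "\<dots> = ennreal n * (ennreal (real (card A)) * (14 * (\<integral>\<^sup>+t. \<Phi> t \<partial>lborel)))"
      by (simp add: ennreal_of_nat_eq_real_of_nat)
    also have "\<dots> \<le> ennreal n * (ennreal n * (14 * (\<integral>\<^sup>+t. \<Phi> t \<partial>lborel)))"
      using A(2) by (intro mult_left_mono mult_right_mono ennreal_leI) auto
    also have "\<dots> = ennreal (14 * n\<^sup>2) * (\<integral>\<^sup>+t. \<Phi> t \<partial>lborel)"
    proof -
      have "n \<ge> 0" using A(2) by linarith
      then show ?thesis by (simp add: ennreal_mult power2_eq_square mult_ac)
    qed
    also have "(\<integral>\<^sup>+t. \<Phi> t \<partial>lborel) = (\<integral>\<^sup>+t. \<integral>\<^sup>+k. ennreal ((f (a_mat t ** k))\<^sup>2) \<partial>\<kappa> \<partial>lborel)"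
      unfolding \<Phi>_def using K_SL2 by (intro nn_integral_cong F_SL2) (auto simp: space_\<kappa>)
    finally show "(\<integral>\<^sup>+m. ennreal ((Theta \<Gamma> f (g ** \<eta> m))\<^sup>2) \<partial>M) \<le>
      ennreal (14 * n\<^sup>2) * (\<integral>\<^sup>+t. \<integral>\<^sup>+k. ennreal ((f (a_mat t ** k))\<^sup>2) \<partial>\<kappa> \<partial>lborel)" .
  qed
qed

end

section \<open>Lower bounds for the norms\<close>

text \<open>Among the separated subsets of the unit ball, whose size packing bounds, one of maximal
  size is a net: a point far from it could be added.\<close>

lemma ex_net_cball:
  assumes \<rho>: "\<rho> > 0"
  obtains S where "finite S" "S \<subseteq> cball (0 :: 'b::euclidean_space) 1" "real (card S) \<le> (2 / \<rho> + 1) ^ DIM('b)"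
    "\<And>z. norm z \<le> 1 \<Longrightarrow> \<exists>s\<in>S. dist z s \<le> \<rho>"
proof -
  define P where "P S \<longleftrightarrow> finite S \<and> S \<subseteq> cball (0 :: 'b) 1 \<and> (\<forall>x\<in>S. \<forall>y\<in>S. x \<noteq> y \<longrightarrow> \<rho> \<le> dist x y)" for S
  have card: "real (card S) \<le> (2 / \<rho> + 1) ^ DIM('b)" if "P S" for S
    using packing_bound[of S 0 1 \<rho>] that \<rho> by (auto simp: P_def)
  have "\<forall>S. P S \<longrightarrow> card S < Suc (nat \<lfloor>(2 / \<rho> + 1) ^ DIM('b)\<rfloor>)"
    using card by (auto simp: less_Suc_eq_le le_nat_floor)
  moreover have "P {}" by (simp add: P_def)
  ultimately obtain S where S: "P S" "\<And>S'. P S' \<Longrightarrow> card S' \<le> card S"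
    using ex_has_greatest_nat[of P "{}" card] by metis
  have "\<exists>s\<in>S. dist z s \<le> \<rho>" if z: "norm z \<le> 1" for z
  proof (rule ccontr)
    assume "\<not> (\<exists>s\<in>S. dist z s \<le> \<rho>)"
    then have far: "\<rho> < dist z s" if "s \<in> S" for s using that by (simp add: not_le)
    then have "z \<notin> S" using \<rho> by force
    moreover have "P (insert z S)"
      using S(1) z far unfolding P_def by (auto simp: dist_commute less_imp_le)
    ultimately show False using S(2)[of "insert z S"] S(1) by (simp add: P_def)
  qed
  then show thesis using that[of S] S(1) card[OF S(1)] by (auto simp: P_def)
qed

context maximal_compact
begin

lemma K_row_norm: "k \<in> K \<Longrightarrow> norm (k $ 2) = 1"
  using K_norm[of k "mat 1"] by (simp add: norm_row2)

text \<open>The entry is the determinant of the bottom rows of \<open>k\<close> and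
  \<open>u\<close>; for \<open>u\<close> in \<open>K\<close> its norm is the chordal distance of the
  two points of the projective line that these rows define.\<close>

definition disc :: "'a^2^2 \<Rightarrow> real \<Rightarrow> ('a^2^2) set" where
  "disc u \<rho> = {k \<in> K. norm ((k ** adj2 u) $ 2 $ 1) \<le> \<rho>}"

lemma disc_sets [measurable]: "disc u \<rho> \<in> sets \<kappa>"
proof -
  have "(\<lambda>k. norm ((k ** adj2 u) $ 2 $ 1)) \<in> borel_measurable \<kappa>"
    by (intro measurable_compose[OF id_measurable_\<kappa>] borel_measurable_continuous_onI continuous_intros)
  then have "{k \<in> space \<kappa>. norm ((k ** adj2 u) $ 2 $ 1) \<le> \<rho>} \<in> sets \<kappa>" by measurable
  then show ?thesis by (simp add: disc_def space_\<kappa>)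
qed

lemma measure_disc:
  assumes u: "u \<in> K"
  shows "measure \<kappa> (disc u \<rho>) = measure \<kappa> (disc (mat 1) \<rho>)"
proof -
  have au: "adj2 u \<in> K" by (rule K_closed(2)[OF u])
  have id: "(k ** adj2 (mat 1 :: 'a^2^2)) $ 2 $ 1 = k $ 2 $ 1" for k :: "'a^2^2" by (simp add: adj2_def)
  have "measure \<kappa> (disc (mat 1) \<rho>) = measure (distr \<kappa> \<kappa> (\<lambda>k. k ** adj2 u)) (disc (mat 1) \<rho>)"
    by (simp only: distr_\<kappa>(4)[OF au])
  also have "\<dots> = measure \<kappa> ((\<lambda>k. k ** adj2 u) -` disc (mat 1) \<rho> \<inter> space \<kappa>)"
    by (rule measure_distr[OF distr_\<kappa>(3)[OF au] disc_sets])
  also have "(\<lambda>k. k ** adj2 u) -` disc (mat 1) \<rho> \<inter> space \<kappa> = disc u \<rho>"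
    unfolding disc_def id space_\<kappa> using K_closed(1)[OF _ au] by blast
  finally show ?thesis by simp
qed

text \<open>All discs of one radius have equal measure by right invariance, and those about rows
  proportional to (s, 1) and (1, s), with s in a net of the unit ball, cover \<open>K\<close>. There
  are at most 2 (3/\<rho>)^d of them, where d is the real dimension of the field.\<close>

lemma measure_disc_ge:
  assumes \<rho>: "0 < \<rho>" "\<rho> \<le> 1" and u: "u \<in> K"
  shows "(\<rho> / 3) ^ DIM('a) / 2 \<le> measure \<kappa> (disc u \<rho>)"
proof -
  interpret prob_space \<kappa> by (rule prob_\<kappa>)
  obtain S :: "'a set" where S: "finite S" "S \<subseteq> cball 0 1" "real (card S) \<le> (2 / \<rho> + 1) ^ DIM('a)"
    "\<And>z. norm z \<le> 1 \<Longrightarrow> \<exists>s\<in>S. dist z s \<le> \<rho>"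
    using ex_net_cball[OF \<rho>(1)] by metis
  have "\<exists>k\<in>K. \<exists>r>0. r \<le> 1 \<and> k $ 2 $ 1 = x * of_real r \<and> k $ 2 $ 2 = y * of_real r"
    if xy: "x = 1 \<or> y = 1" for x y :: 'a
  proof -
    define w :: "'a^2" where "w = vector [x, y]"
    have w: "w $ 1 = x" "w $ 2 = y" by (simp_all add: w_def vector_2)
    have nw: "norm w = sqrt ((norm x)\<^sup>2 + (norm y)\<^sup>2)" by (simp add: norm_row2 w)
    have w1: "1 \<le> norm w" unfolding nw using xy by auto
    then have "w \<noteq> 0" by force
    then have "norm ((1 / norm w) *\<^sub>R w) = 1" by simp
    then obtain k where k: "k \<in> K" "k $ 2 = (1 / norm w) *\<^sub>R w" using K_transitive by blast
    show ?thesis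
    proof (intro bexI[OF _ k(1)] exI[of _ "1 / norm w"] conjI)
      show "k $ 2 $ 1 = x * of_real (1 / norm w)" "k $ 2 $ 2 = y * of_real (1 / norm w)"
        unfolding k(2) vector_scaleR_component w by (simp_all only: scaleR_conv_of_real mult.commute)
      show "0 < 1 / norm w" using w1 by (intro divide_pos_pos) linarith+
      show "1 / norm w \<le> 1" using w1 by (subst divide_le_eq_1) linarith
    qed
  qed
  then obtain U where U: "\<And>x y :: 'a. x = 1 \<or> y = 1 \<Longrightarrow> U x y \<in> K \<and> (\<exists>r>0. r \<le> 1 \<and>
      U x y $ 2 $ 1 = x * of_real r \<and> U x y $ 2 $ 2 = y * of_real r)"
    by metis
  have cover: "space \<kappa> \<subseteq> (\<Union>s\<in>S. disc (U s 1) \<rho>) \<union> (\<Union>s\<in>S. disc (U 1 s) \<rho>)"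
  proof
    fix k assume "k \<in> space \<kappa>"
    then have k: "k \<in> K" by (simp add: space_\<kappa>)
    define p where "p = k $ 2 $ 1"
    define q where "q = k $ 2 $ 2"
    have pq: "norm p \<le> 1" "norm q \<le> 1"
      using Finite_Cartesian_Product.norm_nth_le[of "k $ 2"] K_row_norm[OF k] by (auto simp: p_def q_def)
    have "(norm p)\<^sup>2 + (norm q)\<^sup>2 = 1" using K_row_norm[OF k] by (simp add: norm_row2 p_def q_def)
    then have nz: "p \<noteq> 0 \<or> q \<noteq> 0" by auto
    have row: "(k ** adj2 u) $ 2 $ 1 = p * u $ 2 $ 2 - q * u $ 2 $ 1" for u
      by (simp add: adj2_def p_def q_def)
    show "k \<in> (\<Union>s\<in>S. disc (U s 1) \<rho>) \<union> (\<Union>s\<in>S. disc (U 1 s) \<rho>)"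
    proof (cases "norm p \<le> norm q")
      case True
      then have q: "q \<noteq> 0" using nz by auto
      then obtain s where s: "s \<in> S" "dist (p / q) s \<le> \<rho>" using S(4)[of "p / q"] True by (auto simp: norm_divide)
      obtain r where r: "0 < r" "r \<le> 1" "U s 1 $ 2 $ 1 = s * of_real r" "U s 1 $ 2 $ 2 = 1 * of_real r" using U[of s 1] by blast
      have "(k ** adj2 (U s 1)) $ 2 $ 1 = q * (p / q - s) * of_real r"
        unfolding row r using q by (simp add: field_simps)
      then have "norm ((k ** adj2 (U s 1)) $ 2 $ 1) = norm q * dist (p / q) s * r"
        using r(1) by (simp add: norm_mult dist_norm del: matrix2_mult_nth)
      also have "\<dots> \<le> 1 * \<rho> * 1" using pq s(2) r \<rho> by (intro mult_mono) auto
      finally have "k \<in> disc (U s 1) \<rho>" using k by (simp add: disc_def del: matrix2_mult_nth)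
      then show ?thesis using s(1) by blast
    next
      case False
      then have p: "p \<noteq> 0" by auto
      then obtain s where s: "s \<in> S" "dist (q / p) s \<le> \<rho>" using S(4)[of "q / p"] False by (auto simp: norm_divide)
      obtain r where r: "0 < r" "r \<le> 1" "U 1 s $ 2 $ 1 = 1 * of_real r" "U 1 s $ 2 $ 2 = s * of_real r" using U[of 1 s] by blast
      have "(k ** adj2 (U 1 s)) $ 2 $ 1 = - (p * (q / p - s) * of_real r)"
        unfolding row r using p by (simp add: field_simps)
      then have "norm ((k ** adj2 (U 1 s)) $ 2 $ 1) = norm p * dist (q / p) s * r"
        using r(1) by (simp add: norm_mult dist_norm del: matrix2_mult_nth)
      also have "\<dots> \<le> 1 * \<rho> * 1" using pq s(2) r \<rho> by (intro mult_mono) auto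
      finally have "k \<in> disc (U 1 s) \<rho>" using k by (simp add: disc_def del: matrix2_mult_nth)
      then show ?thesis using s(1) by blast
    qed
  qed
  let ?m = "measure \<kappa> (disc u \<rho>)"
  have m: "measure \<kappa> (disc v \<rho>) = ?m" if "v \<in> K" for v using measure_disc[OF that] measure_disc[OF u] by simp
  have "1 = measure \<kappa> (space \<kappa>)" by (simp add: prob_space)
  also have "\<dots> \<le> measure \<kappa> ((\<Union>s\<in>S. disc (U s 1) \<rho>) \<union> (\<Union>s\<in>S. disc (U 1 s) \<rho>))"
    using S(1) by (intro finite_measure_mono cover sets.Un sets.finite_UN disc_sets)
  also have "\<dots> \<le> measure \<kappa> (\<Union>s\<in>S. disc (U s 1) \<rho>) + measure \<kappa> (\<Union>s\<in>S. disc (U 1 s) \<rho>)"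
    using S(1) by (intro measure_Un_le sets.finite_UN disc_sets)
  also have "\<dots> \<le> (\<Sum>s\<in>S. measure \<kappa> (disc (U s 1) \<rho>)) + (\<Sum>s\<in>S. measure \<kappa> (disc (U 1 s) \<rho>))"
    using S(1) by (intro add_mono finite_measure_subadditive_finite) auto
  also have "\<dots> = 2 * (real (card S) * ?m)" using U by (simp add: m)
  also have "real (card S) * ?m \<le> (3 / \<rho>) ^ DIM('a) * ?m"
  proof (rule mult_right_mono)
    have "(2 / \<rho> + 1) ^ DIM('a) \<le> (3 / \<rho>) ^ DIM('a)"
      using \<rho> by (intro power_mono) (auto simp: field_simps)
    then show "real (card S) \<le> (3 / \<rho>) ^ DIM('a)" using S(3) by linarith
  qed simp
  finally have "1 / 2 \<le> (3 / \<rho>) ^ DIM('a) * ?m" by simp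
  then have "(\<rho> / 3) ^ DIM('a) * (1 / 2) \<le> (\<rho> / 3) ^ DIM('a) * ((3 / \<rho>) ^ DIM('a) * ?m)"
    using \<rho> by (intro mult_left_mono) auto
  also have "\<dots> = ((\<rho> / 3) * (3 / \<rho>)) ^ DIM('a) * ?m" by (simp only: power_mult_distrib mult.assoc)
  also have "\<dots> = ?m" using \<rho> by simp
  finally show ?thesis by simp
qed

text \<open>A triangle inequality for the determinant distance: if A and B are the quotients of a
  common point by \<open>u\<close> and \<open>u'\<close>, the quotient of \<open>u\<close> by
  \<open>u'\<close> is the inverse of A times B. Its lower left entry is at most 2 \<rho>, because
  entries of elements of \<open>K\<close> have norm at most one.\<close>

lemma disc_disjoint:
  assumes u: "u \<in> K" "u' \<in> K" and far: "2 * \<rho> < norm ((u ** adj2 u') $ 2 $ 1)"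
  shows "disc u \<rho> \<inter> disc u' \<rho> = {}"
proof (rule ccontr)
  assume "disc u \<rho> \<inter> disc u' \<rho> \<noteq> {}"
  then obtain k where k: "k \<in> K" "norm ((k ** adj2 u) $ 2 $ 1) \<le> \<rho>" "norm ((k ** adj2 u') $ 2 $ 1) \<le> \<rho>"
    by (auto simp: disc_def simp del: matrix2_mult_nth)
  define A where "A = k ** adj2 u"
  define B where "B = k ** adj2 u'"
  have AB: "A \<in> K" "B \<in> K" unfolding A_def B_def by (intro K_closed k u)+
  have inK: "g \<in> carrier SL2" if "g \<in> K" for g using K_SL2 that by blast
  have aA: "adj2 A = u ** adj2 k"
    unfolding A_def using inK[OF k(1)] inK[OF u(1)] by (simp add: matrix2_eq_iff adj2_def)
  have "u ** adj2 u' = adj2 A ** B"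
    unfolding aA B_def using inK[OF k(1)] by (metis matrix_mul_assoc adj2_mult(1) matrix_mul_rid)
  then have "(u ** adj2 u') $ 2 $ 1 = A $ 1 $ 1 * B $ 2 $ 1 - A $ 2 $ 1 * B $ 1 $ 1"
    by (simp add: adj2_def)
  then have "norm ((u ** adj2 u') $ 2 $ 1) \<le> norm (A $ 1 $ 1) * norm (B $ 2 $ 1) + norm (A $ 2 $ 1) * norm (B $ 1 $ 1)"
    by (metis norm_mult norm_triangle_ineq4)
  moreover have e: "norm (g $ 1 $ 1) \<le> 1" if g: "g \<in> K" for g
  proof -
    have "norm (adj2 g $ 2 $ 2) \<le> norm (adj2 g $ 2)" by (rule Finite_Cartesian_Product.norm_nth_le)
    then show ?thesis using K_row_norm[OF K_closed(2)[OF g]] by (simp add: adj2_def)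
  qed
  moreover have "norm (A $ 1 $ 1) * norm (B $ 2 $ 1) \<le> 1 * \<rho>"
    using e[OF AB(1)] k(3) unfolding B_def[symmetric] by (intro mult_mono) auto
  moreover have "norm (A $ 2 $ 1) * norm (B $ 1 $ 1) \<le> \<rho> * 1"
    using e[OF AB(2)] k(2) unfolding A_def[symmetric] by (intro mult_mono) (auto intro: order_trans[OF norm_ge_zero])
  ultimately show False using far by linarith
qed

text \<open>The angular factor will be built from angles picked by choice, so its measurability is
  not visible from its formula. It is recovered from the continuous \<open>f\<close> by dividing by
  a nonzero value of the height factor.\<close>

lemma borel_measurable_factor:
  fixes f :: "'a^2^2 \<Rightarrow> real"
  assumes "continuous_on (carrier SL2) f" "\<And>k. k \<in> K \<Longrightarrow> f (a_mat s ** k) = c * \<Psi> k" "c \<noteq> 0"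
  shows "\<Psi> \<in> borel_measurable \<kappa>"
proof -
  have "(\<lambda>k. (\<lambda>g. if g \<in> carrier SL2 then f g else 0) (a_mat s ** k)) \<in> borel_measurable \<kappa>"
    using id_measurable_\<kappa> by (intro measurable_compose[OF _ borel_measurable_on_SL2[OF assms(1)]]) measurable
  from borel_measurable_divide[OF this borel_measurable_const[of c]] show ?thesis
  proof (rule measurable_cong[THEN iffD1, rotated])
    fix k assume "k \<in> space \<kappa>"
    then have k: "k \<in> K" by (simp add: space_\<kappa>)
    have "a_mat s ** k \<in> carrier SL2" by (intro SL2_mult_closed a_mat_in_SL2 subsetD[OF K_SL2] k)
    then show "(if a_mat s ** k \<in> carrier SL2 then f (a_mat s ** k) else 0) / c = \<Psi> k"
      using assms(3) by (simp add: assms(2)[OF k])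
  qed
qed

lemma Q_norm_product:
  fixes f :: "'a^2^2 \<Rightarrow> real"
  assumes f: "\<And>t k. k \<in> K \<Longrightarrow> f (a_mat (t / \<mu>) ** k) = v t * \<Psi> k" and "\<And>t. v t \<ge> 0" "\<And>k. \<Psi> k \<ge> 0"
  shows "Q_norm \<mu> \<kappa> p f = ((LINT t|lborel. v t powr p * exp (- t)) * (LINT k|\<kappa>. \<Psi> k powr p)) powr (1 / p)"
proof -
  have "(LINT k|\<kappa>. norm (f (a_mat (t / \<mu>) ** k)) powr p * exp (- t)) =
      (LINT k|\<kappa>. (v t powr p * exp (- t)) * \<Psi> k powr p)" for t
    using assms by (intro Bochner_Integration.integral_cong) (auto simp: space_\<kappa> powr_mult abs_mult)
  then have "(\<lambda>t. LINT k|\<kappa>. norm (f (a_mat (t / \<mu>) ** k)) powr p * exp (- t)) =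
      (\<lambda>t. (v t powr p * exp (- t)) * (LINT k|\<kappa>. \<Psi> k powr p))"
    by (intro ext) (simp only: Bochner_Integration.integral_mult_right_zero)
  then show ?thesis unfolding Q_norm_def by (simp only: Bochner_Integration.integral_mult_left_zero)
qed

end

context cusp_lattice_compact
begin

text \<open>The average bound integrates over heights without the weight exp(-t) of
  \<open>Q_norm\<close>. On the support t \<le> 0 that weight is at least one, and rescaling by
  \<mu> \<ge> 1 only shrinks the integral, so the L2 norm dominates.\<close>

lemma Theta_norm_sq_small:
  fixes f :: "'a^2^2 \<Rightarrow> real"
  assumes cont: "continuous_on (carrier SL2) f"
    and f: "\<And>q g. q \<in> subgroup_Q \<Longrightarrow> g \<in> carrier SL2 \<Longrightarrow> f (q ** g) = f g"
    and prod: "\<And>t k. k \<in> K \<Longrightarrow> f (a_mat (t / \<mu>) ** k) = v t * \<Psi> k"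
    and \<mu>: "\<mu> \<ge> 1" and v: "continuous_on UNIV v" "\<And>t. v t \<ge> 0" "\<And>t. v t \<noteq> 0 \<Longrightarrow> t \<in> {-T..0}"
    and \<Psi>: "\<And>k. \<Psi> k \<ge> 0" "\<And>k. \<Psi> k \<le> B" "v t0 \<noteq> 0" and T: "T \<ge> 0"
  defines "n \<equiv> 2 * (2 * (5 * exp (T/2))\<^sup>2 * norm h + 1) ^ DIM('a)"
  shows "Theta_norm_sq \<Gamma> \<sigma> f \<le> ennreal (14 * n\<^sup>2 * (Q_norm \<mu> \<kappa> 2 f)\<^sup>2)"
proof -
  interpret prob_space \<kappa> by (rule prob_\<kappa>)
  have prod': "f (a_mat t ** k) = v (\<mu> * t) * \<Psi> k" if "k \<in> K" for t k
    using prod[OF that, of "\<mu> * t"] \<mu> by simp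
  have supp: "- T \<le> t" if "k \<in> K" "f (a_mat t ** k) \<noteq> 0" for t k
  proof -
    have "v (\<mu> * t) \<noteq> 0" using that prod' by auto
    then have "- T \<le> \<mu> * t" using v(3) by force
    then show ?thesis
      using \<mu> T by (metis mult_right_mono_neg mult_1 linorder_le_cases order_trans neg_le_0_iff_le)
  qed
  have \<Psi>m: "\<Psi> \<in> borel_measurable \<kappa>"
    by (rule borel_measurable_factor[where f = f and s = "t0 / \<mu>" and c = "v t0", OF cont prod \<Psi>(3)])
  let ?A = "LINT k|\<kappa>. (\<Psi> k)\<^sup>2"
  let ?I = "LINT t|lborel. (v t)\<^sup>2 * exp (- t)"
  have \<Psi>i: "integrable \<kappa> (\<lambda>k. (\<Psi> k)\<^sup>2)"
    using \<Psi> \<Psi>m by (intro integrable_const_bound[of _ "B\<^sup>2"]) (auto intro!: power_mono)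
  have vi: "integrable lborel (\<lambda>t. (v t)\<^sup>2 * exp (- t))"
  proof -
    have "integrable lborel (\<lambda>t. indicator {-T..0} t *\<^sub>R ((v t)\<^sup>2 * exp (- t)))"
      using continuous_on_subset[OF v(1)] by (intro borel_integrable_compact continuous_intros) auto
    moreover have "(\<lambda>t. indicator {-T..0} t *\<^sub>R ((v t)\<^sup>2 * exp (- t))) = (\<lambda>t. (v t)\<^sup>2 * exp (- t))"
      using v(3) by (auto simp: fun_eq_iff indicator_def)
    ultimately show ?thesis by simp
  qed
  have vm [measurable]: "v \<in> borel_measurable borel" using v(1) by (rule borel_measurable_continuous_onI)
  have "(\<integral>\<^sup>+t. \<integral>\<^sup>+k. ennreal ((f (a_mat t ** k))\<^sup>2) \<partial>\<kappa> \<partial>lborel) =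
      (\<integral>\<^sup>+t. ennreal ((v (\<mu> * t))\<^sup>2) * ennreal ?A \<partial>lborel)"
  proof (rule nn_integral_cong)
    fix t :: real
    have "(\<integral>\<^sup>+k. ennreal ((f (a_mat t ** k))\<^sup>2) \<partial>\<kappa>) = (\<integral>\<^sup>+k. ennreal ((v (\<mu> * t))\<^sup>2) * ennreal ((\<Psi> k)\<^sup>2) \<partial>\<kappa>)"
      by (intro nn_integral_cong) (auto simp: space_\<kappa> prod' power_mult_distrib ennreal_mult)
    also have "\<dots> = ennreal ((v (\<mu> * t))\<^sup>2) * ennreal ?A"
      using \<Psi>m \<Psi>i by (subst nn_integral_cmult) (auto simp: nn_integral_eq_integral)
    finally show "(\<integral>\<^sup>+k. ennreal ((f (a_mat t ** k))\<^sup>2) \<partial>\<kappa>) = ennreal ((v (\<mu> * t))\<^sup>2) * ennreal ?A" .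
  qed
  also have "\<dots> = (\<integral>\<^sup>+t. ennreal ((v (\<mu> * t))\<^sup>2) \<partial>lborel) * ennreal ?A"
    using measurable_compose[OF _ vm, of "\<lambda>t. \<mu> * t" lborel] by (intro nn_integral_multc) measurable
  also have "(\<integral>\<^sup>+t. ennreal ((v (\<mu> * t))\<^sup>2) \<partial>lborel) \<le> ennreal ?I"
  proof -
    have "(\<integral>\<^sup>+t. ennreal ((v (\<mu> * t))\<^sup>2) \<partial>lborel) = 1 * (\<integral>\<^sup>+t. ennreal ((v (\<mu> * t))\<^sup>2) \<partial>lborel)" by simp
    also have "\<dots> \<le> ennreal \<bar>\<mu>\<bar> * (\<integral>\<^sup>+t. ennreal ((v (0 + \<mu> * t))\<^sup>2) \<partial>lborel)"
      using \<mu> by (intro mult_mono) (auto simp: ennreal_1[symmetric] simp del: ennreal_1)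
    also have "\<dots> = (\<integral>\<^sup>+t. ennreal ((v t)\<^sup>2) \<partial>lborel)"
      using vm \<mu> by (subst nn_integral_real_affine[where c = \<mu> and t = 0]) auto
    also have "\<dots> \<le> (\<integral>\<^sup>+t. ennreal ((v t)\<^sup>2 * exp (- t)) \<partial>lborel)"
    proof (intro nn_integral_mono ennreal_leI)
      fix t show "(v t)\<^sup>2 \<le> (v t)\<^sup>2 * exp (- t)"
      proof (cases "v t = 0")
        case False
        then have "1 \<le> exp (- t)" using v(3)[of t] by simp
        then show ?thesis using mult_left_mono[of 1 "exp (- t)" "(v t)\<^sup>2"] by simp
      qed simp
    qed
    also have "\<dots> = ennreal ?I" using vi by (intro nn_integral_eq_integral) auto
    finally show ?thesis .
  qed
  finally have "(\<integral>\<^sup>+t. \<integral>\<^sup>+k. ennreal ((f (a_mat t ** k))\<^sup>2) \<partial>\<kappa> \<partial>lborel) \<le> ennreal ?I * ennreal ?A"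
    by (simp add: mult_right_mono)
  also have "\<dots> = ennreal (?I * ?A)" by (simp add: ennreal_mult)
  also have "?I * ?A = (Q_norm \<mu> \<kappa> 2 f)\<^sup>2"
  proof -
    have sq: "x powr 2 = x\<^sup>2" if "x \<ge> 0" for x :: real using that by (cases "x = 0") auto
    have "Q_norm \<mu> \<kappa> 2 f = (?I * ?A) powr (1 / 2)"
      using Q_norm_product[where f = f and \<mu> = \<mu> and v = v and \<Psi> = \<Psi> and p = 2, OF prod v(2) \<Psi>(1)] by (simp add: sq v \<Psi>)
    moreover have "0 \<le> ?I * ?A" by simp
    ultimately show ?thesis by (simp add: powr_half_sqrt)
  qed
  finally have "(\<integral>\<^sup>+t. \<integral>\<^sup>+k. ennreal ((f (a_mat t ** k))\<^sup>2) \<partial>\<kappa> \<partial>lborel) \<le> ennreal ((Q_norm \<mu> \<kappa> 2 f)\<^sup>2)" .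
  note Q = this
  have "Theta_norm_sq \<Gamma> \<sigma> f \<le>
      ennreal (14 * n\<^sup>2) * (\<integral>\<^sup>+t. \<integral>\<^sup>+k. ennreal ((f (a_mat t ** k))\<^sup>2) \<partial>\<kappa> \<partial>lborel)"
    unfolding n_def by (rule Theta_norm_sq_le_bounded_height[OF cont]; (rule f supp; assumption))
  also have "\<dots> \<le> ennreal (14 * n\<^sup>2) * ennreal ((Q_norm \<mu> \<kappa> 2 f)\<^sup>2)"
    by (rule mult_left_mono[OF Q]) simp
  finally have "Theta_norm_sq \<Gamma> \<sigma> f \<le> ennreal (14 * n\<^sup>2) * ennreal ((Q_norm \<mu> \<kappa> 2 f)\<^sup>2)" .
  then show ?thesis by (simp add: ennreal_mult)
qed

end

context maximal_compact
begin

text \<open>The L1 norm factors into height and angle. The plateau contributes exp(L - 1) - exp 1 to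
  the height integral, and L \<ge> 3 makes the subtracted term at most half of the first; the
  angular factor is at least \<delta> on \<open>D\<close>.\<close>

lemma Q_norm_1_ge:
  fixes f :: "'a^2^2 \<Rightarrow> real"
  assumes cont: "continuous_on (carrier SL2) f"
    and prod: "\<And>t k. k \<in> K \<Longrightarrow> f (a_mat (t / \<mu>) ** k) = v t * \<Psi> k"
    and L: "L \<ge> 3" and v: "cutoff L v" "continuous_on UNIV v"
    and \<Psi>: "\<And>k. \<Psi> k \<ge> 0" "\<And>k. \<Psi> k \<le> B"
    and D: "D \<in> sets \<kappa>" "\<And>k. k \<in> D \<Longrightarrow> \<delta> \<le> \<Psi> k" and \<delta>: "\<delta> \<ge> 0"
  shows "\<delta> * measure \<kappa> D * (exp (L - 1) / 2) \<le> Q_norm \<mu> \<kappa> 1 f"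
proof -
  interpret prob_space \<kappa> by (rule prob_\<kappa>)
  have v0: "\<And>t. v t \<ge> 0" "\<And>t. v t \<noteq> 0 \<Longrightarrow> t \<in> {-L..0}" "\<And>t. t \<in> {-L+1..-1} \<Longrightarrow> v t = 1"
  proof -
    show "\<And>t. v t \<ge> 0" "\<And>t. t \<in> {-L+1..-1} \<Longrightarrow> v t = 1" using v(1) by (auto simp: cutoff_def)
    fix t assume "v t \<noteq> 0"
    then have "t \<in> closure {t. v t \<noteq> 0}" by (intro subsetD[OF closure_subset]) simp
    then show "t \<in> {-L..0}" using v(1) unfolding cutoff_def by blast
  qed
  have "v (- 1) \<noteq> 0" using v0(3)[of "- 1"] L by simp
  from borel_measurable_factor[where f = f and s = "- 1 / \<mu>" and c = "v (- 1)", OF cont prod this]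
  have \<Psi>m: "\<Psi> \<in> borel_measurable \<kappa>" .
  have \<Psi>i: "integrable \<kappa> \<Psi>"
    using \<Psi> \<Psi>m by (intro integrable_const_bound[of _ "B"]) auto
  have vi: "integrable lborel (\<lambda>t. v t * exp (- t))"
  proof -
    have "integrable lborel (\<lambda>t. indicator {-L..0} t *\<^sub>R (v t * exp (- t)))"
      using continuous_on_subset[OF v(2)] by (intro borel_integrable_compact continuous_intros) auto
    moreover have "(\<lambda>t. indicator {-L..0} t *\<^sub>R (v t * exp (- t))) = (\<lambda>t. v t * exp (- t))"
      using v0(2) by (auto simp: fun_eq_iff indicator_def)
    ultimately show ?thesis by simp
  qed
  have A: "\<delta> * measure \<kappa> D \<le> (LINT k|\<kappa>. \<Psi> k)"
  proof -
    have int: "integrable \<kappa> (\<lambda>k. \<delta> * indicator D k)"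
      using D(1) by (intro integrable_mult_right integrable_real_indicator) (auto simp: less_top[symmetric])
    have "\<delta> * measure \<kappa> D = (LINT k|\<kappa>. \<delta> * indicator D k)" using D(1) by simp
    also have "\<dots> \<le> (LINT k|\<kappa>. \<Psi> k)"
      using D(2) \<Psi>(1) by (intro integral_mono[OF int \<Psi>i]) (auto simp: indicator_def)
    finally show ?thesis .
  qed
  have I: "exp (L - 1) / 2 \<le> (LINT t|lborel. v t * exp (- t))"
  proof -
    have ftc: "has_bochner_integral lborel (\<lambda>t. exp (- t) * indicator {-L+1..-1} t)
      (- exp (- (-1)) - (- exp (- (-L+1))))"
      using L by (intro has_bochner_integral_FTC_Icc_nonneg) (auto intro!: derivative_eq_intros)
    then have "exp (L - 1) - exp 1 = (\<integral>t. exp (- t) * indicator {-L+1..-1} t \<partial>lborel)"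
      by (simp add: has_bochner_integral_integral_eq algebra_simps)
    also have "\<dots> \<le> (LINT t|lborel. v t * exp (- t))"
      using v0(1,3) by (intro integral_mono vi integrable.intros[OF ftc]) (auto simp: indicator_def)
    finally have "exp (L - 1) - exp 1 \<le> (LINT t|lborel. v t * exp (- t))" by simp
    moreover have "2 * exp 1 \<le> exp (L - 1)"
    proof -
      have "2 * exp 1 \<le> exp 1 * exp (1 :: real)" using exp_ge_add_one_self[of 1] by (intro mult_right_mono) auto
      also have "\<dots> = exp 2" by (simp flip: exp_add)
      also have "\<dots> \<le> exp (L - 1)" using L by simp
      finally show ?thesis .
    qed
    ultimately show ?thesis by linarith
  qed
  have p1: "x powr 1 = x" if "x \<ge> 0" for x :: real using that by simp
  have "Q_norm \<mu> \<kappa> 1 f = ((LINT t|lborel. v t * exp (- t)) * (LINT k|\<kappa>. \<Psi> k)) powr (1 / 1)"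
    using Q_norm_product[where f = f and \<mu> = \<mu> and v = v and \<Psi> = \<Psi> and p = 1, OF prod v0(1) \<Psi>(1)] by (simp add: p1 v0 \<Psi>)
  also have "\<dots> = (LINT t|lborel. v t * exp (- t)) * (LINT k|\<kappa>. \<Psi> k)"
    using v0 \<Psi> by (simp add: integral_nonneg)
  finally have "Q_norm \<mu> \<kappa> 1 f = (LINT t|lborel. v t * exp (- t)) * (LINT k|\<kappa>. \<Psi> k)" .
  moreover have "\<delta> * measure \<kappa> D * (exp (L - 1) / 2) \<le> (LINT k|\<kappa>. \<Psi> k) * (LINT t|lborel. v t * exp (- t))"
    using A I \<Psi> \<delta> by (intro mult_mono) (auto intro: integral_nonneg)
  ultimately show ?thesis by (simp add: mult.commute)
qed

end

section \<open>From smooth families to the data of the estimates\<close>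

lemma continuous_on_smooth_SL2:
  assumes "smooth_on_SL2 f"
  shows "continuous_on (carrier SL2) f"
  unfolding continuous_on_eq_continuous_within
proof
  fix g :: "'a^2^2" assume g: "g \<in> carrier SL2"
  with assms obtain U F where U: "open U" "g \<in> U" "smooth_on U F" "\<forall>x\<in>U \<inter> carrier SL2. F x = f x"
    unfolding smooth_on_SL2_def by blast
  have "continuous_on U F" using U(3) unfolding smooth_on_def by (metis cont_diff_on.simps(1))
  then have "isCont F g" using U(2) continuous_on_eq_continuous_at[OF U(1)] by blast
  then have F: "(F \<longlongrightarrow> F g) (at g within carrier SL2)"
    by (rule tendsto_within_subset[OF isContD subset_UNIV])
  have eq: "F x = f x" if "x \<in> U" "x \<in> carrier SL2" for x using U(4) that by blast
  have ev: "eventually (\<lambda>x. F x = f x) (at g within carrier SL2)"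
    unfolding eventually_at_topological using U(1,2) eq by blast
  have "(f \<longlongrightarrow> F g) (at g within carrier SL2)" using F tendsto_cong[OF ev] by blast
  then show "continuous (at g within carrier SL2) f"
    unfolding continuous_within eq[OF U(2) g] .
qed

lemma test_functionD:
  fixes f :: "'a::real_normed_vector \<Rightarrow> real"
  assumes "test_function f"
  shows "continuous_on UNIV f" "\<exists>B\<ge>1. (\<forall>x. f x \<noteq> 0 \<longrightarrow> norm x \<le> B) \<and> (\<forall>x. f x \<le> B)"
proof -
  show c: "continuous_on UNIV f"
    using assms unfolding test_function_def smooth_on_def by (metis cont_diff_on.simps(1))
  let ?S = "closure {x. f x \<noteq> 0}"
  have S: "compact ?S" using assms by (simp add: test_function_def)
  obtain B1 where B1: "\<forall>x\<in>?S. norm x \<le> B1" using compact_imp_bounded[OF S] by (auto simp: bounded_iff)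
  have fS: "compact (f ` ?S)" using S c by (intro compact_continuous_image continuous_on_subset[OF c]) auto
  then obtain B2 where B2: "\<forall>y\<in>f ` ?S. norm y \<le> B2" using compact_imp_bounded[OF fS] by (auto simp: bounded_iff)
  have in_S: "x \<in> ?S" if "f x \<noteq> 0" for x by (intro subsetD[OF closure_subset]) (use that in simp)
  show "\<exists>B\<ge>1. (\<forall>x. f x \<noteq> 0 \<longrightarrow> norm x \<le> B) \<and> (\<forall>x. f x \<le> B)"
  proof (intro exI[of _ "max 1 (max B1 B2)"] conjI allI impI)
    fix x assume "f x \<noteq> 0"
    then have "norm x \<le> B1" using B1 in_S by blast
    then show "norm x \<le> max 1 (max B1 B2)" by (simp add: le_max_iff_disj)
  next
    fix x show "f x \<le> max 1 (max B1 B2)"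
    proof (cases "f x = 0")
      case False
      then have "norm (f x) \<le> B2" using B2 in_S by blast
      then have "f x \<le> B2" by simp
      then show ?thesis by (simp add: le_max_iff_disj)
    qed (simp add: le_max_iff_disj)
  qed simp
qed

lemma cutoffD:
  assumes "cutoff L v"
  shows "continuous_on UNIV v" "\<And>t. 0 \<le> v t" "\<And>t. v t \<le> 1" "\<And>t. v t \<noteq> 0 \<Longrightarrow> t \<in> {-L..0}"
proof -
  show "continuous_on UNIV v" using assms by (intro test_functionD(1)) (simp add: cutoff_def)
  show "\<And>t. 0 \<le> v t" "\<And>t. v t \<le> 1" using assms by (auto simp: cutoff_def)
  fix t assume "v t \<noteq> 0"
  then have "t \<in> closure {t. v t \<noteq> 0}" by (intro subsetD[OF closure_subset]) simp
  then show "t \<in> {-L..0}" using assms unfolding cutoff_def by blast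
qed

lemma Q_invariant_eqI:
  assumes f: "\<And>q g. q \<in> subgroup_Q \<Longrightarrow> g \<in> carrier SL2 \<Longrightarrow> f (q ** g) = f g"
    and "g \<in> carrier SL2" "h \<in> carrier SL2" "norm u = 1"
    and "g $ 2 $ 1 = u * h $ 2 $ 1" "g $ 2 $ 2 = u * h $ 2 $ 2"
  shows "f g = f h"
proof -
  obtain q where "q \<in> subgroup_Q" "g = q ** h" by (rule same_bottom_row[OF assms(2-6)])
  then show ?thesis using f assms(3) by simp
qed

lemma (in cusp_lattice) Theta_norm_sq_le_pointwise:
  fixes f :: "'a^2^2 \<Rightarrow> real"
  assumes f: "\<And>q g. q \<in> subgroup_Q \<Longrightarrow> g \<in> carrier SL2 \<Longrightarrow> f (q ** g) = f g"
    and bound: "\<And>g. g \<in> carrier SL2 \<Longrightarrow> (Theta \<Gamma> f g)\<^sup>2 \<le> C"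
  shows "Theta_norm_sq \<Gamma> \<sigma> f \<le> ennreal C"
proof (rule Theta_norm_sq_le_of_averages[OF f, where M = unit_interval and \<eta> = "\<lambda>_. mat 1"])
  fix g :: "'a^2^2" assume "g \<in> carrier SL2"
  then show "(\<integral>\<^sup>+m. ennreal ((Theta \<Gamma> f (g ** mat 1))\<^sup>2) \<partial>unit_interval) \<le> ennreal C"
    using bound by (intro nn_integral_prob_le prob_space_unit_interval ennreal_leI) simp
qed (auto intro: prob_space_unit_interval)

lemma (in cusp_lattice) Theta_norm_sq_zero:
  fixes f :: "'a^2^2 \<Rightarrow> real"
  assumes "\<And>g. g \<in> carrier SL2 \<Longrightarrow> f g = 0"
  shows "Theta_norm_sq \<Gamma> \<sigma> f = 0"
proof -
  have "(Theta \<Gamma> f g)\<^sup>2 \<le> 0" if "g \<in> carrier SL2" for g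
  proof -
    have "Theta \<Gamma> f g = (\<Sum>c\<in>{}. f (rep c ** g))"
    proof (rule Theta_finite_sum)
      fix c assume "c \<in> cosets" "f (rep c ** g) \<noteq> 0"
      then show "c \<in> {}" using assms[OF SL2_mult_closed[OF rep_in_SL2 that]] by simp
    qed auto
    then show ?thesis by simp
  qed
  moreover have "f (q ** g) = f g" if "q \<in> subgroup_Q" "g \<in> carrier SL2" for q g
  proof -
    have "q \<in> carrier SL2" using that(1) by (auto simp: subgroup_Q_def carrier_SL2_iff intro!: right_inverse)
    then show ?thesis using assms that(2) SL2_mult_closed[of q g] by simp
  qed
  ultimately have "Theta_norm_sq \<Gamma> \<sigma> f \<le> ennreal 0" by (intro Theta_norm_sq_le_pointwise)
  then show ?thesis by simp
qed

text \<open>The ratio of the bottom row entries of \<open>X\<close> is that of its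
  \<open>K\<close>-part, so support conditions on the angles of \<open>k\<close> can be read as
  conditions on the row of \<open>X\<close>.\<close>

lemma (in maximal_compact) iwasawa_row:
  assumes X: "X \<in> carrier SL2"
  obtains k c where "k \<in> K" "c \<noteq> 0" "X $ 2 $ 1 = c * k $ 2 $ 1" "X $ 2 $ 2 = c * k $ 2 $ 2"
    "\<And>f :: 'a^2^2 \<Rightarrow> real. (\<And>q g. q \<in> subgroup_Q \<Longrightarrow> g \<in> carrier SL2 \<Longrightarrow> f (q ** g) = f g) \<Longrightarrow>
      f X = f (a_mat (- ln ((norm (X $ 2))\<^sup>2)) ** k)"
proof -
  define t where "t = - ln ((norm (X $ 2))\<^sup>2)"
  obtain q k where qk: "q \<in> subgroup_Q" "k \<in> K" "X = q ** (a_mat t ** k)"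
    using iwasawa[OF X] unfolding t_def by metis
  obtain a x where ax: "q = mat2 a x 0 (inverse a)" "norm a = 1" using qk(1) by (auto simp: subgroup_Q_def)
  define c where "c = inverse a * of_real (exp (- t/2))"
  have "a \<noteq> 0" using ax(2) by auto
  then have c: "c \<noteq> 0" by (simp add: c_def)
  have row: "X $ 2 $ i = c * k $ 2 $ i" for i
    by (simp add: qk(3) ax(1) a_mat_def c_def)
  have "a_mat t ** k \<in> carrier SL2"
    by (intro SL2_mult_closed a_mat_in_SL2 subsetD[OF K_SL2] qk(2))
  then have eq: "f X = f (a_mat t ** k)"
    if "\<And>q g. q \<in> subgroup_Q \<Longrightarrow> g \<in> carrier SL2 \<Longrightarrow> f (q ** g) = f g" for f :: "'a^2^2 \<Rightarrow> real"
    using that[OF qk(1)] qk(3) by simp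
  show thesis by (rule that[OF qk(2) c row row]) (rule eq[unfolded t_def])
qed

section \<open>Elementary inequalities\<close>

lemma cos_ge_half: "\<bar>x\<bar> \<le> 1 \<Longrightarrow> 1 / 2 \<le> cos x" for x :: real
proof -
  assume x: "\<bar>x\<bar> \<le> 1"
  have "cos (pi / 3) \<le> cos \<bar>x\<bar>" using x pi_gt3 by (intro cos_monotone_0_pi_le) auto
  then show ?thesis by (simp add: cos_60)
qed

lemma abs_le_twice_abs_sin: "\<bar>x\<bar> \<le> 1 \<Longrightarrow> \<bar>x\<bar> \<le> 2 * \<bar>sin x\<bar>" for x :: real
proof -
  have pos: "x \<le> 2 * sin x" if "0 \<le> x" "x \<le> 1" for x :: real
  proof -
    have "2 * sin 0 - 0 \<le> 2 * sin x - x"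
    proof (rule DERIV_nonneg_imp_nondecreasing[OF that(1)])
      fix y assume y: "0 \<le> y" "y \<le> x"
      have "((\<lambda>x. 2 * sin x - x) has_real_derivative 2 * cos y - 1) (at y)"
        by (auto intro!: derivative_eq_intros)
      moreover have "0 \<le> 2 * cos y - 1" using cos_ge_half[of y] y that by auto
      ultimately show "\<exists>d. ((\<lambda>x. 2 * sin x - x) has_real_derivative d) (at y) \<and> 0 \<le> d" by blast
    qed
    then show ?thesis by simp
  qed
  assume "\<bar>x\<bar> \<le> 1"
  then show ?thesis using pos[of "\<bar>x\<bar>"] by (auto simp: abs_if split: if_splits)
qed

lemma abs_le_of_sin: "\<bar>sin x\<bar> \<le> 1 / 2 \<Longrightarrow> x \<in> {-pi/2..pi/2} \<Longrightarrow> \<bar>x\<bar> \<le> 2 / 3" for x :: real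
proof (rule ccontr)
  assume s: "\<bar>sin x\<bar> \<le> 1 / 2" and x: "x \<in> {-pi/2..pi/2}" and "\<not> \<bar>x\<bar> \<le> 2 / 3"
  then have "pi / 6 < \<bar>x\<bar>" using pi_less_4 by linarith
  moreover have "\<bar>x\<bar> \<le> pi / 2" using x by auto
  ultimately have "sin (pi / 6) < sin \<bar>x\<bar>" using pi_gt_zero by (intro sin_monotone_2pi) linarith+
  moreover have "sin \<bar>x\<bar> \<le> \<bar>sin x\<bar>" by (simp add: abs_if)
  ultimately show False using s by (simp add: sin_30)
qed

text \<open>The sum of the squares minus the modulus of their difference is twice the smaller
  square, which is at most twice the product.\<close>

lemma min_square_le: "a\<^sup>2 + b\<^sup>2 \<le> \<bar>a\<^sup>2 - b\<^sup>2\<bar> + 2 * (a * b)" if "a \<ge> 0" "b \<ge> 0" for a b :: real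
proof (cases "a \<le> b")
  case True
  then have "a * a \<le> b * b" "a * a \<le> a * b" using that by (intro mult_mono mult_left_mono; simp)+
  then show ?thesis unfolding power2_eq_square by linarith
next
  case False
  then have "b * b \<le> a * a" "b * b \<le> a * b" using that by (intro mult_mono mult_right_mono; simp)+
  then show ?thesis unfolding power2_eq_square by linarith
qed

section \<open>The real case\<close>

lemma SO2_iff: "A \<in> SO2 \<longleftrightarrow> A \<in> carrier SL2 \<and> A $ 1 $ 1 = A $ 2 $ 2 \<and> A $ 1 $ 2 = - A $ 2 $ 1"
proof
  assume A: "A \<in> SO2"
  then have S: "A \<in> carrier SL2" and o: "transpose A ** A = mat 1"
    by (auto simp: SO2_def SL2_def orthogonal_matrix)
  have "transpose A = adj2 A" by (rule SL2_cancel_right[OF S]) (simp only: o adj2_mult(1)[OF S])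
  then have "transpose A $ 1 $ 1 = adj2 A $ 1 $ 1" "transpose A $ 2 $ 1 = adj2 A $ 2 $ 1" by simp_all
  then have "A $ 1 $ 1 = A $ 2 $ 2" "A $ 1 $ 2 = - A $ 2 $ 1" by (simp_all only: transpose_def adj2_def mat2_nth vec_lambda_beta)
  then show "A \<in> carrier SL2 \<and> A $ 1 $ 1 = A $ 2 $ 2 \<and> A $ 1 $ 2 = - A $ 2 $ 1" using S by blast
next
  assume A: "A \<in> carrier SL2 \<and> A $ 1 $ 1 = A $ 2 $ 2 \<and> A $ 1 $ 2 = - A $ 2 $ 1"
  then have "transpose A = adj2 A" by (simp add: matrix2_eq_iff adj2_def transpose_def)
  then have "transpose A ** A = mat 1" using A by (simp only: adj2_mult(1))
  then show "A \<in> SO2" using A by (simp only: SO2_def orthogonal_matrix mem_Collect_eq) (simp add: SL2_def)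
qed

lemma maximal_compact_SO2:
  assumes "haar_probability SO2 \<kappa>"
  shows "maximal_compact SO2 \<kappa>"
proof
  show "SO2 \<subseteq> carrier SL2" by (auto simp: SO2_iff)
  show "k ** l \<in> SO2" if "k \<in> SO2" "l \<in> SO2" for k l
    using that SL2_mult_closed[of k l] by (simp add: SO2_iff algebra_simps)
  show "adj2 k \<in> SO2" if "k \<in> SO2" for k
    using that adj2_closed[of k] by (simp add: SO2_iff) (simp add: adj2_def)
  show "norm ((x ** k) $ 2) = norm (x $ 2)" if "k \<in> SO2" for x k :: "real^2^2"
  proof -
    have k: "k $ 1 $ 1 = k $ 2 $ 2" "k $ 1 $ 2 = - k $ 2 $ 1" "(k $ 2 $ 2)\<^sup>2 + (k $ 2 $ 1)\<^sup>2 = 1"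
      using that by (auto simp: SO2_iff carrier_SL2_iff power2_eq_square)
    have "(x $ 2 $ 1 * k $ 1 $ 1 + x $ 2 $ 2 * k $ 2 $ 1)\<^sup>2 + (x $ 2 $ 1 * k $ 1 $ 2 + x $ 2 $ 2 * k $ 2 $ 2)\<^sup>2 =
      ((x $ 2 $ 1)\<^sup>2 + (x $ 2 $ 2)\<^sup>2) * ((k $ 2 $ 2)\<^sup>2 + (k $ 2 $ 1)\<^sup>2)"
      by (simp add: k(1,2) power2_eq_square algebra_simps)
    then show ?thesis by (simp add: norm_row2 k(3))
  qed
  show "\<exists>k\<in>SO2. k $ 2 = w" if "norm w = 1" for w :: "real^2"
  proof (intro bexI[of _ "mat2 (w $ 2) (- w $ 1) (w $ 1) (w $ 2)"])
    have "(w $ 1)\<^sup>2 + (w $ 2)\<^sup>2 = 1" using that by (simp add: norm_row2)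
    then show "mat2 (w $ 2) (- w $ 1) (w $ 1) (w $ 2) \<in> SO2"
      by (simp add: SO2_iff carrier_SL2_iff power2_eq_square)
  qed (simp add: vec_eq_iff forall_2)
qed (rule assms)

lemma k_real_in_SO2: "k_real \<theta> \<in> SO2"
  by (simp add: SO2_iff carrier_SL2_iff k_real_def flip: power2_eq_square)

text \<open>The angle is determined only modulo pi, which is why its range has length pi;
  \<open>s\<close> records the lost sign.\<close>

lemma SO2_angle:
  assumes "k \<in> SO2"
  shows "\<exists>\<theta>\<in>{-pi/2<..pi/2}. \<exists>s. \<bar>s\<bar> = 1 \<and> k $ 2 $ 1 = s * - sin \<theta> \<and> k $ 2 $ 2 = s * cos \<theta>"
proof -
  have n: "(k $ 2 $ 1)\<^sup>2 + (k $ 2 $ 2)\<^sup>2 = 1"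
    using assms by (auto simp: SO2_iff carrier_SL2_iff power2_eq_square)
  have main: "\<exists>\<theta>\<in>{-pi/2<..pi/2}. \<exists>s. \<bar>s\<bar> = 1 \<and> x = s * - sin \<theta> \<and> y = s * cos \<theta>"
    if xy: "x\<^sup>2 + y\<^sup>2 = 1" "0 \<le> y" for x y :: real
  proof -
    obtain t where t: "0 \<le> t" "t \<le> pi" "x = cos t" "y = sin t"
      using sincos_total_pi[OF xy(2,1)] by blast
    \<comment> \<open>t = 0 would lead to the excluded endpoint -pi/2; pi/2 with the opposite sign
      gives the same row.\<close>
    show ?thesis
    proof (cases "t = 0")
      case True
      then show ?thesis using t by (intro bexI[of _ "pi/2"] exI[of _ "-1"]) auto
    next
      case False
      have "sin (t - pi / 2) = - cos t" "cos (t - pi / 2) = sin t" by (simp_all add: sin_diff cos_diff)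
      then show ?thesis using t False by (intro bexI[of _ "t - pi/2"] exI[of _ 1]) auto
    qed
  qed
  show ?thesis
  proof (cases "0 \<le> k $ 2 $ 2")
    case True
    then show ?thesis using main[OF n] by simp
  next
    case False
    then obtain \<theta> s where "\<theta> \<in> {-pi/2<..pi/2}" "\<bar>s\<bar> = 1" "- k $ 2 $ 1 = s * - sin \<theta>" "- k $ 2 $ 2 = s * cos \<theta>"
      using main[of "- k $ 2 $ 1" "- k $ 2 $ 2"] n by auto
    then show ?thesis by (intro bexI[of _ \<theta>] exI[of _ "- s"]) auto
  qed
qed

definition angle_SO2 :: "real^2^2 \<Rightarrow> real" where
  "angle_SO2 k = (SOME \<theta>. \<theta> \<in> {-pi/2<..pi/2} \<and> (\<exists>s. \<bar>s\<bar> = 1 \<and> k $ 2 $ 1 = s * - sin \<theta> \<and> k $ 2 $ 2 = s * cos \<theta>))"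

lemma angle_SO2:
  assumes "k \<in> SO2"
  shows "angle_SO2 k \<in> {-pi/2<..pi/2}"
    "\<exists>s. \<bar>s\<bar> = 1 \<and> k $ 2 $ 1 = s * - sin (angle_SO2 k) \<and> k $ 2 $ 2 = s * cos (angle_SO2 k)"
proof -
  have "\<exists>\<theta>. \<theta> \<in> {-pi/2<..pi/2} \<and> (\<exists>s. \<bar>s\<bar> = 1 \<and> k $ 2 $ 1 = s * - sin \<theta> \<and> k $ 2 $ 2 = s * cos \<theta>)"
    using SO2_angle[OF assms] by blast
  from someI_ex[OF this, folded angle_SO2_def]
  show "angle_SO2 k \<in> {-pi/2<..pi/2}"
    "\<exists>s. \<bar>s\<bar> = 1 \<and> k $ 2 $ 1 = s * - sin (angle_SO2 k) \<and> k $ 2 $ 2 = s * cos (angle_SO2 k)" by blast+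
qed

text \<open>The sign ambiguity of the angle is a left factor in Q, to which \<open>f\<close> is
  blind.\<close>

lemma f_lambda_real_on_SO2:
  fixes f :: "real^2^2 \<Rightarrow> real"
  assumes f: "\<And>q g. q \<in> subgroup_Q \<Longrightarrow> g \<in> carrier SL2 \<Longrightarrow> f (q ** g) = f g"
    and formula: "\<And>x t \<theta>. \<theta> \<in> {-pi/2<..pi/2} \<Longrightarrow> f (n_mat x ** a_mat t ** k_real \<theta>) = v t * \<psi> (lam * \<theta>)"
    and k: "k \<in> SO2"
  shows "f (a_mat t ** k) = v t * \<psi> (lam * angle_SO2 k)"
proof -
  let ?\<theta> = "angle_SO2 k"
  obtain s where s: "\<bar>s\<bar> = 1" "k $ 2 $ 1 = s * - sin ?\<theta>" "k $ 2 $ 2 = s * cos ?\<theta>"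
    using angle_SO2(2)[OF k] by blast
  have "f (a_mat t ** k) = f (n_mat 0 ** a_mat t ** k_real ?\<theta>)"
  proof (rule Q_invariant_eqI[OF f, where u = s])
    have "k \<in> carrier SL2" "k_real ?\<theta> \<in> carrier SL2" using k k_real_in_SO2 by (auto simp: SO2_iff)
    note kS = this
    show "a_mat t ** k \<in> carrier SL2" by (intro SL2_mult_closed a_mat_in_SL2 kS)
    show "n_mat 0 ** a_mat t ** k_real ?\<theta> \<in> carrier SL2"
      by (intro SL2_mult_closed a_mat_in_SL2 n_mat_in_SL2 kS)
    show "norm s = 1" using s(1) by simp
    show "(a_mat t ** k) $ 2 $ 1 = s * (n_mat 0 ** a_mat t ** k_real ?\<theta>) $ 2 $ 1"
      "(a_mat t ** k) $ 2 $ 2 = s * (n_mat 0 ** a_mat t ** k_real ?\<theta>) $ 2 $ 2"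
      by (simp_all add: a_mat_def n_mat_def k_real_def s(2,3))
  qed
  then show ?thesis using formula[OF angle_SO2(1)[OF k]] by simp
qed

lemma hopf_real: "(norm a)\<^sup>2 + (norm b)\<^sup>2 \<le> \<bar>(norm a)\<^sup>2 - (norm b)\<^sup>2\<bar> + 2 * \<bar>b \<bullet> a\<bar> + 2 * \<bar>b \<bullet> (a * 1)\<bar>"
  for a b :: real
proof -
  have "0 \<le> \<bar>b * a\<bar>" "a\<^sup>2 + b\<^sup>2 \<le> \<bar>a\<^sup>2 - b\<^sup>2\<bar> + 2 * \<bar>b * a\<bar>"
    using min_square_le[of "\<bar>a\<bar>" "\<bar>b\<bar>"] by (simp_all add: abs_mult mult.commute)
  then show ?thesis unfolding inner_real_def real_norm_def power2_abs mult_1_right by linarith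
qed

text \<open>Rows in the support satisfy |d| \<le> R with R^2 = lam E, and |c/d| \<le> 2 B/lam. Their
  ratios are separated by 1/(R^2 |h|), so at most 4 B |h| E + 1 rows contribute: the powers of lam
  cancel.\<close>

lemma Theta_norm_sq_le_large_real:
  fixes f :: "real^2^2 \<Rightarrow> real"
  assumes "cusp_lattice \<Gamma> \<sigma> h" and K: "maximal_compact SO2 \<kappa>"
    and f: "\<And>q g. q \<in> subgroup_Q \<Longrightarrow> g \<in> carrier SL2 \<Longrightarrow> f (q ** g) = f g"
    and fk: "\<And>t k. k \<in> SO2 \<Longrightarrow> f (a_mat t ** k) = v t * \<psi> (lam * angle_SO2 k)"
    and v: "\<And>t. v t \<noteq> 0 \<Longrightarrow> t \<in> {- L..0}" "\<And>t. 0 \<le> v t" "\<And>t. v t \<le> 1"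
    and \<psi>: "\<And>x. 0 \<le> \<psi> x" "\<And>x. \<psi> x \<le> 1" "\<And>x. \<psi> x \<noteq> 0 \<Longrightarrow> \<bar>x\<bar> \<le> B"
    and B: "B \<ge> 1" "lam \<ge> B" and E: "exp L = lam * E" "E \<ge> 1"
  shows "Theta_norm_sq \<Gamma> \<sigma> f \<le> ennreal (((4 * B * norm h + 1) * E)\<^sup>2)"
proof -
  interpret cusp_lattice \<Gamma> \<sigma> h by fact
  interpret maximal_compact SO2 \<kappa> by fact
  define R where "R = exp (L / 2)"
  define T where "T = 2 * B / lam"
  have lam: "lam > 0" using B by linarith
  have RT: "R > 0" "T \<ge> 0" using lam B by (simp_all add: R_def T_def)
  have R2: "R\<^sup>2 = lam * E" by (simp add: R_def E(1)[symmetric] flip: exp_double)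
  have local: "X $ 2 $ 2 \<noteq> 0 \<and> norm (X $ 2 $ 2) \<le> R \<and> dist 0 (X $ 2 $ 1 / X $ 2 $ 2) \<le> T \<and> 0 \<le> f X \<and> f X \<le> 1"
    if X: "X \<in> carrier SL2" "f X \<noteq> 0" for X
  proof -
    obtain k c where kc: "k \<in> SO2" "c \<noteq> 0" "X $ 2 $ 1 = c * k $ 2 $ 1" "X $ 2 $ 2 = c * k $ 2 $ 2"
      "f X = f (a_mat (- ln ((norm (X $ 2))\<^sup>2)) ** k)"
      using iwasawa_row[OF X(1)] f by metis
    define t where "t = - ln ((norm (X $ 2))\<^sup>2)"
    define \<theta> where "\<theta> = angle_SO2 k"
    have fX: "f X = v t * \<psi> (lam * \<theta>)" using kc(5) fk[OF kc(1)] by (simp add: t_def \<theta>_def)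
    then have nz: "v t \<noteq> 0" "\<psi> (lam * \<theta>) \<noteq> 0" using X(2) by auto
    have "lam * \<bar>\<theta>\<bar> \<le> B" using \<psi>(3)[OF nz(2)] lam by (simp add: abs_mult)
    then have th: "\<bar>\<theta>\<bar> \<le> B / lam" using lam by (simp add: field_simps)
    also have "\<dots> \<le> 1" using B lam by simp
    finally have c2: "1 / 2 \<le> cos \<theta>" by (rule cos_ge_half)
    obtain s where s: "\<bar>s\<bar> = 1" "k $ 2 $ 1 = s * - sin \<theta>" "k $ 2 $ 2 = s * cos \<theta>"
      using angle_SO2(2)[OF kc(1)] unfolding \<theta>_def by blast
    have s0: "s \<noteq> 0" using s(1) by auto
    have a: "X $ 2 $ 2 \<noteq> 0" using kc(2) s0 c2 by (simp add: kc(4) s(3))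
    have "X $ 2 $ 1 / X $ 2 $ 2 = - (sin \<theta> / cos \<theta>)" using kc(2) s0 by (simp add: kc(3,4) s(2,3))
    then have "dist 0 (X $ 2 $ 1 / X $ 2 $ 2) = \<bar>sin \<theta>\<bar> / cos \<theta>" using c2 by (simp add: abs_divide)
    also have "\<dots> \<le> \<bar>\<theta>\<bar> / (1 / 2)"
      using c2 abs_sin_x_le_abs_x[of \<theta>] by (intro frac_le) auto
    also have "\<dots> \<le> T" using th by (simp add: T_def)
    finally have d: "dist 0 (X $ 2 $ 1 / X $ 2 $ 2) \<le> T" .
    have X2: "0 < norm (X $ 2)" using bottom_row_nonzero[OF X(1)] by simp
    have "norm (X $ 2 $ 2) \<le> norm (X $ 2)" by (rule Finite_Cartesian_Product.norm_nth_le)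
    also have "\<dots> = exp (- t / 2)" unfolding t_def using exp_half_ln_square[OF X2] by simp
    also have "\<dots> \<le> R" using v(1)[OF nz(1)] by (simp add: R_def)
    finally have "norm (X $ 2 $ 2) \<le> R" .
    moreover have "0 \<le> f X" "f X \<le> 1" unfolding fX using v \<psi> by (auto intro: mult_le_one)
    ultimately show ?thesis using a d by blast
  qed
  show ?thesis
  proof (rule Theta_norm_sq_le_pointwise[OF f])
    fix g :: "real^2^2" assume g: "g \<in> carrier SL2"
    define A where "A = {c \<in> cosets. (rep c ** g) $ 2 $ 2 \<noteq> 0 \<and> norm ((rep c ** g) $ 2 $ 2) \<le> R \<and>
      dist 0 ((rep c ** g) $ 2 $ 1 / (rep c ** g) $ 2 $ 2) \<le> T}"
    have A: "finite A" "real (card A) \<le> 2 * T * R\<^sup>2 * norm h + 1"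
      using count_chart(1,2)[OF g RT, of 0] unfolding A_def by simp_all
    have rg: "rep c ** g \<in> carrier SL2" if "c \<in> cosets" for c
      by (rule SL2_mult_closed[OF rep_in_SL2[OF that] g])
    have f01: "0 \<le> f (rep c ** g)" "f (rep c ** g) \<le> 1" if "c \<in> cosets" for c
      using local[OF rg[OF that]] by (cases "f (rep c ** g) = 0"; simp)+
    have Th: "Theta \<Gamma> f g = (\<Sum>c\<in>A. f (rep c ** g))"
    proof (rule Theta_finite_sum[OF A(1)])
      show "A \<subseteq> cosets" unfolding A_def by blast
      fix c assume "c \<in> cosets" "f (rep c ** g) \<noteq> 0"
      then show "c \<in> A" unfolding A_def using local[OF rg] by blast
    qed
    have "Theta \<Gamma> f g \<le> (\<Sum>c\<in>A. 1)"
      unfolding Th using f01 by (intro sum_mono) (auto simp: A_def)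
    also have "\<dots> = real (card A)" by simp
    also have "\<dots> \<le> 4 * B * norm h * E + 1" using A(2) lam unfolding R2 T_def by (simp add: mult_ac)
    also have "\<dots> \<le> (4 * B * norm h + 1) * E" using E(2) by (simp add: distrib_right)
    finally have "Theta \<Gamma> f g \<le> (4 * B * norm h + 1) * E" .
    moreover have "0 \<le> Theta \<Gamma> f g" unfolding Th using f01 by (intro sum_nonneg) (auto simp: A_def)
    ultimately show "(Theta \<Gamma> f g)\<^sup>2 \<le> ((4 * B * norm h + 1) * E)\<^sup>2" by (intro power_mono)
  qed
qed

text \<open>The set where the angular factor is at least \<delta> contains the disc of radius
  \<eta>/(2 lam) about \<open>k_real (x0 / lam)\<close>, of Haar measure at least \<eta>/(12 lam).
  The height integral is at least exp(L - 1)/2 = lam E/(2 exp 1), whence the 24.\<close>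

lemma Q_norm_1_ge_large_real:
  fixes f :: "real^2^2 \<Rightarrow> real"
  assumes K: "maximal_compact SO2 \<kappa>" and cont: "continuous_on (carrier SL2) f"
    and fk: "\<And>t k. k \<in> SO2 \<Longrightarrow> f (a_mat t ** k) = v t * \<psi> (lam * angle_SO2 k)"
    and v: "cutoff L v" and L: "L \<ge> 3"
    and \<psi>: "\<And>x. 0 \<le> \<psi> x" "\<And>x. \<psi> x \<le> 1"
    and \<eta>: "0 < \<eta>" "\<eta> \<le> 1" "\<And>x. \<bar>x - x0\<bar> \<le> \<eta> \<Longrightarrow> \<delta> \<le> \<psi> x" and \<delta>: "\<delta> \<ge> 0"
    and x0: "\<bar>x0\<bar> \<le> B" and lam: "lam \<ge> 8 * B" "B \<ge> 1" and E: "exp L = lam * E"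
  shows "\<delta> * \<eta> / (24 * exp 1) * E \<le> Q_norm 1 \<kappa> 1 f"
proof -
  interpret maximal_compact SO2 \<kappa> by fact
  define u where "u = k_real (x0 / lam)"
  define \<rho> where "\<rho> = \<eta> / (2 * lam)"
  have l8: "lam \<ge> 8" using lam by linarith
  have u: "u \<in> SO2" by (simp add: u_def k_real_in_SO2)
  have \<rho>: "0 < \<rho>" "\<rho> \<le> 1 / 16"
    using \<eta>(1,2) l8 by (auto simp: \<rho>_def field_simps)
  have x0': "\<bar>x0 / lam\<bar> \<le> 1 / 8" using x0 lam by (simp add: field_simps abs_divide)
  have D: "\<delta> \<le> \<psi> (lam * angle_SO2 k)" if k: "k \<in> disc u \<rho>" for k
  proof -
    define \<theta> where "\<theta> = angle_SO2 k"
    define \<theta>0 where "\<theta>0 = x0 / lam"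
    have kS: "k \<in> SO2" and kr: "norm ((k ** adj2 u) $ 2 $ 1) \<le> \<rho>" using k unfolding disc_def by blast+
    obtain s where s: "\<bar>s\<bar> = 1" "k $ 2 $ 1 = s * - sin \<theta>" "k $ 2 $ 2 = s * cos \<theta>"
      using angle_SO2(2)[OF kS] unfolding \<theta>_def by blast
    have "(k ** adj2 u) $ 2 $ 1 = - s * sin (\<theta> - \<theta>0)"
      by (simp add: s(2,3) adj2_def u_def k_real_def sin_diff algebra_simps flip: \<theta>0_def)
    then have sd: "\<bar>sin (\<theta> - \<theta>0)\<bar> \<le> \<rho>" using kr s(1) by (simp add: abs_mult del: matrix2_mult_nth)
    have t0: "\<bar>\<theta>0\<bar> \<le> 1 / 8" using x0' by (simp add: \<theta>0_def)
    have c0: "1 / 2 \<le> cos \<theta>0" using t0 by (intro cos_ge_half) linarith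
    \<comment> \<open>An angle is bounded by twice its sine only for small arguments, so \<theta>
      itself is first confined to |\<theta>| \<le> 2/3.\<close>
    have "\<bar>sin \<theta>\<bar> * (1 / 2) \<le> \<bar>sin \<theta>\<bar> * cos \<theta>0" using c0 by (intro mult_left_mono) auto
    also have "\<dots> = \<bar>sin \<theta> * cos \<theta>0\<bar>" using c0 by (simp add: abs_mult)
    also have "sin \<theta> * cos \<theta>0 = sin (\<theta> - \<theta>0) + cos \<theta> * sin \<theta>0" by (simp add: sin_diff)
    also have "\<bar>sin (\<theta> - \<theta>0) + cos \<theta> * sin \<theta>0\<bar> \<le> \<bar>sin (\<theta> - \<theta>0)\<bar> + \<bar>cos \<theta> * sin \<theta>0\<bar>" by (rule abs_triangle_ineq)
    also have "\<bar>cos \<theta> * sin \<theta>0\<bar> \<le> 1 * \<bar>\<theta>0\<bar>"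
      unfolding abs_mult using abs_sin_x_le_abs_x[of \<theta>0] by (intro mult_mono) auto
    finally have "\<bar>sin \<theta>\<bar> \<le> 1 / 2" using sd \<rho>(2) t0 by linarith
    moreover have "\<theta> \<in> {-pi/2..pi/2}" using angle_SO2(1)[OF kS] by (auto simp: \<theta>_def)
    ultimately have "\<bar>\<theta>\<bar> \<le> 2 / 3" by (rule abs_le_of_sin)
    then have "\<bar>\<theta> - \<theta>0\<bar> \<le> 1" using t0 by linarith
    then have "\<bar>\<theta> - \<theta>0\<bar> \<le> 2 * \<rho>" using abs_le_twice_abs_sin[of "\<theta> - \<theta>0"] sd by linarith
    then have "lam * \<bar>\<theta> - \<theta>0\<bar> \<le> lam * (2 * \<rho>)" using l8 by (intro mult_left_mono) auto
    also have "lam * (2 * \<rho>) = \<eta>" using l8 by (simp add: \<rho>_def)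
    also have "lam * \<bar>\<theta> - \<theta>0\<bar> = \<bar>lam * (\<theta> - \<theta>0)\<bar>" using l8 by (simp add: abs_mult)
    also have "lam * (\<theta> - \<theta>0) = lam * \<theta> - x0" using l8 by (simp add: \<theta>0_def right_diff_distrib)
    finally show ?thesis using \<eta>(3) by (simp add: \<theta>_def)
  qed
  have "\<delta> * measure \<kappa> (disc u \<rho>) * (exp (L - 1) / 2) \<le> Q_norm 1 \<kappa> 1 f"
    by (rule Q_norm_1_ge[where \<Psi> = "\<lambda>k. \<psi> (lam * angle_SO2 k)" and B = 1, OF cont _ L v cutoffD(1)[OF v] \<psi> disc_sets D \<delta>])
      (simp add: fk)
  moreover have "\<delta> * (\<rho> / 3 / 2) * (exp (L - 1) / 2) \<le> \<delta> * measure \<kappa> (disc u \<rho>) * (exp (L - 1) / 2)"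
    using measure_disc_ge[of \<rho> u] \<rho> u \<delta> by (intro mult_right_mono mult_left_mono) auto
  moreover have "exp (L - 1) = lam * E / exp 1" by (simp add: exp_diff E)
  then have "\<delta> * (\<rho> / 3 / 2) * (exp (L - 1) / 2) = \<delta> * \<eta> / (24 * exp 1) * E"
    using l8 by (simp add: \<rho>_def field_simps)
  ultimately show ?thesis by linarith
qed

section \<open>Combining small and large parameters\<close>

lemma cusp_latticeI:
  assumes "SL2_lattice \<Gamma>" "cusp_at_infinity \<Gamma>" "invariant_probability \<Gamma> \<sigma>"
  obtains h where "cusp_lattice \<Gamma> \<sigma> h"
proof -
  obtain h where "h \<noteq> 0" "n_mat h \<in> \<Gamma>" by (rule cusp_translation[OF assms(2)])
  then have "cusp_lattice \<Gamma> \<sigma> h"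
    using assms(1,3) by (intro cusp_lattice.intro) (auto simp: SL2_lattice_def)
  then show thesis by (rule that)
qed

lemma positive_near:
  fixes \<psi> :: "'a::metric_space \<Rightarrow> real"
  assumes "continuous_on UNIV \<psi>" "\<psi> x0 > 0"
  obtains \<eta> where "0 < \<eta>" "\<eta> \<le> 1" "\<And>x. dist x x0 \<le> \<eta> \<Longrightarrow> \<psi> x0 / 2 \<le> \<psi> x"
proof -
  have "\<psi> x0 / 2 > 0" using assms(2) by simp
  then obtain d where d: "d > 0" "\<And>x. dist x x0 < d \<Longrightarrow> dist (\<psi> x) (\<psi> x0) < \<psi> x0 / 2"
    using assms(1) unfolding continuous_on_iff by blast
  show thesis
  proof (rule that[of "min 1 (d / 2)"])
    fix x assume "dist x x0 \<le> min 1 (d / 2)"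
    then have "dist x x0 < d" using d(1) by simp
    from d(2)[OF this] have "\<bar>\<psi> x - \<psi> x0\<bar> < \<psi> x0 / 2" by (simp add: dist_real_def)
    then show "\<psi> x0 / 2 \<le> \<psi> x" by linarith
  qed (use d(1) in auto)
qed

lemma exp_exponent_split: "lam > 0 \<Longrightarrow> exp ((n + \<epsilon>) * ln lam) = lam powr n * exp (\<epsilon> * ln lam)" for lam :: real
  by (simp add: powr_def distrib_right exp_add)

lemma f_lambda_zero:
  assumes "maximal_compact K \<kappa>"
    and f: "\<And>q g. q \<in> subgroup_Q \<Longrightarrow> g \<in> carrier SL2 \<Longrightarrow> f (q ** g) = (f g :: real)"
    and z: "\<And>t k. k \<in> K \<Longrightarrow> f (a_mat t ** k) = 0" and g: "g \<in> carrier SL2"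
  shows "f g = 0"
proof -
  interpret maximal_compact K \<kappa> by fact
  obtain k c where "k \<in> K" "f g = f (a_mat (- ln ((norm (g $ 2))\<^sup>2)) ** k)"
    using iwasawa_row[OF g] f by metis
  then show ?thesis using z by simp
qed

lemma ennreal_le_combined_squares:
  fixes Q1 Q2 C1 C2 :: real
  assumes "C1 \<ge> 0" "C2 \<ge> 0" "x \<le> ennreal (C1 * Q2\<^sup>2) \<or> x \<le> ennreal (C2 * Q1\<^sup>2)"
  shows "x \<le> ennreal ((C1 + C2) * (Q2\<^sup>2 + Q1\<^sup>2))"
proof -
  have "0 \<le> C1 * Q2\<^sup>2" "0 \<le> C2 * Q1\<^sup>2" "0 \<le> C1 * Q1\<^sup>2" "0 \<le> C2 * Q2\<^sup>2"
    using assms(1,2) by simp_all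
  then have "C1 * Q2\<^sup>2 \<le> (C1 + C2) * (Q2\<^sup>2 + Q1\<^sup>2)" "C2 * Q1\<^sup>2 \<le> (C1 + C2) * (Q2\<^sup>2 + Q1\<^sup>2)"
    by (simp_all add: algebra_simps)
  then show ?thesis using assms(3) by (meson ennreal_leI order_trans)
qed

text \<open>Below the threshold the range of heights is at most \<open>d * ln lam\<^sub>0\<close>,
  so one constant serves in \<open>Theta_norm_sq_small\<close>; above it the estimate by the L1 norm
  is assumed. The sum of the two constants covers both.\<close>

lemma (in cusp_lattice_compact) theta_bound_if_large:
  fixes \<Psi> :: "real \<Rightarrow> 'a^2^2 \<Rightarrow> real" and lam\<^sub>0 :: real
  assumes \<Psi>: "\<And>lam k. 0 \<le> \<Psi> lam k" "\<And>lam k. \<Psi> lam k \<le> B" and \<mu>: "\<mu> \<ge> 1" and d: "d \<ge> 0" and lam\<^sub>0: "lam\<^sub>0 > 1"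
    and C2: "C2 \<ge> 0" and large: "\<And>lam v f. lam \<ge> lam\<^sub>0 \<Longrightarrow> continuous_on (carrier SL2) f \<Longrightarrow>
      (\<And>q g. q \<in> subgroup_Q \<Longrightarrow> g \<in> carrier SL2 \<Longrightarrow> f (q ** g) = f g) \<Longrightarrow>
      (\<And>t k. k \<in> K \<Longrightarrow> f (a_mat (t / \<mu>) ** k) = v t * \<Psi> lam k) \<Longrightarrow>
      cutoff (d * ln lam) v \<Longrightarrow> Theta_norm_sq \<Gamma> \<sigma> f \<le> ennreal (C2 * (Q_norm \<mu> \<kappa> 1 f)\<^sup>2)"
  shows "\<exists>C. \<forall>lam\<ge>1. \<forall>f\<in>Cc_smooth_Q. (\<exists>v. cutoff (d * ln lam) v \<and>
      (\<forall>t. \<forall>k\<in>K. f (a_mat (t / \<mu>) ** k) = v t * \<Psi> lam k)) \<longrightarrow>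
    Theta_norm_sq \<Gamma> \<sigma> f \<le> ennreal (C * ((Q_norm \<mu> \<kappa> 2 f)\<^sup>2 + (Q_norm \<mu> \<kappa> 1 f)\<^sup>2))"
proof -
  define n where "n = 2 * (2 * (5 * exp ((d * ln lam\<^sub>0)/2))\<^sup>2 * norm h + 1) ^ DIM('a)"
  define C1 where "C1 = 14 * n\<^sup>2"
  have C1: "C1 \<ge> 0" by (simp add: C1_def)
  show ?thesis
  proof (intro exI[of _ "C1 + C2"] allI ballI impI)
    fix lam :: real and f :: "'a^2^2 \<Rightarrow> real"
    assume lam: "lam \<ge> 1" and fC: "f \<in> Cc_smooth_Q"
      and "\<exists>v. cutoff (d * ln lam) v \<and> (\<forall>t. \<forall>k\<in>K. f (a_mat (t / \<mu>) ** k) = v t * \<Psi> lam k)"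
    then obtain v where v: "cutoff (d * ln lam) v"
      and fk: "\<And>t k. k \<in> K \<Longrightarrow> f (a_mat (t / \<mu>) ** k) = v t * \<Psi> lam k" by blast
    have cont: "continuous_on (carrier SL2) f"
      using fC by (intro continuous_on_smooth_SL2) (simp add: Cc_smooth_Q_def)
    have f: "f (q ** g) = f g" if "q \<in> subgroup_Q" "g \<in> carrier SL2" for q g
      using fC that by (simp add: Cc_smooth_Q_def)
    have "Theta_norm_sq \<Gamma> \<sigma> f \<le> ennreal (C1 * (Q_norm \<mu> \<kappa> 2 f)\<^sup>2) \<or>
        Theta_norm_sq \<Gamma> \<sigma> f \<le> ennreal (C2 * (Q_norm \<mu> \<kappa> 1 f)\<^sup>2)"
    proof (cases "lam \<ge> lam\<^sub>0")
      case True
      then show ?thesis using large[OF True cont f fk v] by blast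
    next
      case False
      \<comment> \<open>A nonzero value of the cutoff is needed to recover the angular factor; if
        there is none, \<open>f\<close> vanishes on the group.\<close>
      show ?thesis
      proof (cases "\<exists>t. v t \<noteq> 0")
        case True
        then obtain t0 where t0: "v t0 \<noteq> 0" by blast
        have "d * ln lam \<le> d * ln lam\<^sub>0" using False lam d by (intro mult_left_mono) auto
        then have vs: "t \<in> {- (d * ln lam\<^sub>0)..0}" if "v t \<noteq> 0" for t
          using cutoffD(4)[OF v that] by auto
        have "0 \<le> d * ln lam\<^sub>0" using d lam\<^sub>0 by simp
        then have "Theta_norm_sq \<Gamma> \<sigma> f \<le> ennreal (C1 * (Q_norm \<mu> \<kappa> 2 f)\<^sup>2)"
          unfolding C1_def n_def
          by (intro Theta_norm_sq_small[where v = v and \<Psi> = "\<Psi> lam" and B = B and ?t0.0 = t0,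
                OF cont f _ \<mu> cutoffD(1,2)[OF v] vs \<Psi> t0])
            (auto simp: fk)
        then show ?thesis by blast
      next
        case False
        then have z: "f (a_mat t ** k) = 0" if "k \<in> K" for t k
          using fk[OF that, of "\<mu> * t"] \<mu> by simp
        have "Theta_norm_sq \<Gamma> \<sigma> f = 0"
          by (rule Theta_norm_sq_zero) (rule f_lambda_zero[where f = f, OF maximal_compact_axioms f z])
        then show ?thesis by simp
      qed
    qed
    then show "Theta_norm_sq \<Gamma> \<sigma> f \<le> ennreal ((C1 + C2) * ((Q_norm \<mu> \<kappa> 2 f)\<^sup>2 + (Q_norm \<mu> \<kappa> 1 f)\<^sup>2))"
      by (rule ennreal_le_combined_squares[OF C1 C2])
  qed
qed

lemma theta_bound_real:
  fixes \<Gamma> :: "(real^2^2) set" and \<psi> :: "real \<Rightarrow> real"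
  assumes \<Gamma>: "SL2_lattice \<Gamma>" "cusp_at_infinity \<Gamma>" "invariant_probability \<Gamma> \<sigma>"
    and \<kappa>: "haar_probability SO2 \<kappa>" and \<epsilon>: "\<epsilon> > 0"
    and \<psi>: "test_function \<psi>" "\<And>x. 0 \<le> \<psi> x" "\<And>x. \<psi> x \<le> 1"
  shows "\<exists>C :: real. \<forall>lam \<ge> 1. \<forall>f \<in> Cc_smooth_Q. f_lambda_real \<epsilon> \<psi> lam f \<longrightarrow>
    Theta_norm_sq \<Gamma> \<sigma> f \<le> ennreal (C * ((Q_norm 1 \<kappa> 2 f)\<^sup>2 + (Q_norm 1 \<kappa> 1 f)\<^sup>2))"
proof -
  obtain h where lat: "cusp_lattice \<Gamma> \<sigma> h" by (rule cusp_latticeI[OF \<Gamma>])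
  have mc: "maximal_compact SO2 \<kappa>" by (rule maximal_compact_SO2[OF \<kappa>])
  interpret cusp_lattice \<Gamma> \<sigma> h by (rule lat)
  interpret maximal_compact SO2 \<kappa> by (rule mc)
  interpret cusp_lattice_compact \<Gamma> \<sigma> h SO2 \<kappa> 1
  proof
    show "(norm a)\<^sup>2 + (norm b)\<^sup>2 \<le> \<bar>(norm a)\<^sup>2 - (norm b)\<^sup>2\<bar> + 2 * \<bar>b \<bullet> a\<bar> + 2 * \<bar>b \<bullet> (a * 1)\<bar>"
      for a b :: real by (rule hopf_real)
  qed simp
  obtain B where B: "B \<ge> 1" "\<And>x. \<psi> x \<noteq> 0 \<Longrightarrow> \<bar>x\<bar> \<le> B" using test_functionD(2)[OF \<psi>(1)] by auto
  \<comment> \<open>The term exp 3 gives ln lam \<ge> 3 and hence L \<ge> 3; the other term provides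
    lam \<ge> 8 B.\<close>
  define lam1 where "lam1 = exp 3 + 8 * B"
  have lam1: "lam1 > 1" using B(1) by (simp add: lam1_def add_strict_increasing)
  obtain C2 where C2: "C2 \<ge> 0" "\<And>lam v f. lam \<ge> lam1 \<Longrightarrow> continuous_on (carrier SL2) f \<Longrightarrow>
    (\<And>q g. q \<in> subgroup_Q \<Longrightarrow> g \<in> carrier SL2 \<Longrightarrow> f (q ** g) = f g) \<Longrightarrow>
    (\<And>t k. k \<in> SO2 \<Longrightarrow> f (a_mat (t / 1) ** k) = v t * \<psi> (lam * angle_SO2 k)) \<Longrightarrow>
    cutoff ((1 + \<epsilon>) * ln lam) v \<Longrightarrow> Theta_norm_sq \<Gamma> \<sigma> f \<le> ennreal (C2 * (Q_norm 1 \<kappa> 1 f)\<^sup>2)"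
  proof (cases "\<forall>x. \<psi> x = 0")
    case True
    show thesis
    proof (rule that[of 0])
      fix lam v and f :: "real^2^2 \<Rightarrow> real"
      assume f: "\<And>q g. q \<in> subgroup_Q \<Longrightarrow> g \<in> carrier SL2 \<Longrightarrow> f (q ** g) = f g"
        and fk: "\<And>t k. k \<in> SO2 \<Longrightarrow> f (a_mat (t / 1) ** k) = v t * \<psi> (lam * angle_SO2 k)"
      have z: "f (a_mat t ** k) = 0" if "k \<in> SO2" for t k using fk[OF that, of t] True by simp
      have "Theta_norm_sq \<Gamma> \<sigma> f = 0"
        by (rule Theta_norm_sq_zero) (rule f_lambda_zero[where f = f, OF mc f z])
      then show "Theta_norm_sq \<Gamma> \<sigma> f \<le> ennreal (0 * (Q_norm 1 \<kappa> 1 f)\<^sup>2)" by simp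
    qed simp
  next
    case False
    then obtain x0 where "\<psi> x0 \<noteq> 0" by blast
    then have x0: "\<psi> x0 > 0" "\<bar>x0\<bar> \<le> B" using \<psi>(2)[of x0] B(2) by (auto simp: less_le)
    obtain \<eta> where \<eta>: "0 < \<eta>" "\<eta> \<le> 1" "\<And>x. dist x x0 \<le> \<eta> \<Longrightarrow> \<psi> x0 / 2 \<le> \<psi> x"
      by (rule positive_near[OF test_functionD(1)[OF \<psi>(1)] x0(1)]) blast
    define c where "c = \<psi> x0 / 2 * \<eta> / (24 * exp 1)"
    have c: "c > 0" using x0 \<eta> by (simp add: c_def)
    show thesis
    proof (rule that[of "((4 * B * norm h + 1) / c)\<^sup>2"])
      fix lam v and f :: "real^2^2 \<Rightarrow> real"
      assume lam: "lam \<ge> lam1" and cont: "continuous_on (carrier SL2) f"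
        and f: "\<And>q g. q \<in> subgroup_Q \<Longrightarrow> g \<in> carrier SL2 \<Longrightarrow> f (q ** g) = f g"
        and fk': "\<And>t k. k \<in> SO2 \<Longrightarrow> f (a_mat (t / 1) ** k) = v t * \<psi> (lam * angle_SO2 k)"
        and v: "cutoff ((1 + \<epsilon>) * ln lam) v"
      have fk: "f (a_mat t ** k) = v t * \<psi> (lam * angle_SO2 k)" if "k \<in> SO2" for t k
        using fk'[OF that, of t] by simp
      define E where "E = exp (\<epsilon> * ln lam)"
      define L where "L = (1 + \<epsilon>) * ln lam"
      have lB: "lam \<ge> 8 * B" "lam \<ge> B" "lam \<ge> exp 3" "lam > 0"
        using lam B(1) exp_gt_zero[of "3::real"] unfolding lam1_def by linarith+
      have ln3: "ln lam \<ge> 3" using lB(3,4) by (simp add: ln_ge_iff)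
      have EL: "exp L = lam * E" using exp_exponent_split[OF lB(4), of 1 \<epsilon>] lB(4) by (simp add: L_def E_def)
      have E1: "E \<ge> 1" using ln3 \<epsilon> by (simp add: E_def)
      have "1 * 3 \<le> (1 + \<epsilon>) * ln lam" using ln3 \<epsilon> by (intro mult_mono) auto
      then have L3: "L \<ge> 3" by (simp add: L_def)
      note vd = cutoffD[OF v, folded L_def]
      have up: "Theta_norm_sq \<Gamma> \<sigma> f \<le> ennreal (((4 * B * norm h + 1) * E)\<^sup>2)"
        by (rule Theta_norm_sq_le_large_real[OF lat mc f fk vd(4,2,3) \<psi>(2,3) B(2) B(1) lB(2) EL E1])
      have "\<psi> x0 / 2 * \<eta> / (24 * exp 1) * E \<le> Q_norm 1 \<kappa> 1 f"
        using x0(1) \<eta>(3)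
        by (intro Q_norm_1_ge_large_real[OF mc cont fk v[folded L_def] L3 \<psi>(2,3) \<eta>(1,2) _ _ x0(2) lB(1) B(1) EL])
          (auto simp: dist_real_def)
      then have "c * E \<le> Q_norm 1 \<kappa> 1 f" by (simp add: c_def)
      then have "E \<le> Q_norm 1 \<kappa> 1 f / c" using c by (simp add: field_simps)
      then have "((4 * B * norm h + 1) * E)\<^sup>2 \<le> ((4 * B * norm h + 1) * (Q_norm 1 \<kappa> 1 f / c))\<^sup>2"
        using B(1) E1 by (intro power_mono mult_left_mono) auto
      also have "\<dots> = ((4 * B * norm h + 1) / c)\<^sup>2 * (Q_norm 1 \<kappa> 1 f)\<^sup>2"
        by (simp add: power_mult_distrib power_divide)
      finally show "Theta_norm_sq \<Gamma> \<sigma> f \<le> ennreal (((4 * B * norm h + 1) / c)\<^sup>2 * (Q_norm 1 \<kappa> 1 f)\<^sup>2)"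
        using up by (meson ennreal_leI order_trans)
    qed simp
  qed
  have "\<exists>C. \<forall>lam\<ge>1. \<forall>f\<in>Cc_smooth_Q. (\<exists>v. cutoff ((1 + \<epsilon>) * ln lam) v \<and>
      (\<forall>t. \<forall>k\<in>SO2. f (a_mat (t / 1) ** k) = v t * \<psi> (lam * angle_SO2 k))) \<longrightarrow>
    Theta_norm_sq \<Gamma> \<sigma> f \<le> ennreal (C * ((Q_norm 1 \<kappa> 2 f)\<^sup>2 + (Q_norm 1 \<kappa> 1 f)\<^sup>2))"
    using \<epsilon> by (intro theta_bound_if_large[where \<Psi> = "\<lambda>lam k. \<psi> (lam * angle_SO2 k)", OF \<psi>(2,3) _ _ lam1 C2]) auto
  then obtain C where C: "\<And>lam f v. lam \<ge> 1 \<Longrightarrow> f \<in> Cc_smooth_Q \<Longrightarrow> cutoff ((1 + \<epsilon>) * ln lam) v \<Longrightarrow>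
      (\<forall>t. \<forall>k\<in>SO2. f (a_mat (t / 1) ** k) = v t * \<psi> (lam * angle_SO2 k)) \<Longrightarrow>
    Theta_norm_sq \<Gamma> \<sigma> f \<le> ennreal (C * ((Q_norm 1 \<kappa> 2 f)\<^sup>2 + (Q_norm 1 \<kappa> 1 f)\<^sup>2))"
    by blast
  show ?thesis
  proof (intro exI[of _ C] allI ballI impI)
    fix lam :: real and f :: "real^2^2 \<Rightarrow> real"
    assume lam: "lam \<ge> 1" and fC: "f \<in> Cc_smooth_Q" and fl: "f_lambda_real \<epsilon> \<psi> lam f"
    have f: "f (q ** g) = f g" if "q \<in> subgroup_Q" "g \<in> carrier SL2" for q g
      using fC that by (simp add: Cc_smooth_Q_def)
    obtain v where v: "cutoff ((1 + \<epsilon>) * ln lam) v"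
      and formula: "\<And>x t \<theta>. \<theta> \<in> {-pi/2<..pi/2} \<Longrightarrow> f (n_mat x ** a_mat t ** k_real \<theta>) = v t * \<psi> (lam * \<theta>)"
      using fl unfolding f_lambda_real_def by blast
    have "f (a_mat (t / 1) ** k) = v t * \<psi> (lam * angle_SO2 k)" if "k \<in> SO2" for t k
      using f_lambda_real_on_SO2[OF f formula that] by simp
    then show "Theta_norm_sq \<Gamma> \<sigma> f \<le> ennreal (C * ((Q_norm 1 \<kappa> 2 f)\<^sup>2 + (Q_norm 1 \<kappa> 1 f)\<^sup>2))"
      by (intro C[OF lam fC v]) blast
  qed
qed

section \<open>The complex case\<close>

lemma SU2_iff: "A \<in> SU2 \<longleftrightarrow> A \<in> carrier SL2 \<and> A $ 1 $ 1 = cnj (A $ 2 $ 2) \<and> A $ 1 $ 2 = - cnj (A $ 2 $ 1)"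
proof -
  define A' where "A' = (\<chi> i j. cnj (A $ j $ i))"
  have A'_eq: "A' = adj2 A \<longleftrightarrow> A $ 1 $ 1 = cnj (A $ 2 $ 2) \<and> A $ 1 $ 2 = - cnj (A $ 2 $ 1)"
  proof -
    have "A' = adj2 A \<longleftrightarrow> cnj (A $ 1 $ 1) = A $ 2 $ 2 \<and> cnj (A $ 2 $ 1) = - A $ 1 $ 2 \<and>
        cnj (A $ 1 $ 2) = - A $ 2 $ 1 \<and> cnj (A $ 2 $ 2) = A $ 1 $ 1"
      by (simp only: matrix2_eq_iff A'_def adj2_def mat2_nth vec_lambda_beta)
    also have "\<dots> \<longleftrightarrow> A $ 1 $ 1 = cnj (A $ 2 $ 2) \<and> A $ 1 $ 2 = - cnj (A $ 2 $ 1)"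
      by (metis complex_cnj_cnj complex_cnj_minus add.inverse_inverse)
    finally show ?thesis .
  qed
  have "A \<in> SU2 \<longleftrightarrow> A' ** A = mat 1 \<and> A \<in> carrier SL2" by (simp only: SU2_def A'_def mem_Collect_eq) (simp add: SL2_def)
  also have "\<dots> \<longleftrightarrow> A \<in> carrier SL2 \<and> A' = adj2 A"
    using SL2_cancel_right[of A A' "adj2 A"] adj2_mult(1)[of A] by auto
  finally show ?thesis using A'_eq by simp
qed

lemma SU2_row_norm:
  assumes "k \<in> SU2"
  shows "(cmod (k $ 2 $ 1))\<^sup>2 + (cmod (k $ 2 $ 2))\<^sup>2 = 1"
proof -
  have e: "k $ 1 $ 1 = cnj (k $ 2 $ 2)" "k $ 1 $ 2 = - cnj (k $ 2 $ 1)"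
    and "k $ 1 $ 1 * k $ 2 $ 2 - k $ 1 $ 2 * k $ 2 $ 1 = 1"
    using assms unfolding SU2_iff carrier_SL2_iff by blast+
  from this(3) have "cnj (k $ 2 $ 2) * k $ 2 $ 2 + cnj (k $ 2 $ 1) * k $ 2 $ 1 = 1"
    unfolding e by simp
  then have "complex_of_real ((cmod (k $ 2 $ 1))\<^sup>2 + (cmod (k $ 2 $ 2))\<^sup>2) = 1"
    by (simp only: of_real_add complex_norm_square mult.commute add.commute)
  then show ?thesis by (metis of_real_eq_1_iff)
qed

lemma mat2_in_SU2: "(cmod p)\<^sup>2 + (cmod q)\<^sup>2 = 1 \<Longrightarrow> mat2 (cnj p) (- cnj q) q p \<in> SU2"
proof -
  assume "(cmod p)\<^sup>2 + (cmod q)\<^sup>2 = 1"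
  then have "complex_of_real ((cmod p)\<^sup>2 + (cmod q)\<^sup>2) = 1" by (simp only: of_real_1)
  then have "cnj p * p + cnj q * q = 1"
    by (simp only: of_real_add complex_norm_square mult.commute)
  then show ?thesis by (simp add: SU2_iff carrier_SL2_iff)
qed

lemma maximal_compact_SU2:
  assumes "haar_probability SU2 \<kappa>"
  shows "maximal_compact SU2 \<kappa>"
proof
  show "SU2 \<subseteq> carrier SL2" by (auto simp: SU2_iff)
  show "k ** l \<in> SU2" if "k \<in> SU2" "l \<in> SU2" for k l
    using that SL2_mult_closed[of k l] by (simp add: SU2_iff algebra_simps)
  show "adj2 k \<in> SU2" if "k \<in> SU2" for k
    using that adj2_closed[of k] by (simp add: SU2_iff) (simp add: adj2_def)
  show "norm ((x ** k) $ 2) = norm (x $ 2)" if k: "k \<in> SU2" for x k :: "complex^2^2"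
  proof -
    define c where "c = k $ 2 $ 1"
    define d where "d = k $ 2 $ 2"
    define a where "a = x $ 2 $ 1"
    define b where "b = x $ 2 $ 2"
    have k1: "k $ 1 $ 1 = cnj d" "k $ 1 $ 2 = - cnj c" using k by (auto simp: SU2_iff c_def d_def)
    have n: "(cmod c)\<^sup>2 + (cmod d)\<^sup>2 = 1" using SU2_row_norm[OF k] by (simp add: c_def d_def)
    have "complex_of_real ((cmod (a * cnj d + b * c))\<^sup>2 + (cmod (a * (- cnj c) + b * d))\<^sup>2) =
        complex_of_real (((cmod a)\<^sup>2 + (cmod b)\<^sup>2) * ((cmod c)\<^sup>2 + (cmod d)\<^sup>2))"
      unfolding of_real_add of_real_mult complex_norm_square by (simp add: algebra_simps)
    then have "(cmod (a * cnj d + b * c))\<^sup>2 + (cmod (a * (- cnj c) + b * d))\<^sup>2 =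
        ((cmod a)\<^sup>2 + (cmod b)\<^sup>2) * ((cmod c)\<^sup>2 + (cmod d)\<^sup>2)"
      by (simp only: of_real_eq_iff)
    then show ?thesis
      by (simp only: norm_row2 matrix2_mult_nth k1 n mult_1_right a_def[symmetric] b_def[symmetric] c_def[symmetric] d_def[symmetric])
  qed
  show "\<exists>k\<in>SU2. k $ 2 = w" if "norm w = 1" for w :: "complex^2"
  proof (intro bexI[of _ "mat2 (cnj (w $ 2)) (- cnj (w $ 1)) (w $ 1) (w $ 2)"])
    have "(cmod (w $ 2))\<^sup>2 + (cmod (w $ 1))\<^sup>2 = 1" using that by (simp add: norm_row2)
    then show "mat2 (cnj (w $ 2)) (- cnj (w $ 1)) (w $ 1) (w $ 2) \<in> SU2" by (rule mat2_in_SU2)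
  qed (simp add: vec_eq_iff forall_2)
qed (rule assms)

text \<open>The two inner products are the real and imaginary parts of b times the conjugate of a,
  so their squares add up to |a|^2 |b|^2 and the sum of their moduli is at least |a| |b|.\<close>

lemma hopf_complex: "(norm a)\<^sup>2 + (norm b)\<^sup>2 \<le> \<bar>(norm a)\<^sup>2 - (norm b)\<^sup>2\<bar> + 2 * \<bar>b \<bullet> a\<bar> + 2 * \<bar>b \<bullet> (a * \<i>)\<bar>"
  for a b :: complex
proof -
  have "(b \<bullet> a)\<^sup>2 + (b \<bullet> (a * \<i>))\<^sup>2 = (norm a * norm b)\<^sup>2"
    unfolding power_mult_distrib cmod_power2 by (simp add: inner_complex_def power2_eq_square algebra_simps)
  then have "norm a * norm b = sqrt ((b \<bullet> a)\<^sup>2 + (b \<bullet> (a * \<i>))\<^sup>2)"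
    by simp
  then have "norm a * norm b \<le> \<bar>b \<bullet> a\<bar> + \<bar>b \<bullet> (a * \<i>)\<bar>"
    using sqrt_sum_squares_le_sum_abs[of "b \<bullet> a" "b \<bullet> (a * \<i>)"] by linarith
  then show ?thesis using min_square_le[OF norm_ge_zero[of a] norm_ge_zero[of b]] by linarith
qed

text \<open>A relation, because the phases are undetermined where an entry of the row vanishes. Only
  the bottom row and the difference \<delta> of the phases are recorded, since \<open>f\<close>
  depends on nothing else of \<open>k\<close>.\<close>

definition SU2_coordinates :: "complex^2^2 \<Rightarrow> real \<Rightarrow> real \<Rightarrow> bool" where
  "SU2_coordinates k \<theta> \<delta> \<longleftrightarrow> \<theta> \<in> {0..pi/2} \<and> \<delta> \<in> {-pi<..pi} \<and> (\<exists>\<alpha> \<beta>. \<alpha> - \<beta> = \<delta> \<and>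
     k $ 2 $ 1 = - of_real (sin \<theta>) * cis (- \<beta>) \<and> k $ 2 $ 2 = of_real (cos \<theta>) * cis (- \<alpha>))"

definition SU2_angle :: "complex^2^2 \<Rightarrow> real" where
  "SU2_angle k = (SOME \<theta>. \<exists>\<delta>. SU2_coordinates k \<theta> \<delta>)"

definition SU2_phase :: "complex^2^2 \<Rightarrow> real" where
  "SU2_phase k = (SOME \<delta>. SU2_coordinates k (SU2_angle k) \<delta>)"

lemma SU2_coordinates_ex:
  assumes k: "k \<in> SU2"
  shows "\<exists>\<theta> \<delta>. SU2_coordinates k \<theta> \<delta>"
proof -
  obtain \<theta> where \<theta>: "0 \<le> \<theta>" "\<theta> \<le> pi / 2" "cmod (k $ 2 $ 2) = cos \<theta>" "cmod (k $ 2 $ 1) = sin \<theta>"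
    using sincos_total_pi_half[of "cmod (k $ 2 $ 2)" "cmod (k $ 2 $ 1)"] SU2_row_norm[OF k] by (auto simp: add.commute)
  define \<alpha> where "\<alpha> = - Arg (k $ 2 $ 2)"
  define \<beta>0 where "\<beta>0 = - Arg (- k $ 2 $ 1)"
  have bd: "- pi < Arg z" "Arg z \<le> pi" for z using Arg_bounded[of z] by auto
  have r1: "k $ 2 $ 2 = of_real (cos \<theta>) * cis (- \<alpha>)"
    using rcis_cmod_Arg[of "k $ 2 $ 2"] by (simp add: rcis_def \<theta> \<alpha>_def)
  have "- k $ 2 $ 1 = of_real (sin \<theta>) * cis (- \<beta>0)"
    using rcis_cmod_Arg[of "- k $ 2 $ 1"] by (simp add: rcis_def \<theta> \<beta>0_def)
  then have r2: "k $ 2 $ 1 = - of_real (sin \<theta>) * cis (- \<beta>0)" by (simp add: minus_equation_iff[of "k $ 2 $ 1"])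
  \<comment> \<open>Principal arguments leave the difference of the phases between -2 pi and 2 pi;
    shifting \<beta>0 by 2 pi brings it into the required range.\<close>
  have "\<exists>\<beta>. cis (- \<beta>) = cis (- \<beta>0) \<and> \<alpha> - \<beta> \<in> {-pi<..pi}"
  proof -
    consider "\<alpha> - \<beta>0 > pi" | "\<alpha> - \<beta>0 \<le> - pi" | "\<alpha> - \<beta>0 \<in> {-pi<..pi}" by force
    then show ?thesis
    proof cases
      case 1
      have "cis (- (\<beta>0 + 2 * pi)) = cis (- \<beta>0)" by (simp add: complex_eq_iff cos_diff sin_diff)
      then show ?thesis using 1 bd[of "k $ 2 $ 2"] bd[of "- k $ 2 $ 1"]
        by (intro exI[of _ "\<beta>0 + 2 * pi"]) (auto simp: \<alpha>_def \<beta>0_def)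
    next
      case 2
      have "cis (- (\<beta>0 - 2 * pi)) = cis (- \<beta>0)" by (simp add: complex_eq_iff cos_diff sin_diff)
      then show ?thesis using 2 bd[of "k $ 2 $ 2"] bd[of "- k $ 2 $ 1"]
        by (intro exI[of _ "\<beta>0 - 2 * pi"]) (auto simp: \<alpha>_def \<beta>0_def)
    qed blast
  qed
  then obtain \<beta> where \<beta>: "cis (- \<beta>) = cis (- \<beta>0)" "\<alpha> - \<beta> \<in> {-pi<..pi}" by blast
  have "SU2_coordinates k \<theta> (\<alpha> - \<beta>)"
    unfolding SU2_coordinates_def using \<theta>(1,2) \<beta>(2) r1 r2[folded \<beta>(1)] atLeastAtMost_iff by blast
  then show ?thesis by blast
qed

lemma SU2_coordinates: "k \<in> SU2 \<Longrightarrow> SU2_coordinates k (SU2_angle k) (SU2_phase k)"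
  unfolding SU2_phase_def using someI_ex[OF SU2_coordinates_ex, folded SU2_angle_def] by (rule someI_ex)

lemma f_lambda_complex_on_SU2:
  fixes f :: "complex^2^2 \<Rightarrow> real"
  assumes f: "\<And>q g. q \<in> subgroup_Q \<Longrightarrow> g \<in> carrier SL2 \<Longrightarrow> f (q ** g) = f g"
    and formula: "\<And>x t \<theta> \<alpha> \<beta>. \<theta> \<in> {0..pi/2} \<Longrightarrow> \<alpha> - \<beta> \<in> {-pi<..pi} \<Longrightarrow>
      f (n_mat x ** a_mat t ** k_complex \<theta> \<alpha> \<beta>) = v (2 * t) * \<psi> (lam * sin \<theta>, lam * (\<alpha> - \<beta>))"
    and k: "k \<in> SU2"
  shows "f (a_mat (t / 2) ** k) = v t * \<psi> (lam * sin (SU2_angle k), lam * SU2_phase k)"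
proof -
  let ?\<theta> = "SU2_angle k"
  obtain \<alpha> \<beta> where c: "?\<theta> \<in> {0..pi/2}" "\<alpha> - \<beta> = SU2_phase k" "SU2_phase k \<in> {-pi<..pi}"
    "k $ 2 $ 1 = - of_real (sin ?\<theta>) * cis (- \<beta>)" "k $ 2 $ 2 = of_real (cos ?\<theta>) * cis (- \<alpha>)"
    using SU2_coordinates[OF k] unfolding SU2_coordinates_def by blast
  have "f (a_mat (t / 2) ** k) = f (n_mat 0 ** a_mat (t / 2) ** k_complex ?\<theta> \<alpha> \<beta>)"
  proof (rule Q_invariant_eqI[OF f, where u = 1])
    have kS: "k \<in> carrier SL2" using k by (simp add: SU2_iff)
    have "complex_of_real ((cos ?\<theta>)\<^sup>2 + (sin ?\<theta>)\<^sup>2) = 1"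
      by (simp only: sin_cos_squared_add2 of_real_1)
    then have "of_real (cos ?\<theta>) * of_real (cos ?\<theta>) + of_real (sin ?\<theta>) * of_real (sin ?\<theta>) = (1 :: complex)"
      by (simp only: power2_eq_square of_real_add of_real_mult)
    then have kc: "k_complex ?\<theta> \<alpha> \<beta> \<in> carrier SL2"
      by (simp add: carrier_SL2_iff k_complex_def cis_mult mult.assoc mult.left_commute)
    show "a_mat (t / 2) ** k \<in> carrier SL2" by (intro SL2_mult_closed a_mat_in_SL2 kS)
    show "n_mat 0 ** a_mat (t / 2) ** k_complex ?\<theta> \<alpha> \<beta> \<in> carrier SL2"
      by (intro SL2_mult_closed a_mat_in_SL2 n_mat_in_SL2 kc)
    show "norm (1 :: complex) = 1" by simp
    show "(a_mat (t / 2) ** k) $ 2 $ 1 = 1 * (n_mat 0 ** a_mat (t / 2) ** k_complex ?\<theta> \<alpha> \<beta>) $ 2 $ 1"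
      "(a_mat (t / 2) ** k) $ 2 $ 2 = 1 * (n_mat 0 ** a_mat (t / 2) ** k_complex ?\<theta> \<alpha> \<beta>) $ 2 $ 2"
      by (simp_all add: a_mat_def n_mat_def k_complex_def c(4,5))
  qed
  then show ?thesis using formula[of ?\<theta> \<alpha> \<beta> 0 "t / 2"] c(1-3) by simp
qed

text \<open>\<open>near\<close> bounds the determinant distance of two unit rows with moduli (S, C)
  and (s, c) and relative phase \<tau>. Comparing moduli controls S - s; the imaginary part S c sin
  \<tau> controls the phase, with a loss of 1/s because the phase degenerates as s tends to
  zero.\<close>

lemma complex_disc_coordinates:
  fixes s c S C \<tau> \<rho> :: real
  assumes sc: "s\<^sup>2 + c\<^sup>2 = 1" "0 \<le> s" "1 / 2 \<le> c" and SC: "S\<^sup>2 + C\<^sup>2 = 1" "0 \<le> S" "0 \<le> C"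
    and near: "cmod (of_real (C * s) - of_real (S * c) * cis \<tau>) \<le> \<rho>" and \<rho>: "\<rho> \<le> 1"
    and s: "s + 2 * \<rho> \<le> 1 / 2" "8 * \<rho> \<le> s" and \<tau>: "\<bar>\<tau>\<bar> \<le> pi + 1" and "\<rho> > 0"
  shows "\<bar>S - s\<bar> \<le> 2 * \<rho>" "\<bar>\<tau>\<bar> \<le> 8 * \<rho> / s"
proof -
  have c0: "0 \<le> c" using sc by linarith
  have "cmod (of_real (C * s)) - cmod (of_real (S * c) * cis \<tau>) \<le> \<rho>"
    "cmod (of_real (S * c) * cis \<tau>) - cmod (of_real (C * s)) \<le> \<rho>"
    using near norm_triangle_ineq2[of "of_real (C * s)" "of_real (S * c) * cis \<tau>"]
      norm_triangle_ineq2[of "of_real (S * c) * cis \<tau>" "of_real (C * s)"]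
    by (simp_all only: norm_minus_commute[of "of_real (S * c) * cis \<tau>" "of_real (C * s)"])
  then have d: "\<bar>S * c - C * s\<bar> \<le> \<rho>"
    using sc SC c0 by (simp add: norm_mult abs_le_iff)
  \<comment> \<open>\<open>e\<close> and S c - C s are cosine and sine of the difference of the two
    angles, so 1 - e \<le> 1 - e^2 \<le> \<rho>^2 \<le> \<rho>.\<close>
  define e where "e = C * c + S * s"
  have e0: "0 \<le> e" using sc SC c0 by (simp add: e_def)
  have "e\<^sup>2 + (S * c - C * s)\<^sup>2 = (s\<^sup>2 + c\<^sup>2) * (S\<^sup>2 + C\<^sup>2)"
    by (simp add: e_def power2_eq_square algebra_simps)
  then have e2: "e\<^sup>2 + (S * c - C * s)\<^sup>2 = 1" using sc(1) SC(1) by simp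
  have "(S * c - C * s)\<^sup>2 \<le> \<rho>\<^sup>2" using d by (simp add: abs_le_square_iff[symmetric])
  moreover have "\<rho>\<^sup>2 \<le> \<rho>" using \<rho> \<open>\<rho> > 0\<close> by (simp add: power2_eq_square mult_left_le)
  moreover have e1: "e \<le> 1"
    using e2 e0 by (smt (verit) one_le_power power2_eq_square zero_le_power2 mult_le_cancel_left1)
  then have "e\<^sup>2 \<le> e" using e0 by (simp add: power2_eq_square mult_left_le)
  ultimately have e': "1 - e \<le> \<rho>" using e2 by linarith
  have "S = S * (s\<^sup>2 + c\<^sup>2)" using sc(1) by simp
  also have "\<dots> = s * e + c * (S * c - C * s)" by (simp add: e_def power2_eq_square algebra_simps)
  finally have "S - s = - (s * (1 - e)) + c * (S * c - C * s)" by (simp add: algebra_simps)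
  then have "\<bar>S - s\<bar> \<le> \<bar>s * (1 - e)\<bar> + \<bar>c * (S * c - C * s)\<bar>" by linarith
  also have "\<bar>s * (1 - e)\<bar> \<le> 1 * \<rho>"
    unfolding abs_mult using s \<open>\<rho> > 0\<close> sc e' e1 by (intro mult_mono) auto
  also have "\<bar>c * (S * c - C * s)\<bar> \<le> 1 * \<rho>"
  proof -
    have "c \<le> 1" using sc(1) by (metis abs_square_le_1 abs_le_iff le_add_same_cancel2 zero_le_power2)
    then show ?thesis unfolding abs_mult using d c0 by (intro mult_mono) auto
  qed
  finally show Ss: "\<bar>S - s\<bar> \<le> 2 * \<rho>" by simp
  have "\<bar>Im (of_real (C * s) - of_real (S * c) * cis \<tau>)\<bar> \<le> \<rho>" "\<bar>Re (of_real (C * s) - of_real (S * c) * cis \<tau>)\<bar> \<le> \<rho>"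
    using near abs_Im_le_cmod abs_Re_le_cmod order_trans by blast+
  then have im: "\<bar>S * c * sin \<tau>\<bar> \<le> \<rho>" and re: "\<bar>C * s - S * c * cos \<tau>\<bar> \<le> \<rho>" by simp_all
  have S2: "s / 2 \<le> S" "S \<le> 1 / 2" using Ss s by linarith+
  have C2: "1 / 2 \<le> C"
  proof (rule ccontr)
    assume "\<not> 1 / 2 \<le> C"
    then have "C\<^sup>2 < (1/2)\<^sup>2" "S\<^sup>2 \<le> (1/2)\<^sup>2" using SC S2 by (intro power_strict_mono power_mono; simp)+
    then show False using SC(1) by (simp add: power2_eq_square)
  qed
  have s0: "s > 0" using s \<open>\<rho> > 0\<close> by linarith
  \<comment> \<open>A small sine leaves \<tau> near 0 or near a multiple of pi; the real part
    excludes the latter, since C s is at least s/2, which exceeds \<rho>.\<close>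
  have cos_pos: "cos \<tau> > 0"
  proof (rule ccontr)
    assume "\<not> cos \<tau> > 0"
    then have "S * c * cos \<tau> \<le> 0" using SC c0 by (intro mult_nonneg_nonpos) auto
    moreover have "1 / 2 * s \<le> C * s" using C2 s0 by (intro mult_right_mono) auto
    ultimately show False using re s(2) \<open>\<rho> > 0\<close> by linarith
  qed
  have "\<bar>\<tau>\<bar> < pi / 2"
  proof (rule ccontr)
    assume "\<not> \<bar>\<tau>\<bar> < pi / 2"
    then have "0 \<le> cos (\<bar>\<tau>\<bar> - pi)" using \<tau> pi_gt3 by (intro cos_ge_zero) linarith+
    then show False using cos_pos by (simp add: cos_diff)
  qed
  then have t_range: "\<tau> \<in> {-pi/2..pi/2}" by auto
  have "s / 2 * (1 / 2) * \<bar>sin \<tau>\<bar> \<le> S * c * \<bar>sin \<tau>\<bar>"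
    using S2 sc(3) s0 by (intro mult_right_mono mult_mono) auto
  also have "\<dots> \<le> \<rho>" using im SC c0 by (simp add: abs_mult)
  finally have sin: "\<bar>sin \<tau>\<bar> \<le> 4 * \<rho> / s" using s0 by (simp add: field_simps)
  also have "\<dots> \<le> 1 / 2" using s(2) s0 by (simp add: field_simps)
  finally have "\<bar>\<tau>\<bar> \<le> 2 / 3" using t_range by (intro abs_le_of_sin)
  then have "\<bar>\<tau>\<bar> \<le> 2 * \<bar>sin \<tau>\<bar>" by (intro abs_le_twice_abs_sin) linarith
  then show "\<bar>\<tau>\<bar> \<le> 8 * \<rho> / s" using sin by simp
qed

text \<open>The set where the angular factor is at least \<delta> contains a strip of length about
  1/lam and width about 1/lam^2, the phase acting at distance about 1/lam from its degenerate point.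
  A single disc that fits has measure of order lam^-4, which is too little; about lam disjoint discs
  of radius \<rho> placed along the strip recover the order lam^-3.\<close>

lemma Q_norm_1_ge_large_complex:
  fixes f :: "complex^2^2 \<Rightarrow> real" and x0 y0 B \<eta> lam :: real
  assumes K: "maximal_compact SU2 \<kappa>" and cont: "continuous_on (carrier SL2) f"
    and fk: "\<And>t k. k \<in> SU2 \<Longrightarrow> f (a_mat (t / 2) ** k) = v t * \<psi> (lam * sin (SU2_angle k), lam * SU2_phase k)"
    and v: "cutoff L v" and L: "L \<ge> 3"
    and \<psi>: "\<And>x. 0 \<le> \<psi> x" "\<And>x. \<psi> x \<le> B"
    and \<eta>: "0 < \<eta>" "\<eta> \<le> 1" "\<eta> \<le> x0" "\<And>x y. \<bar>x - x0\<bar> \<le> \<eta> / 2 \<Longrightarrow> \<bar>y - y0\<bar> \<le> \<eta> / 2 \<Longrightarrow> \<delta> \<le> \<psi> (x, y)"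
    and \<delta>: "\<delta> \<ge> 0" and x0: "\<bar>x0\<bar> \<le> B" "\<bar>y0\<bar> \<le> B" and lam: "lam \<ge> 8 * B" "B \<ge> 1" and E: "exp L = lam ^ 3 * E"
  defines "M \<equiv> 16 + 16 / x0"
  shows "\<delta> * \<eta>\<^sup>2 / (72 * exp 1 * M\<^sup>2) * E \<le> Q_norm 2 \<kappa> 1 f"
proof -
  interpret maximal_compact SU2 \<kappa> by fact
  interpret prob_space \<kappa> by (rule prob_\<kappa>)
  have l8: "lam \<ge> 8" using lam by linarith
  have x0_pos: "x0 > 0" using \<eta>(1,3) by linarith
  have M: "M \<ge> 16" "16 / x0 \<le> M" using x0_pos by (auto simp: M_def)
  \<comment> \<open>Over all the discs the deviation from (x0, y0) is a multiple of \<eta>/M in the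
    first variable and at most 8 \<eta>/(M x0) in the second; the choice of \<open>M\<close> makes
    both at most \<eta>/2.\<close>
  define \<rho> where "\<rho> = \<eta> / (M * lam\<^sup>2)"
  define \<alpha>0 where "\<alpha>0 = y0 / lam"
  define J where "J = nat \<lfloor>lam\<rfloor>"
  \<comment> \<open>Centres at constant phase. Spacing 5 \<rho> in the sine together with a cosine
    of at least 1/2 yields determinants of modulus at least 5 \<rho>/2, hence disjoint
    discs.\<close>
  define s where "s j = x0 / lam + 5 * \<rho> * real j" for j
  define c where "c j = sqrt (1 - (s j)\<^sup>2)" for j
  define u where "u j = mat2 (cnj (of_real (c j) * cis (- \<alpha>0))) (- cnj (- of_real (s j))) (- of_real (s j)) (of_real (c j) * cis (- \<alpha>0))" for j
  have J: "real J \<le> lam" "lam / 2 \<le> real J" using l8 unfolding J_def by linarith+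
  have \<rho>0: "\<rho> > 0" using \<eta>(1) M l8 by (simp add: \<rho>_def)
  define q where "q = \<eta> / M"
  have q0: "0 \<le> q" using \<eta>(1) M(1) by (simp add: q_def)
  have lr: "lam * \<rho> * lam = q" using l8 by (simp add: \<rho>_def q_def power2_eq_square)
  have eM: "q \<le> 1 / 16" "q \<le> \<eta> / 16" "q * 16 \<le> x0"
  proof -
    show "q \<le> 1 / 16" unfolding q_def using \<eta> M by (intro frac_le) auto
    show "q \<le> \<eta> / 16" unfolding q_def using \<eta> M by (intro frac_le) auto
    then show "q * 16 \<le> x0" using \<eta>(3) by linarith
  qed
  have lr': "lam * \<rho> \<le> q / 8"
  proof -
    have "lam * \<rho> * 8 \<le> lam * \<rho> * lam" using l8 \<rho>0 by (intro mult_left_mono) auto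
    then show ?thesis using lr by simp
  qed
  have r64: "\<rho> \<le> q / 64"
  proof -
    have "8 * \<rho> \<le> lam * \<rho>" using l8 \<rho>0 by (intro mult_right_mono) auto
    then show ?thesis using lr' by linarith
  qed
  have xl: "x0 / lam \<le> 1 / 8" "\<bar>\<alpha>0\<bar> \<le> 1 / 8"
    using x0 lam l8 by (auto simp: \<alpha>0_def field_simps abs_divide)
  have s: "x0 / lam \<le> s j" "lam * s j \<le> x0 + 5 * (q)" "s j \<le> 3 / 16" if "j < J" for j
  proof -
    show "x0 / lam \<le> s j" using \<rho>0 by (simp add: s_def)
    have "real j \<le> lam" using that J(1) by linarith
    then have "lam * \<rho> * real j \<le> lam * \<rho> * lam" using \<rho>0 l8 by (intro mult_left_mono) auto
    then have a: "lam * \<rho> * real j \<le> q" by (simp only: lr)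
    then show "lam * s j \<le> x0 + 5 * (q)" using l8 by (simp add: s_def distrib_left mult.assoc mult.left_commute)
    have "8 * (\<rho> * real j) \<le> lam * (\<rho> * real j)" using l8 \<rho>0 by (intro mult_right_mono) auto
    then have "\<rho> * real j \<le> 1 / 128" using a eM(1) by (simp add: mult.assoc)
    then show "s j \<le> 3 / 16" unfolding s_def using xl by (simp add: mult.assoc)
  qed
  have s0: "0 < s j" for j unfolding s_def using x0_pos l8 \<rho>0 by (intro add_pos_nonneg) auto
  have s2: "(s j)\<^sup>2 \<le> 3 / 4" if "j < J" for j
  proof -
    have "(s j)\<^sup>2 \<le> (3 / 16)\<^sup>2" using s(3)[OF that] s0[of j] by (intro power_mono) auto
    then show ?thesis by (simp add: power2_eq_square)
  qed
  have c: "(s j)\<^sup>2 + (c j)\<^sup>2 = 1" "1 / 2 \<le> c j" if "j < J" for j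
  proof -
    show "(s j)\<^sup>2 + (c j)\<^sup>2 = 1" using s2[OF that] by (simp add: c_def)
    have "sqrt ((1 / 2)\<^sup>2) \<le> c j" unfolding c_def using s2[OF that] by (intro real_sqrt_le_mono) (simp add: power2_eq_square)
    then show "1 / 2 \<le> c j" by simp
  qed
  have u: "u j \<in> SU2" if "j < J" for j
    unfolding u_def using c(1)[OF that] by (intro mat2_in_SU2) (simp add: norm_mult add.commute)
  have u_row: "u j $ 2 $ 1 = - of_real (s j)" "u j $ 2 $ 2 = of_real (c j) * cis (- \<alpha>0)" for j
    by (simp_all add: u_def)
  have disjoint: "disc (u i) \<rho> \<inter> disc (u j) \<rho> = {}" if ij: "j < i" "i < J" for i j
  proof (rule disc_disjoint)
    have jJ: "j < J" using ij by simp
    show "u i \<in> SU2" "u j \<in> SU2" using u ij by auto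
    have "(u i ** adj2 (u j)) $ 2 $ 1 = (of_real (s j * c i - s i * c j)) * cis (- \<alpha>0)"
      by (simp add: adj2_def u_row algebra_simps)
    then have eq: "norm ((u i ** adj2 (u j)) $ 2 $ 1) = \<bar>s j * c i - s i * c j\<bar>"
      by (simp only: norm_mult norm_of_real norm_cis mult_1_right)
    have diff: "5 * \<rho> \<le> s i - s j"
    proof -
      have "5 * \<rho> * 1 \<le> 5 * \<rho> * (real i - real j)" using ij \<rho>0 by (intro mult_left_mono) auto
      then show ?thesis by (simp add: s_def right_diff_distrib)
    qed
    have "(s j)\<^sup>2 \<le> (s i)\<^sup>2" using diff \<rho>0 s0[of j] by (intro power_mono) auto
    then have "c i \<le> c j" unfolding c_def by (intro real_sqrt_le_mono) simp
    then have "s j * c i \<le> s j * c j" using s0[of j] by (intro mult_left_mono) auto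
    moreover have "5 * \<rho> * (1 / 2) \<le> (s i - s j) * c j" using diff c(2)[OF jJ] \<rho>0 by (intro mult_mono) auto
    ultimately have "5 / 2 * \<rho> \<le> s i * c j - s j * c i" by (simp add: left_diff_distrib)
    then show "2 * \<rho> < norm ((u i ** adj2 (u j)) $ 2 $ 1)" unfolding eq using \<rho>0 by linarith
  qed
  define D where "D = (\<Union>j<J. disc (u j) \<rho>)"
  have D_sets: "D \<in> sets \<kappa>" unfolding D_def by (intro sets.finite_UN disc_sets) auto
  have \<rho>1: "\<rho> \<le> 1" using r64 eM(1) by linarith
  have D_measure: "\<eta>\<^sup>2 / (36 * M\<^sup>2 * lam ^ 3) \<le> measure \<kappa> D"
  proof -
    have df: "disjoint_family_on (\<lambda>j. disc (u j) \<rho>) {..<J}"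
      unfolding disjoint_family_on_def using disjoint by (metis Int_commute lessThan_iff linorder_neqE_nat)
    have "\<eta>\<^sup>2 / (36 * M\<^sup>2 * lam ^ 3) = lam / 2 * ((\<rho> / 3)\<^sup>2 / 2)"
      using l8 by (simp add: \<rho>_def power2_eq_square power3_eq_cube field_simps)
    also have "\<dots> \<le> real J * ((\<rho> / 3)\<^sup>2 / 2)" using J(2) by (intro mult_right_mono) auto
    also have "\<dots> = (\<Sum>j<J. (\<rho> / 3)\<^sup>2 / 2)" by simp
    also have "\<dots> \<le> (\<Sum>j<J. measure \<kappa> (disc (u j) \<rho>))"
      using measure_disc_ge[OF \<rho>0 \<rho>1 u] by (intro sum_mono) simp
    also have "\<dots> = measure \<kappa> D"
      unfolding D_def using df by (intro finite_measure_finite_Union[symmetric]) auto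
    finally show ?thesis .
  qed
  have D: "\<delta> \<le> \<psi> (lam * sin (SU2_angle k), lam * SU2_phase k)" if kD: "k \<in> D" for k
  proof -
    obtain j where j: "j < J" "k \<in> disc (u j) \<rho>" using kD by (auto simp: D_def)
    have kS: "k \<in> SU2" and kr: "norm ((k ** adj2 (u j)) $ 2 $ 1) \<le> \<rho>" using j(2) unfolding disc_def by blast+
    define \<theta> where "\<theta> = SU2_angle k"
    obtain \<alpha> \<beta> where co: "\<theta> \<in> {0..pi/2}" "\<alpha> - \<beta> = SU2_phase k" "SU2_phase k \<in> {-pi<..pi}"
      "k $ 2 $ 1 = - of_real (sin \<theta>) * cis (- \<beta>)" "k $ 2 $ 2 = of_real (cos \<theta>) * cis (- \<alpha>)"
      using SU2_coordinates[OF kS] unfolding SU2_coordinates_def \<theta>_def by blast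
    define \<tau> where "\<tau> = SU2_phase k - \<alpha>0"
    have row: "(k ** adj2 (u j)) $ 2 $ 1 = k $ 2 $ 1 * u j $ 2 $ 2 - k $ 2 $ 2 * u j $ 2 $ 1" by (simp add: adj2_def)
    have "(k ** adj2 (u j)) $ 2 $ 1 = cis (- \<alpha>) * (of_real (cos \<theta> * s j) - of_real (sin \<theta> * c j) * cis \<tau>)"
    proof -
      have "cis (- \<beta>) * cis (- \<alpha>0) = cis (- \<alpha>) * cis \<tau>"
        using co(2) by (simp add: cis_mult \<tau>_def algebra_simps)
      then have "of_real (sin \<theta>) * cis (- \<beta>) * (of_real (c j) * cis (- \<alpha>0)) =
          of_real (sin \<theta> * c j) * (cis (- \<alpha>) * cis \<tau>)" by (simp add: mult_ac)
      then show ?thesis unfolding row co(4,5) u_row by (auto simp: algebra_simps)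
    qed
    then have near: "cmod (of_real (cos \<theta> * s j) - of_real (sin \<theta> * c j) * cis \<tau>) \<le> \<rho>"
      using kr by (simp only: norm_mult norm_cis mult_1_left)
    have small: "8 * \<rho> \<le> x0 / lam"
    proof -
      have "8 * \<rho> * lam = 8 * (lam * \<rho>)" by (simp add: mult_ac)
      then have "8 * \<rho> * lam \<le> x0" using lr' eM(3) q0 by linarith
      then show ?thesis using l8 by (simp add: field_simps)
    qed
    have tau: "\<bar>\<tau>\<bar> \<le> pi + 1" using co(3) xl(2) by (auto simp: \<tau>_def)
    have sc0: "0 \<le> sin \<theta>" "0 \<le> cos \<theta>" using co(1) by (auto intro: sin_ge_zero cos_ge_zero)
    note dc = complex_disc_coordinates[OF c(1)[OF j(1)] less_imp_le[OF s0] c(2)[OF j(1)] _ sc0 near \<rho>1 _ _ tau \<rho>0]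
    have dc1: "\<bar>sin \<theta> - s j\<bar> \<le> 2 * \<rho>" and dc2: "\<bar>\<tau>\<bar> \<le> 8 * \<rho> / s j"
      using s[OF j(1)] small r64 eM(1) by (intro dc; simp)+
    have "\<bar>lam * sin \<theta> - lam * s j\<bar> = lam * \<bar>sin \<theta> - s j\<bar>" using l8 by (simp add: abs_mult flip: right_diff_distrib)
    also have "\<dots> \<le> lam * (2 * \<rho>)" using dc1 l8 by (intro mult_left_mono) auto
    finally have a1: "\<bar>lam * sin \<theta> - lam * s j\<bar> \<le> q / 4" using lr' by linarith
    have "lam * (x0 / lam) \<le> lam * s j" using s(1)[OF j(1)] l8 by (intro mult_left_mono) auto
    then have "x0 \<le> lam * s j" using l8 by simp
    then have p1: "\<bar>lam * sin \<theta> - x0\<bar> \<le> \<eta> / 2" using a1 s(2)[OF j(1)] eM(2) \<eta>(1) by linarith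
    have "\<bar>\<tau>\<bar> \<le> 8 * \<rho> / (x0 / lam)"
    proof (rule order_trans[OF dc2], rule divide_left_mono)
      show "0 < s j * (x0 / lam)" using s0[of j] x0_pos l8 by (intro mult_pos_pos divide_pos_pos) auto
    qed (use s(1)[OF j(1)] \<rho>0 in auto)
    then have "lam * \<bar>\<tau>\<bar> \<le> lam * (8 * \<rho> / (x0 / lam))" using l8 by (intro mult_left_mono) auto
    also have "\<dots> = 8 * (lam * \<rho> * lam) / x0" by (simp add: field_simps)
    also have "\<dots> = q * (8 / x0)" by (simp only: lr) simp
    also have "\<dots> \<le> q * (M / 2)" using M(2) q0 by (intro mult_left_mono) auto
    also have "\<dots> = \<eta> / 2" using M(1) by (simp add: q_def)
    also have "lam * \<bar>\<tau>\<bar> = \<bar>lam * SU2_phase k - y0\<bar>"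
    proof -
      have "lam * \<tau> = lam * SU2_phase k - y0" using l8 by (simp add: \<tau>_def \<alpha>0_def right_diff_distrib)
      then show ?thesis using l8 by (metis abs_mult abs_of_nonneg order_trans zero_le_numeral)
    qed
    finally show ?thesis using \<eta>(4)[OF p1] by (simp add: \<theta>_def)
  qed
  have "\<delta> * measure \<kappa> D * (exp (L - 1) / 2) \<le> Q_norm 2 \<kappa> 1 f"
    by (rule Q_norm_1_ge[where \<Psi> = "\<lambda>k. \<psi> (lam * sin (SU2_angle k), lam * SU2_phase k)" and B = B,
          OF cont fk L v cutoffD(1)[OF v] \<psi> D_sets D \<delta>])
  moreover have "\<delta> * (\<eta>\<^sup>2 / (36 * M\<^sup>2 * lam ^ 3)) * (exp (L - 1) / 2) \<le> \<delta> * measure \<kappa> D * (exp (L - 1) / 2)"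
    using D_measure \<delta> by (intro mult_right_mono mult_left_mono) auto
  moreover have eL: "exp (L - 1) = lam ^ 3 * E / exp 1" by (simp add: exp_diff E)
  have "lam \<noteq> 0" using l8 by simp
  then have "\<delta> * (\<eta>\<^sup>2 / (36 * M\<^sup>2 * lam ^ 3)) * (exp (L - 1) / 2) = \<delta> * \<eta>\<^sup>2 / (72 * exp 1 * M\<^sup>2) * E"
    unfolding eL by (simp add: mult_ac)
  ultimately show ?thesis by linarith
qed

text \<open>Two rotated copies u, v of \<zeta> by angles a, b satisfy Im(u cnj v) = |\<zeta>|^2
  sin(a - b), and small imaginary parts make this at most 2 w |\<zeta>| in modulus. So admissible
  angles differ by at most 4 w/|\<zeta>| and lie in an interval of twice that length.\<close>

lemma measure_small_sine_le:
  fixes \<zeta> :: complex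
  assumes \<zeta>: "\<zeta> \<noteq> 0" and w: "w \<ge> 0"
  shows "(\<integral>\<^sup>+\<phi>. indicator {\<phi>. \<bar>Im (cis \<phi> * \<zeta>)\<bar> \<le> w} \<phi> \<partial>unit_interval) \<le> ennreal (8 * w / cmod \<zeta>)"
proof -
  define E where "E = {\<phi>. \<bar>Im (cis \<phi> * \<zeta>)\<bar> \<le> w} \<inter> {0..1}"
  have cl: "closed {\<phi>. \<bar>Im (cis \<phi> * \<zeta>)\<bar> \<le> w}"
    by (intro closed_Collect_le continuous_intros)
  have diam: "\<bar>a - b\<bar> \<le> 4 * w / cmod \<zeta>" if "a \<in> E" "b \<in> E" for a b
  proof -
    define u where "u = cis a * \<zeta>"
    define v where "v = cis b * \<zeta>"
    have uv: "\<bar>Im u\<bar> \<le> w" "\<bar>Im v\<bar> \<le> w" "cmod u = cmod \<zeta>" "cmod v = cmod \<zeta>"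
      using that by (auto simp: E_def u_def v_def norm_mult)
    have "u * cnj v = (cis a * cis (- b)) * (\<zeta> * cnj \<zeta>)" by (simp add: u_def v_def cis_cnj mult_ac)
    also have "\<dots> = cis (a - b) * of_real ((cmod \<zeta>)\<^sup>2)"
      by (simp only: cis_mult complex_norm_square diff_conv_add_uminus)
    finally have "Im (u * cnj v) = (cmod \<zeta>)\<^sup>2 * sin (a - b)" by (simp del: of_real_power)
    then have "(cmod \<zeta>)\<^sup>2 * \<bar>sin (a - b)\<bar> = \<bar>Im u * Re v - Re u * Im v\<bar>" by (simp add: abs_mult algebra_simps)
    also have "\<dots> \<le> \<bar>Im u\<bar> * \<bar>Re v\<bar> + \<bar>Re u\<bar> * \<bar>Im v\<bar>" using abs_triangle_ineq4[of "Im u * Re v" "Re u * Im v"] by (simp add: abs_mult)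
    also have "\<dots> \<le> w * cmod \<zeta> + cmod \<zeta> * w"
      using uv abs_Re_le_cmod[of u] abs_Re_le_cmod[of v] w by (intro add_mono mult_mono) auto
    finally have "\<bar>sin (a - b)\<bar> \<le> 2 * w / cmod \<zeta>"
      using \<zeta> by (simp add: field_simps power2_eq_square)
    moreover have "\<bar>a - b\<bar> \<le> 1" using that by (auto simp: E_def)
    ultimately show ?thesis using abs_le_twice_abs_sin[of "a - b"] by linarith
  qed
  have "(\<integral>\<^sup>+\<phi>. indicator {\<phi>. \<bar>Im (cis \<phi> * \<zeta>)\<bar> \<le> w} \<phi> \<partial>unit_interval) =
      (\<integral>\<^sup>+\<phi>. indicator {\<phi>. \<bar>Im (cis \<phi> * \<zeta>)\<bar> \<le> w} \<phi> * indicator {0..1} \<phi> \<partial>lborel)"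
    using cl by (intro nn_integral_unit_interval borel_measurable_indicator borel_closed)
  also have "\<dots> = (\<integral>\<^sup>+\<phi>. indicator E \<phi> \<partial>lborel)"
    by (intro nn_integral_cong) (auto simp: E_def indicator_def)
  also have "\<dots> \<le> ennreal (8 * w / cmod \<zeta>)"
  proof (cases "E = {}")
    case False
    then obtain a where a: "a \<in> E" by blast
    have "(\<integral>\<^sup>+\<phi>. indicator E \<phi> \<partial>lborel) \<le> (\<integral>\<^sup>+\<phi>. indicator {a - 4 * w / cmod \<zeta>..a + 4 * w / cmod \<zeta>} \<phi> \<partial>lborel)"
      using diam[OF _ a] by (intro nn_integral_mono) (auto simp: indicator_def abs_le_iff; force)
    also have "\<dots> = ennreal (8 * w / cmod \<zeta>)" using w by (simp add: divide_nonneg_nonneg)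
    finally show ?thesis .
  qed simp
  finally show ?thesis .
qed

lemma measure_unit_interval_le:
  assumes "r \<ge> 0"
  shows "(\<integral>\<^sup>+x. indicator {x. \<bar>p + x\<bar> \<le> r} x \<partial>unit_interval) \<le> ennreal (2 * r)"
proof -
  have eq: "{x. \<bar>p + x\<bar> \<le> r} = {- p - r..- p + r}" by auto
  have "(\<integral>\<^sup>+x. indicator {x. \<bar>p + x\<bar> \<le> r} x \<partial>unit_interval) =
      (\<integral>\<^sup>+x. indicator {- p - r..- p + r} x * indicator {0..1} x \<partial>lborel)"
    unfolding eq by (intro nn_integral_unit_interval) simp
  also have "\<dots> \<le> (\<integral>\<^sup>+x. indicator {- p - r..- p + r} x \<partial>lborel)"
    by (intro nn_integral_mono) (auto simp: indicator_def)
  also have "\<dots> = ennreal (2 * r)" using assms by simp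
  finally show ?thesis .
qed

text \<open>
  Two points of the strip differ by at most \<open>2 b\<close> in the imaginary direction, which a rotation by a random
  angle achieves with probability \<open>O(b / \<bar>z - z'\<bar>)\<close>.
\<close>

lemma strip_pair_integral:
  fixes z z' :: complex and a b :: real
  assumes ab: "0 \<le> b" "b \<le> a"
  defines "U \<equiv> unit_interval"
    and "\<xi> \<equiv> \<lambda>z \<phi> x y. (indicator {x. \<bar>Re (cis \<phi> * z) + x\<bar> \<le> a} x * indicator {y. \<bar>Im (cis \<phi> * z) + y\<bar> \<le> b} y :: ennreal)"
  defines "I \<equiv> \<integral>\<^sup>+\<phi>. \<integral>\<^sup>+x. \<integral>\<^sup>+y. \<xi> z \<phi> x y * \<xi> z' \<phi> x y \<partial>U \<partial>U \<partial>U"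
  shows "I \<le> ennreal (4 * a * b)" "z \<noteq> z' \<Longrightarrow> I \<le> ennreal (64 * a * b\<^sup>2 * (if dist z z' \<le> 4 * a then 1 / dist z z' else 0))"
proof -
  have U: "prob_space U" unfolding U_def by (rule prob_space_unit_interval)
  have [measurable_cong, simp]: "sets U = sets borel" by (simp add: U_def)
  have a: "0 \<le> a" using ab by linarith
  \<comment> \<open>A condition on the angle alone, necessary for both points to fall into the strip
    after a common translation; given it, the translations contribute at most 2 a times 2 b.\<close>
  let ?D = "\<lambda>\<phi>. (indicator {\<phi>. \<bar>Re (cis \<phi> * (z - z'))\<bar> \<le> 2 * a \<and> \<bar>Im (cis \<phi> * (z - z'))\<bar> \<le> 2 * b} \<phi> :: ennreal)"
  have cl: "closed {\<phi>. \<bar>Re (cis \<phi> * (z - z'))\<bar> \<le> 2 * a \<and> \<bar>Im (cis \<phi> * (z - z'))\<bar> \<le> 2 * b}"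
    by (intro closed_Collect_conj closed_Collect_le continuous_intros)
  have m: "{x :: real. \<bar>p + x\<bar> \<le> r} \<in> sets borel" for p r by (intro borel_closed closed_Collect_le continuous_intros)
  have inner: "(\<integral>\<^sup>+x. \<integral>\<^sup>+y. \<xi> z \<phi> x y * \<xi> z' \<phi> x y \<partial>U \<partial>U) \<le> ennreal (4 * a * b) * ?D \<phi>" for \<phi>
  proof -
    have "\<xi> z \<phi> x y * \<xi> z' \<phi> x y \<le> ?D \<phi> * (indicator {x. \<bar>Re (cis \<phi> * z) + x\<bar> \<le> a} x * indicator {y. \<bar>Im (cis \<phi> * z) + y\<bar> \<le> b} y)" for x y
    proof (cases "\<xi> z \<phi> x y * \<xi> z' \<phi> x y = 0")
      case True
      show ?thesis unfolding True by (rule zero_le)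
    next
      case False
      then have h: "\<bar>Re (cis \<phi> * z) + x\<bar> \<le> a" "\<bar>Im (cis \<phi> * z) + y\<bar> \<le> b"
        "\<bar>Re (cis \<phi> * z') + x\<bar> \<le> a" "\<bar>Im (cis \<phi> * z') + y\<bar> \<le> b"
        by (auto simp: \<xi>_def indicator_def split: if_splits)
      then have "\<bar>Re (cis \<phi> * z) - Re (cis \<phi> * z')\<bar> \<le> 2 * a" "\<bar>Im (cis \<phi> * z) - Im (cis \<phi> * z')\<bar> \<le> 2 * b"
        by linarith+
      then have "?D \<phi> = 1" by (simp add: right_diff_distrib)
      then show ?thesis using h by (simp add: \<xi>_def)
    qed
    then have "(\<integral>\<^sup>+x. \<integral>\<^sup>+y. \<xi> z \<phi> x y * \<xi> z' \<phi> x y \<partial>U \<partial>U) \<le>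
        (\<integral>\<^sup>+x. \<integral>\<^sup>+y. ?D \<phi> * (indicator {x. \<bar>Re (cis \<phi> * z) + x\<bar> \<le> a} x * indicator {y. \<bar>Im (cis \<phi> * z) + y\<bar> \<le> b} y) \<partial>U \<partial>U)"
      by (intro nn_integral_mono)
    also have "\<dots> = ?D \<phi> * ((\<integral>\<^sup>+x. indicator {x. \<bar>Re (cis \<phi> * z) + x\<bar> \<le> a} x \<partial>U) * (\<integral>\<^sup>+y. indicator {y. \<bar>Im (cis \<phi> * z) + y\<bar> \<le> b} y \<partial>U))"
      using m by (simp add: nn_integral_cmult nn_integral_multc mult.assoc)
    also have "\<dots> \<le> ?D \<phi> * (ennreal (2 * a) * ennreal (2 * b))"
      unfolding U_def using a ab by (intro mult_left_mono mult_mono measure_unit_interval_le) auto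
    also have "\<dots> = ennreal (4 * a * b) * ?D \<phi>" using a ab by (simp add: mult.commute mult.left_commute flip: ennreal_mult)
    finally show ?thesis .
  qed
  have "I \<le> (\<integral>\<^sup>+\<phi>. ennreal (4 * a * b) * ?D \<phi> \<partial>U)"
    unfolding I_def by (intro nn_integral_mono inner)
  also have "\<dots> = ennreal (4 * a * b) * (\<integral>\<^sup>+\<phi>. ?D \<phi> \<partial>U)"
    using cl by (intro nn_integral_cmult borel_measurable_indicator) auto
  finally have I: "I \<le> ennreal (4 * a * b) * (\<integral>\<^sup>+\<phi>. ?D \<phi> \<partial>U)" .
  have "(\<integral>\<^sup>+\<phi>. ?D \<phi> \<partial>U) \<le> 1" by (rule nn_integral_prob_le[OF U]) (auto simp: indicator_def)
  then have "ennreal (4 * a * b) * (\<integral>\<^sup>+\<phi>. ?D \<phi> \<partial>U) \<le> ennreal (4 * a * b) * 1" by (intro mult_left_mono) auto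
  then show "I \<le> ennreal (4 * a * b)" using I by simp
  assume zz: "z \<noteq> z'"
  define \<zeta> where "\<zeta> = z - z'"
  have \<zeta>: "\<zeta> \<noteq> 0" "dist z z' = cmod \<zeta>" using zz by (auto simp: \<zeta>_def dist_norm)
  show "I \<le> ennreal (64 * a * b\<^sup>2 * (if dist z z' \<le> 4 * a then 1 / dist z z' else 0))"
  proof (cases "dist z z' \<le> 4 * a")
    case True
    have "(\<integral>\<^sup>+\<phi>. ?D \<phi> \<partial>U) \<le> (\<integral>\<^sup>+\<phi>. indicator {\<phi>. \<bar>Im (cis \<phi> * \<zeta>)\<bar> \<le> 2 * b} \<phi> \<partial>U)"
      by (intro nn_integral_mono) (auto simp: indicator_def \<zeta>_def)
    also have "\<dots> \<le> ennreal (8 * (2 * b) / cmod \<zeta>)"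
      unfolding U_def using ab by (intro measure_small_sine_le \<zeta>) simp
    finally have "I \<le> ennreal (4 * a * b) * ennreal (8 * (2 * b) / cmod \<zeta>)"
      using I by (meson mult_left_mono order_trans zero_le)
    also have "\<dots> = ennreal (64 * a * b\<^sup>2 * (1 / dist z z'))"
      using a ab by (simp add: \<zeta>(2) power2_eq_square mult_ac flip: ennreal_mult)
    finally show ?thesis using True by simp
  next
    case False
    \<comment> \<open>Both coordinates of the rotated difference would be at most 2 a, as b \<le> a,
      forcing |z - z'| \<le> 4 a.\<close>
    have "?D \<phi> = 0" for \<phi>
    proof -
      have "4 * a < cmod (cis \<phi> * (z - z'))" using False by (simp add: norm_mult dist_norm)
      also have "\<dots> \<le> \<bar>Re (cis \<phi> * (z - z'))\<bar> + \<bar>Im (cis \<phi> * (z - z'))\<bar>" by (rule cmod_le)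
      finally have "\<not> (\<bar>Re (cis \<phi> * (z - z'))\<bar> \<le> 2 * a \<and> \<bar>Im (cis \<phi> * (z - z'))\<bar> \<le> 2 * b)" using ab by linarith
      then show ?thesis by (simp only: indicator_def mem_Collect_eq of_bool_eq simp_thms)
    qed
    then have "(\<integral>\<^sup>+\<phi>. ?D \<phi> \<partial>U) = 0" by (simp only: nn_integral_0_iff_AE nn_integral_const mult_zero_left)
    then show ?thesis using I by simp
  qed
qed

text \<open>Squaring a sum of indicators gives pairs of rows. Second entries have norm at most R
  with R^4 = lam^3 E, so O(R^4) rows have their ratio in the relevant ball. A diagonal pair costs 4
  a b, about lam^-3; the other pairs with a given row cost O(a^2 b^2 R^4) together, by
  \<open>sum_inverse_dist_le\<close>. The totals are O(E) and O(E^2).\<close>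

lemma Theta_norm_sq_le_large_complex:
  fixes f :: "complex^2^2 \<Rightarrow> real"
  assumes "cusp_lattice \<Gamma> \<sigma> h" and K: "maximal_compact SU2 \<kappa>"
    and f: "\<And>q g. q \<in> subgroup_Q \<Longrightarrow> g \<in> carrier SL2 \<Longrightarrow> f (q ** g) = f g"
    and fk: "\<And>t k. k \<in> SU2 \<Longrightarrow> f (a_mat (t / 2) ** k) = v t * \<psi> (lam * sin (SU2_angle k), lam * SU2_phase k)"
    and v: "\<And>t. v t \<noteq> 0 \<Longrightarrow> t \<in> {- L..0}" "\<And>t. 0 \<le> v t" "\<And>t. v t \<le> 1"
    and \<psi>: "\<And>x. 0 \<le> \<psi> x" "\<And>x. \<psi> x \<le> B" "\<And>x. \<psi> x \<noteq> 0 \<Longrightarrow> norm x \<le> B"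
    and B: "B \<ge> 1" "lam \<ge> 8 * B\<^sup>2" and E: "exp L = lam ^ 3 * E" "E \<ge> 1" and "L \<ge> 0"
  shows "Theta_norm_sq \<Gamma> \<sigma> f \<le> ennreal (B\<^sup>2 * (8 * norm h + 1)\<^sup>2 * (16 * B ^ 3 + 147456 * B ^ 6 * (norm h)\<^sup>2) * E\<^sup>2)"
proof -
  interpret cusp_lattice \<Gamma> \<sigma> h by fact
  interpret maximal_compact SU2 \<kappa> by fact
  define U where "U = unit_interval"
  have [measurable_cong, simp]: "sets U = sets borel" "space U = UNIV" by (simp_all add: U_def)
  have U: "prob_space U" unfolding U_def by (rule prob_space_unit_interval)
  interpret U: prob_space U by (rule U)
  have UU: "prob_space (U \<Otimes>\<^sub>M U)" by (intro prob_space_pair_measure U)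
  interpret UU: prob_space "U \<Otimes>\<^sub>M U" by (rule UU)
  define M where "M = U \<Otimes>\<^sub>M U \<Otimes>\<^sub>M U"
  have M: "prob_space M" unfolding M_def by (intro prob_space_pair_measure U UU)
  \<comment> \<open>On the ratio z = c/d the diagonal factor acts as rotation by \<phi> and the
    lower unipotent factor as translation by x + i y, and neither changes |d|.\<close>
  define \<eta> :: "real \<times> real \<times> real \<Rightarrow> complex^2^2" where
    "\<eta> = (\<lambda>(\<phi>, x, y). mat2 (cis (\<phi> / 2)) 0 0 (cis (- \<phi> / 2)) ** mat2 1 0 (Complex x y) 1)"
  have \<eta>_SL2: "\<eta> m \<in> carrier SL2" for m
  proof -
    have "mat2 (cis (\<phi> / 2)) 0 0 (cis (- \<phi> / 2)) \<in> carrier SL2" for \<phi>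
      by (simp add: carrier_SL2_iff cis_mult)
    moreover have "mat2 1 0 w 1 \<in> carrier SL2" for w :: complex by (simp add: carrier_SL2_iff)
    ultimately show ?thesis unfolding \<eta>_def split_beta' by (intro SL2_mult_closed)
  qed
  have \<eta>m: "\<eta> \<in> borel_measurable M"
  proof -
    have "continuous_on UNIV \<eta>"
      unfolding \<eta>_def split_beta' Complex_eq by (intro continuous_intros) auto
    then have "\<eta> \<in> borel_measurable (borel \<Otimes>\<^sub>M borel \<Otimes>\<^sub>M borel)"
      using borel_measurable_continuous_onI by (simp add: borel_prod)
    then show ?thesis unfolding M_def by (simp cong: measurable_cong_sets)
  qed
  have B2: "B \<le> B\<^sup>2" using B(1) by (simp add: power2_eq_square)
  have lam: "lam \<ge> 8 * B" "lam > 0" "lam \<ge> 8" using B B2 by linarith+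
  \<comment> \<open>Half the side lengths of the strip: |sin \<theta>| \<le> B/lam and cos \<theta>
    \<ge> 1/2 bound |c/d| by a, and the phase |\<delta>| \<le> B/lam gains another factor B/lam in
    the imaginary direction.\<close>
  define a where "a = 2 * B / lam"
  define b where "b = 2 * B\<^sup>2 / lam\<^sup>2"
  \<comment> \<open>The cutoff is evaluated at 2 t, so t \<ge> - L/2 on the support and the row norm
    exp(-t/2) is at most exp(L/4).\<close>
  define R where "R = exp (L / 4)"
  have R: "R > 0" "R \<ge> 1" using \<open>L \<ge> 0\<close> by (simp_all add: R_def)
  have R4: "R ^ 4 = lam ^ 3 * E" by (simp add: R_def E(1)[symmetric] flip: exp_of_nat_mult)
  have ab: "0 \<le> b" "b \<le> a" "a \<le> 1"
  proof -
    show "0 \<le> b" by (simp add: b_def)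
    have "b = a * (B / lam)" by (simp add: a_def b_def power2_eq_square)
    also have "\<dots> \<le> a * 1" using lam B(1) by (intro mult_left_mono) (auto simp: a_def)
    finally show "b \<le> a" by simp
    show "a \<le> 1" using lam B(1) by (simp add: a_def)
  qed
  have a0: "0 \<le> a" using ab by linarith
  have local: "X $ 2 $ 2 \<noteq> 0 \<and> norm (X $ 2 $ 2) \<le> R \<and> \<bar>Re (X $ 2 $ 1 / X $ 2 $ 2)\<bar> \<le> a \<and>
      \<bar>Im (X $ 2 $ 1 / X $ 2 $ 2)\<bar> \<le> b \<and> 0 \<le> f X \<and> f X \<le> B"
    if X: "X \<in> carrier SL2" "f X \<noteq> 0" for X
  proof -
    obtain k c where kc: "k \<in> SU2" "c \<noteq> 0" "X $ 2 $ 1 = c * k $ 2 $ 1" "X $ 2 $ 2 = c * k $ 2 $ 2"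
      "f X = f (a_mat (- ln ((norm (X $ 2))\<^sup>2)) ** k)"
      using iwasawa_row[OF X(1)] f by metis
    define t where "t = - ln ((norm (X $ 2))\<^sup>2)"
    define \<theta> where "\<theta> = SU2_angle k"
    define \<delta> where "\<delta> = SU2_phase k"
    have fX: "f X = v (2 * t) * \<psi> (lam * sin \<theta>, lam * \<delta>)"
      using kc(5) fk[OF kc(1), of "2 * t"] by (simp add: t_def \<theta>_def \<delta>_def)
    then have nz: "v (2 * t) \<noteq> 0" "\<psi> (lam * sin \<theta>, lam * \<delta>) \<noteq> 0" using X(2) by auto
    have "norm (lam * sin \<theta>) \<le> B" "norm (lam * \<delta>) \<le> B"
      using \<psi>(3)[OF nz(2)] norm_fst_le[of "lam * sin \<theta>" "lam * \<delta>"] norm_snd_le[of "lam * \<delta>" "lam * sin \<theta>"] by linarith+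
    then have sd: "\<bar>sin \<theta>\<bar> \<le> B / lam" "\<bar>\<delta>\<bar> \<le> B / lam" using lam by (simp_all add: abs_mult field_simps)
    have Bl: "B / lam \<le> 1 / 8" using lam by (simp add: field_simps)
    obtain \<alpha> \<beta> where co: "\<theta> \<in> {0..pi/2}" "\<alpha> - \<beta> = \<delta>"
      "k $ 2 $ 1 = - of_real (sin \<theta>) * cis (- \<beta>)" "k $ 2 $ 2 = of_real (cos \<theta>) * cis (- \<alpha>)"
      using SU2_coordinates[OF kc(1)] unfolding SU2_coordinates_def \<theta>_def \<delta>_def by blast
    have "\<bar>sin \<theta>\<bar> \<le> 1 / 2" using sd(1) Bl by linarith
    then have "\<bar>\<theta>\<bar> \<le> 2 / 3" using co(1) by (intro abs_le_of_sin) auto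
    then have c2: "1 / 2 \<le> cos \<theta>" by (intro cos_ge_half) linarith
    have A: "X $ 2 $ 2 \<noteq> 0" using kc(2) c2 by (simp add: kc(4) co(4))
    define r where "r = \<bar>sin \<theta>\<bar> / cos \<theta>"
    have r: "0 \<le> r" "r \<le> a"
    proof -
      show "0 \<le> r" using c2 by (simp add: r_def)
      have "r \<le> (B / lam) / (1 / 2)" unfolding r_def using sd(1) c2 B(1) lam by (intro frac_le) auto
      then show "r \<le> a" by (simp add: a_def mult.commute)
    qed
    have cb: "cis (- \<beta>) = cis \<delta> * cis (- \<alpha>)" by (simp add: cis_mult co(2)[symmetric])
    have "X $ 2 $ 1 / X $ 2 $ 2 = - of_real (sin \<theta> / cos \<theta>) * cis \<delta>"
      unfolding kc(3,4) co(3,4) cb using kc(2) by simp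
    then have z: "\<bar>Re (X $ 2 $ 1 / X $ 2 $ 2)\<bar> = r * \<bar>cos \<delta>\<bar>" "\<bar>Im (X $ 2 $ 1 / X $ 2 $ 2)\<bar> = r * \<bar>sin \<delta>\<bar>"
      using c2 by (simp_all add: r_def abs_mult)
    have "r * \<bar>cos \<delta>\<bar> \<le> a * 1" using r by (intro mult_mono) auto
    moreover have "r * \<bar>sin \<delta>\<bar> \<le> a * (B / lam)"
      using r sd(2) abs_sin_x_le_abs_x[of \<delta>] by (intro mult_mono) auto
    moreover have "a * (B / lam) = b" by (simp add: a_def b_def power2_eq_square)
    ultimately have zz: "\<bar>Re (X $ 2 $ 1 / X $ 2 $ 2)\<bar> \<le> a" "\<bar>Im (X $ 2 $ 1 / X $ 2 $ 2)\<bar> \<le> b" unfolding z by linarith+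
    have X2: "0 < norm (X $ 2)" using bottom_row_nonzero[OF X(1)] by simp
    have "norm (X $ 2 $ 2) \<le> norm (X $ 2)" by (rule Finite_Cartesian_Product.norm_nth_le)
    also have "\<dots> = exp (- t / 2)" unfolding t_def using exp_half_ln_square[OF X2] by simp
    also have "\<dots> \<le> R" using v(1)[OF nz(1)] by (simp add: R_def)
    finally have "norm (X $ 2 $ 2) \<le> R" .
    moreover have "0 \<le> f X" unfolding fX using v \<psi> by simp
    moreover have "f X \<le> 1 * B" unfolding fX using v \<psi> by (intro mult_mono) auto
    ultimately show ?thesis using A zz by simp
  qed
  have AE_U: "AE s in U. s \<in> {0..1}"
    unfolding U_def unit_interval_def by (rule AE_uniform_measureI) auto
  have ms: "{s \<in> space U. s \<in> {0..1}} \<in> sets U" by simp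
  note AE2 = AE_pair_prob_space[OF U U AE_U ms AE_U ms]
  have AE_M: "AE m in M. fst m \<in> {0..1} \<and> fst (snd m) \<in> {0..1} \<and> snd (snd m) \<in> {0..1}"
    unfolding M_def using AE_pair_prob_space(1)[OF U UU AE_U ms AE2] by simp
  show ?thesis
  proof (rule Theta_norm_sq_le_of_averages[OF f M \<eta>m \<eta>_SL2])
    fix g :: "complex^2^2" assume g: "g \<in> carrier SL2"
    define z where "z c = (rep c ** g) $ 2 $ 1 / (rep c ** g) $ 2 $ 2" for c
    \<comment> \<open>Radius 4 suffices: a ratio that reaches the strip after rotation and
      translation by x, y in [0,1] has modulus at most a + b + 2.\<close>
    define A where "A = {c \<in> cosets. (rep c ** g) $ 2 $ 2 \<noteq> 0 \<and> norm ((rep c ** g) $ 2 $ 2) \<le> R \<and> dist 0 (z c) \<le> 4}"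
    define \<rho> where "\<rho> = 1 / (R\<^sup>2 * norm h)"
    have four: "(0 :: real) \<le> 4" by simp
    note cc = count_chart[OF g R(1) four, where ?z0.0 = 0, folded z_def, folded A_def]
    have A: "finite A" "real (card A) \<le> (8 * R\<^sup>2 * norm h + 1)\<^sup>2" "inj_on z A"
      using cc(1-3) by simp_all
    have sep: "\<rho> \<le> dist (z c) (z c')" if "c \<in> A" "c' \<in> A" "c \<noteq> c'" for c c'
      using cc(4)[OF that] by (simp add: \<rho>_def)
    have \<rho>: "\<rho> > 0" using R h_nonzero by (simp add: \<rho>_def)
    define \<xi> :: "complex \<Rightarrow> real \<times> real \<times> real \<Rightarrow> ennreal" where
      "\<xi> w = (\<lambda>(\<phi>, x, y). indicator {x. \<bar>Re (cis \<phi> * w) + x\<bar> \<le> a} x * indicator {y. \<bar>Im (cis \<phi> * w) + y\<bar> \<le> b} y)" for w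
    have \<xi>m: "\<xi> w \<in> borel_measurable M" for w
    proof -
      let ?S = "{p :: real \<times> real \<times> real. \<bar>Re (cis (fst p) * w) + fst (snd p)\<bar> \<le> a \<and>
        \<bar>Im (cis (fst p) * w) + snd (snd p)\<bar> \<le> b}"
      have "closed ?S" by (intro closed_Collect_conj closed_Collect_le continuous_intros)
      then have "(indicator ?S :: _ \<Rightarrow> ennreal) \<in> borel_measurable (borel \<Otimes>\<^sub>M borel \<Otimes>\<^sub>M borel)"
        by (simp add: borel_prod borel_measurable_indicator)
      moreover have "\<xi> w = indicator ?S"
        unfolding \<xi>_def by (auto simp: fun_eq_iff indicator_def)
      ultimately show ?thesis unfolding M_def by (simp cong: measurable_cong_sets)
    qed
    have pt: "ennreal ((Theta \<Gamma> f (g ** \<eta> m))\<^sup>2) \<le> ennreal (B\<^sup>2) * (\<Sum>c\<in>A. \<Sum>c'\<in>A. \<xi> (z c) m * \<xi> (z c') m)"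
      if m: "m = (\<phi>, x, y)" "x \<in> {0..1}" "y \<in> {0..1}" for m \<phi> x y
    proof -
      have one: "c \<in> A \<and> 0 \<le> f (rep c ** (g ** \<eta> m)) \<and> f (rep c ** (g ** \<eta> m)) \<le> B \<and> \<xi> (z c) m = 1"
        if c: "c \<in> cosets" "f (rep c ** (g ** \<eta> m)) \<noteq> 0" for c
      proof -
        define X where "X = rep c ** g"
        define Y where "Y = X ** \<eta> m"
        have YX: "rep c ** (g ** \<eta> m) = Y" unfolding Y_def X_def matrix_mul_assoc ..
        have Y: "Y \<in> carrier SL2" "f Y \<noteq> 0" "rep c ** (g ** \<eta> m) = Y"
        proof -
          show "Y \<in> carrier SL2" unfolding Y_def X_def by (intro SL2_mult_closed rep_in_SL2 g \<eta>_SL2 c(1))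
          show "f Y \<noteq> 0" using c(2) unfolding YX .
        qed (rule YX)
        note l = local[OF Y(1,2)]
        have Y22: "Y $ 2 $ 2 = X $ 2 $ 2 * cis (- \<phi> / 2)"
          and Y21: "Y $ 2 $ 1 = X $ 2 $ 1 * cis (\<phi> / 2) + X $ 2 $ 2 * cis (- \<phi> / 2) * Complex x y"
          unfolding Y_def m(1) \<eta>_def by (simp_all add: algebra_simps)
        have X22: "X $ 2 $ 2 \<noteq> 0" using l Y22 by auto
        have nX: "norm (X $ 2 $ 2) \<le> R" using l unfolding Y22 by (simp add: norm_mult)
        have zc: "z c = X $ 2 $ 1 / X $ 2 $ 2" unfolding z_def X_def ..
        have zY: "Y $ 2 $ 1 / Y $ 2 $ 2 = cis \<phi> * z c + Complex x y"
        proof -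
          have "cis (\<phi> / 2) = cis \<phi> * cis (- \<phi> / 2)" by (simp add: cis_mult)
          then show ?thesis unfolding Y21 Y22 zc using X22 by (simp add: add_divide_distrib)
        qed
        have ri: "\<bar>Re (cis \<phi> * z c) + x\<bar> \<le> a" "\<bar>Im (cis \<phi> * z c) + y\<bar> \<le> b"
          using l unfolding zY by simp_all
        have "cmod (z c) = cmod (cis \<phi> * z c)" by (simp add: norm_mult)
        also have "\<dots> \<le> \<bar>Re (cis \<phi> * z c)\<bar> + \<bar>Im (cis \<phi> * z c)\<bar>" by (rule cmod_le)
        also have "\<dots> \<le> 4" using ri ab m(2,3) unfolding atLeastAtMost_iff by linarith
        finally have "c \<in> A" unfolding A_def using c(1) X22 nX by (simp add: X_def del: matrix2_mult_nth)
        moreover have "\<xi> (z c) m = 1" using ri by (simp add: \<xi>_def m(1))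
        ultimately show ?thesis using l Y(3) by simp
      qed
      have "Theta \<Gamma> f (g ** \<eta> m) = (\<Sum>c\<in>A. f (rep c ** (g ** \<eta> m)))"
        by (rule Theta_finite_sum[OF A(1)]) (use one in \<open>auto simp: A_def\<close>)
      moreover have f0: "0 \<le> f (rep c ** (g ** \<eta> m))" if "c \<in> A" for c
        using one[of c] that by (cases "f (rep c ** (g ** \<eta> m)) = 0") (auto simp: A_def)
      ultimately have "ennreal (Theta \<Gamma> f (g ** \<eta> m)) = (\<Sum>c\<in>A. ennreal (f (rep c ** (g ** \<eta> m))))"
        by (simp add: sum_ennreal)
      also have "\<dots> \<le> (\<Sum>c\<in>A. ennreal B * \<xi> (z c) m)"
      proof (rule sum_mono)
        fix c assume "c \<in> A"
        then show "ennreal (f (rep c ** (g ** \<eta> m))) \<le> ennreal B * \<xi> (z c) m"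
          using one[of c] by (cases "f (rep c ** (g ** \<eta> m)) = 0") (auto simp: A_def ennreal_leI)
      qed
      finally have T: "ennreal (Theta \<Gamma> f (g ** \<eta> m)) \<le> ennreal B * (\<Sum>c\<in>A. \<xi> (z c) m)" by (simp add: sum_distrib_left)
      have "0 \<le> Theta \<Gamma> f (g ** \<eta> m)"
        using \<open>Theta \<Gamma> f (g ** \<eta> m) = _\<close> f0 by (simp add: sum_nonneg)
      then have "ennreal ((Theta \<Gamma> f (g ** \<eta> m))\<^sup>2) = ennreal (Theta \<Gamma> f (g ** \<eta> m)) * ennreal (Theta \<Gamma> f (g ** \<eta> m))"
        by (simp add: power2_eq_square ennreal_mult)
      also have "\<dots> \<le> (ennreal B * (\<Sum>c\<in>A. \<xi> (z c) m)) * (ennreal B * (\<Sum>c\<in>A. \<xi> (z c) m))"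
        by (intro mult_mono T) auto
      also have "\<dots> = ennreal (B\<^sup>2) * ((\<Sum>c\<in>A. \<xi> (z c) m) * (\<Sum>c\<in>A. \<xi> (z c) m))"
        using B(1) by (simp add: power2_eq_square ennreal_mult mult_ac)
      also have "(\<Sum>c\<in>A. \<xi> (z c) m) * (\<Sum>c\<in>A. \<xi> (z c) m) = (\<Sum>c\<in>A. \<Sum>c'\<in>A. \<xi> (z c) m * \<xi> (z c') m)"
        by (rule sum_product)
      finally show ?thesis .
    qed
    have pair: "(\<integral>\<^sup>+m. \<xi> w m * \<xi> w' m \<partial>M) = (\<integral>\<^sup>+\<phi>. \<integral>\<^sup>+x. \<integral>\<^sup>+y. \<xi> w (\<phi>, x, y) * \<xi> w' (\<phi>, x, y) \<partial>U \<partial>U \<partial>U)" for w w'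
    proof -
      have meas: "(\<lambda>m. \<xi> w m * \<xi> w' m) \<in> borel_measurable (U \<Otimes>\<^sub>M U \<Otimes>\<^sub>M U)"
        using \<xi>m unfolding M_def by measurable
      have meas1: "(\<lambda>m. \<xi> w (\<phi>, m) * \<xi> w' (\<phi>, m)) \<in> borel_measurable (U \<Otimes>\<^sub>M U)" for \<phi>
        by (rule measurable_compose[OF measurable_Pair1' meas]) simp
      have "(\<integral>\<^sup>+m. \<xi> w m * \<xi> w' m \<partial>M) = (\<integral>\<^sup>+\<phi>. \<integral>\<^sup>+m. \<xi> w (\<phi>, m) * \<xi> w' (\<phi>, m) \<partial>(U \<Otimes>\<^sub>M U) \<partial>U)"
        unfolding M_def by (rule UU.nn_integral_fst[OF meas, symmetric])
      also have "\<dots> = (\<integral>\<^sup>+\<phi>. \<integral>\<^sup>+x. \<integral>\<^sup>+y. \<xi> w (\<phi>, x, y) * \<xi> w' (\<phi>, x, y) \<partial>U \<partial>U \<partial>U)"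
        by (intro nn_integral_cong U.nn_integral_fst[symmetric] meas1)
      finally show ?thesis .
    qed
    define p where "p c c' = (if c = c' then 4 * a * b else 64 * a * b\<^sup>2 * (if dist (z c) (z c') \<le> 4 * a then 1 / dist (z c) (z c') else 0))" for c c'
    have p0: "0 \<le> p c c'" for c c' using a0 ab by (simp add: p_def)
    have pair_le: "(\<integral>\<^sup>+m. \<xi> (z c) m * \<xi> (z c') m \<partial>M) \<le> ennreal (p c c')" if "c \<in> A" "c' \<in> A" for c c'
    proof (cases "c = c'")
      case True
      then show ?thesis
        unfolding pair using strip_pair_integral(1)[OF ab(1,2), of "z c" "z c'"] by (simp add: p_def \<xi>_def U_def)
    next
      case False
      then have "z c \<noteq> z c'" using A(3) that by (auto dest: inj_onD)
      then show ?thesis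
        unfolding pair using strip_pair_integral(2)[OF ab(1,2), of "z c" "z c'"] False by (simp add: p_def \<xi>_def U_def)
    qed
    have row_sum: "(\<Sum>c'\<in>A. p c c') \<le> 4 * a * b + 64 * a * b\<^sup>2 * (36 * (4 * a) / \<rho>\<^sup>2)" if c: "c \<in> A" for c
    proof -
      have "(\<Sum>c'\<in>A. p c c') = p c c + (\<Sum>c'\<in>A - {c}. p c c')" using A(1) c by (rule sum.remove)
      also have "(\<Sum>c'\<in>A - {c}. p c c') = (\<Sum>c'\<in>A - {c}. 64 * a * b\<^sup>2 * (if dist (z c) (z c') \<le> 4 * a then 1 / dist (z c) (z c') else 0))"
        by (intro sum.cong) (auto simp: p_def)
      also have "\<dots> = 64 * a * b\<^sup>2 * (\<Sum>c'\<in>A - {c}. if dist (z c) (z c') \<le> 4 * a then 1 / dist (z c) (z c') else 0)"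
        by (simp add: sum_distrib_left)
      also have "(\<Sum>c'\<in>A - {c}. if dist (z c) (z c') \<le> 4 * a then 1 / dist (z c) (z c') else 0) =
          (\<Sum>c'\<in>{c' \<in> A - {c}. dist (z c) (z c') \<le> 4 * a}. 1 / dist (z c) (z c'))"
        using A(1) by (intro sum.inter_filter[symmetric]) simp
      also have "\<dots> = (\<Sum>x\<in>z ` {c' \<in> A - {c}. dist (z c) (z c') \<le> 4 * a}. 1 / dist (z c) x)"
        using A(3) by (subst sum.reindex) (auto intro: inj_on_subset)
      also have "z ` {c' \<in> A - {c}. dist (z c) (z c') \<le> 4 * a} = {x \<in> z ` A. x \<noteq> z c \<and> dist (z c) x \<le> 4 * a}"
        using A(3) c by (auto dest: inj_onD)
      also have "(\<Sum>x\<in>{x \<in> z ` A. x \<noteq> z c \<and> dist (z c) x \<le> 4 * a}. 1 / dist (z c) x) \<le> 36 * (4 * a) / \<rho>\<^sup>2"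
      proof (rule sum_inverse_dist_le)
        fix x y assume xy: "x \<in> insert (z c) (z ` A)" "y \<in> insert (z c) (z ` A)" "x \<noteq> y"
        then obtain c1 c2 where "c1 \<in> A" "c2 \<in> A" "x = z c1" "y = z c2" using c by blast
        then show "\<rho> \<le> dist x y" using sep[of c1 c2] xy(3) by blast
      qed (use A \<rho> a0 in simp_all)
      finally show ?thesis using a0 by (simp add: p_def mult_left_mono)
    qed
    have "(\<integral>\<^sup>+m. ennreal ((Theta \<Gamma> f (g ** \<eta> m))\<^sup>2) \<partial>M) \<le>
        (\<integral>\<^sup>+m. ennreal (B\<^sup>2) * (\<Sum>c\<in>A. \<Sum>c'\<in>A. \<xi> (z c) m * \<xi> (z c') m) \<partial>M)"
    proof (rule nn_integral_mono_AE)
      show "AE m in M. ennreal ((Theta \<Gamma> f (g ** \<eta> m))\<^sup>2) \<le> ennreal (B\<^sup>2) * (\<Sum>c\<in>A. \<Sum>c'\<in>A. \<xi> (z c) m * \<xi> (z c') m)"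
        using AE_M
      proof eventually_elim
        case (elim m)
        then show ?case using pt[of m "fst m" "fst (snd m)" "snd (snd m)"] by simp
      qed
    qed
    also have "\<dots> = ennreal (B\<^sup>2) * (\<Sum>c\<in>A. \<Sum>c'\<in>A. \<integral>\<^sup>+m. \<xi> (z c) m * \<xi> (z c') m \<partial>M)"
      using \<xi>m by (simp add: nn_integral_cmult nn_integral_sum)
    also have "\<dots> \<le> ennreal (B\<^sup>2) * (\<Sum>c\<in>A. \<Sum>c'\<in>A. ennreal (p c c'))"
      by (intro mult_left_mono sum_mono pair_le) auto
    also have "\<dots> = ennreal (B\<^sup>2 * (\<Sum>c\<in>A. \<Sum>c'\<in>A. p c c'))"
      using p0 by (simp add: sum_ennreal sum_nonneg ennreal_mult)
    also have "\<dots> \<le> ennreal (B\<^sup>2 * (8 * norm h + 1)\<^sup>2 * (16 * B ^ 3 + 147456 * B ^ 6 * (norm h)\<^sup>2) * E\<^sup>2)"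
    proof (rule ennreal_leI)
      \<comment> \<open>One diagonal term and all off-diagonal terms of a row. With a b = 4
        B^3/lam^3 the constants become 4 times 4, which is 16, and 64 times 144 times 16, which is
        147456.\<close>
      define S where "S = 4 * a * b + 64 * a * b\<^sup>2 * (36 * (4 * a) / \<rho>\<^sup>2)"
      have S_eq: "S = (16 * B ^ 3 + 147456 * B ^ 6 * (norm h)\<^sup>2 * E) / lam ^ 3"
      proof -
        have r: "1 / \<rho>\<^sup>2 = R ^ 4 * (norm h)\<^sup>2" by (simp add: \<rho>_def power2_eq_square power4_eq_xxxx)
        have ab3: "a * b = 4 * B ^ 3 / lam ^ 3" by (simp add: a_def b_def power2_eq_square power3_eq_cube)
        have "S = 4 * (a * b) + 9216 * (a * b)\<^sup>2 * (1 / \<rho>\<^sup>2)" by (simp add: S_def power2_eq_square)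
        also have "\<dots> = 4 * (4 * B ^ 3 / lam ^ 3) + 9216 * (4 * B ^ 3 / lam ^ 3)\<^sup>2 * (lam ^ 3 * E * (norm h)\<^sup>2)"
          unfolding r R4 ab3 ..
        also have "\<dots> = (16 * B ^ 3 + 147456 * (B ^ 3)\<^sup>2 * (norm h)\<^sup>2 * E) / lam ^ 3"
        proof -
          have "4 * (4 * Q / P) + 9216 * (4 * Q / P)\<^sup>2 * (P * E * H) = (16 * Q + 147456 * Q\<^sup>2 * H * E) / P"
            if "P \<noteq> 0" for P Q H :: real using that by (simp add: field_simps power2_eq_square)
          then show ?thesis using lam(2) by simp
        qed
        also have "(B ^ 3)\<^sup>2 = B ^ 6" by (simp flip: power_mult)
        finally show ?thesis .
      qed
      have S0: "0 \<le> S" using a0 ab by (simp add: S_def)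
      have "(\<Sum>c\<in>A. \<Sum>c'\<in>A. p c c') \<le> (\<Sum>c\<in>A. S)" unfolding S_def by (intro sum_mono row_sum)
      also have "\<dots> = real (card A) * S" by simp
      also have "\<dots> \<le> ((8 * norm h + 1)\<^sup>2 * R ^ 4) * S"
      proof (rule mult_right_mono[OF _ S0])
        have "1 \<le> R\<^sup>2" using R by simp
        then have "8 * R\<^sup>2 * norm h + 1 \<le> (8 * norm h + 1) * R\<^sup>2" by (simp add: algebra_simps)
        then have "(8 * R\<^sup>2 * norm h + 1)\<^sup>2 \<le> ((8 * norm h + 1) * R\<^sup>2)\<^sup>2" by (intro power_mono) auto
        also have "\<dots> = (8 * norm h + 1)\<^sup>2 * R ^ 4" by (simp add: power_mult_distrib flip: power_mult)
        finally show "real (card A) \<le> (8 * norm h + 1)\<^sup>2 * R ^ 4" using A(2) by linarith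
      qed
      also have "\<dots> = (8 * norm h + 1)\<^sup>2 * (16 * B ^ 3 + 147456 * B ^ 6 * (norm h)\<^sup>2 * E) * E"
        unfolding S_eq R4 using lam(2) by simp
      also have "\<dots> \<le> (8 * norm h + 1)\<^sup>2 * ((16 * B ^ 3 + 147456 * B ^ 6 * (norm h)\<^sup>2) * E) * E"
      proof (intro mult_right_mono mult_left_mono)
        have "16 * B ^ 3 * 1 \<le> 16 * B ^ 3 * E" using B(1) E(2) by (intro mult_left_mono) auto
        then show "16 * B ^ 3 + 147456 * B ^ 6 * (norm h)\<^sup>2 * E \<le> (16 * B ^ 3 + 147456 * B ^ 6 * (norm h)\<^sup>2) * E"
          by (simp add: distrib_right)
      qed (use E(2) in auto)
      finally have "B\<^sup>2 * (\<Sum>c\<in>A. \<Sum>c'\<in>A. p c c') \<le> B\<^sup>2 * ((8 * norm h + 1)\<^sup>2 * ((16 * B ^ 3 + 147456 * B ^ 6 * (norm h)\<^sup>2) * E) * E)"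
        by (rule mult_left_mono) simp
      then show "B\<^sup>2 * (\<Sum>c\<in>A. \<Sum>c'\<in>A. p c c') \<le> B\<^sup>2 * (8 * norm h + 1)\<^sup>2 * (16 * B ^ 3 + 147456 * B ^ 6 * (norm h)\<^sup>2) * E\<^sup>2"
        by (simp add: power2_eq_square mult_ac)
    qed
    finally show "(\<integral>\<^sup>+m. ennreal ((Theta \<Gamma> f (g ** \<eta> m))\<^sup>2) \<partial>M) \<le>
      ennreal (B\<^sup>2 * (8 * norm h + 1)\<^sup>2 * (16 * B ^ 3 + 147456 * B ^ 6 * (norm h)\<^sup>2) * E\<^sup>2)" .
  qed
qed

section \<open>The complex bound over all parameters\<close>

lemma theta_bound_complex:
  fixes \<Gamma> :: "(complex^2^2) set" and \<psi> :: "real \<times> real \<Rightarrow> real"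
  assumes \<Gamma>: "SL2_lattice \<Gamma>" "cusp_at_infinity \<Gamma>" "invariant_probability \<Gamma> \<sigma>"
    and \<kappa>: "haar_probability SU2 \<kappa>" and \<epsilon>: "\<epsilon> > 0"
    and \<psi>: "test_function \<psi>" "\<And>x. 0 \<le> \<psi> x"
  shows "\<exists>C :: real. \<forall>lam \<ge> 1. \<forall>f \<in> Cc_smooth_Q. f_lambda_complex \<epsilon> \<psi> lam f \<longrightarrow>
    Theta_norm_sq \<Gamma> \<sigma> f \<le> ennreal (C * ((Q_norm 2 \<kappa> 2 f)\<^sup>2 + (Q_norm 2 \<kappa> 1 f)\<^sup>2))"
proof -
  obtain h where lat: "cusp_lattice \<Gamma> \<sigma> h" by (rule cusp_latticeI[OF \<Gamma>])
  have mc: "maximal_compact SU2 \<kappa>" by (rule maximal_compact_SU2[OF \<kappa>])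
  interpret cusp_lattice \<Gamma> \<sigma> h by (rule lat)
  interpret maximal_compact SU2 \<kappa> by (rule mc)
  interpret cusp_lattice_compact \<Gamma> \<sigma> h SU2 \<kappa> \<i>
  proof
    show "(norm a)\<^sup>2 + (norm b)\<^sup>2 \<le> \<bar>(norm a)\<^sup>2 - (norm b)\<^sup>2\<bar> + 2 * \<bar>b \<bullet> a\<bar> + 2 * \<bar>b \<bullet> (a * \<i>)\<bar>"
      for a b :: complex by (rule hopf_complex)
  qed simp
  let ?c = "\<lambda>lam k. (lam * sin (SU2_angle k), lam * SU2_phase k)"
  obtain B where B: "B \<ge> 1" "\<And>x. \<psi> x \<noteq> 0 \<Longrightarrow> norm x \<le> B" "\<And>x. \<psi> x \<le> B"
    using test_functionD(2)[OF \<psi>(1)] by auto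
  define lam1 where "lam1 = exp 3 + 8 * B\<^sup>2"
  have "1 \<le> B\<^sup>2" using B(1) by simp
  then have lam1: "lam1 > 1" using exp_gt_zero[of "3::real"] unfolding lam1_def by linarith
  have sin_nonneg: "0 \<le> sin (SU2_angle k)" if "k \<in> SU2" for k
    using SU2_coordinates[OF that] unfolding SU2_coordinates_def by (intro sin_ge_zero) auto
  obtain C2 where C2: "C2 \<ge> 0" "\<And>lam v f. lam \<ge> lam1 \<Longrightarrow> continuous_on (carrier SL2) f \<Longrightarrow>
    (\<And>q g. q \<in> subgroup_Q \<Longrightarrow> g \<in> carrier SL2 \<Longrightarrow> f (q ** g) = f g) \<Longrightarrow>
    (\<And>t k. k \<in> SU2 \<Longrightarrow> f (a_mat (t / 2) ** k) = v t * \<psi> (?c lam k)) \<Longrightarrow>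
    cutoff ((3 + \<epsilon>) * ln lam) v \<Longrightarrow> Theta_norm_sq \<Gamma> \<sigma> f \<le> ennreal (C2 * (Q_norm 2 \<kappa> 1 f)\<^sup>2)"
  \<comment> \<open>Only arguments x = lam sin \<theta> \<ge> 0 occur. The lower bound divides by
    x0, so a point with x0 > 0 is needed; if \<psi> vanishes at all of these, continuity extends
    this to x = 0 and \<open>f\<close> is zero.\<close>
  proof (cases "\<forall>x>0. \<forall>y. \<psi> (x, y) = 0")
    case True
    have zero: "\<psi> (x, y) = 0" if "x \<ge> 0" for x y
    proof (rule ccontr)
      assume "\<psi> (x, y) \<noteq> 0"
      then have "\<psi> (x, y) > 0" using \<psi>(2)[of "(x, y)"] by (simp add: less_le)
      then obtain \<eta> where \<eta>: "0 < \<eta>" "\<And>p. dist p (x, y) \<le> \<eta> \<Longrightarrow> \<psi> (x, y) / 2 \<le> \<psi> p"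
        by (rule positive_near[OF test_functionD(1)[OF \<psi>(1)]]) blast
      have "\<psi> (x, y) / 2 \<le> \<psi> (x + \<eta>, y)" using \<eta>(1) by (intro \<eta>(2)) (simp add: dist_Pair_Pair dist_real_def)
      moreover have "\<psi> (x + \<eta>, y) = 0" using True \<eta>(1) that by simp
      ultimately show False using \<open>\<psi> (x, y) > 0\<close> by simp
    qed
    show thesis
    proof (rule that[of 0])
      fix lam v and f :: "complex^2^2 \<Rightarrow> real"
      assume lam: "lam \<ge> lam1" and f: "\<And>q g. q \<in> subgroup_Q \<Longrightarrow> g \<in> carrier SL2 \<Longrightarrow> f (q ** g) = f g"
        and fk: "\<And>t k. k \<in> SU2 \<Longrightarrow> f (a_mat (t / 2) ** k) = v t * \<psi> (?c lam k)"
      have z: "f (a_mat t ** k) = 0" if k: "k \<in> SU2" for t k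
        using fk[OF k, of "2 * t"] zero[of "lam * sin (SU2_angle k)"] sin_nonneg[OF k] lam lam1 by simp
      have "Theta_norm_sq \<Gamma> \<sigma> f = 0"
        by (rule Theta_norm_sq_zero) (rule f_lambda_zero[where f = f, OF mc f z])
      then show "Theta_norm_sq \<Gamma> \<sigma> f \<le> ennreal (0 * (Q_norm 2 \<kappa> 1 f)\<^sup>2)" by simp
    qed simp
  next
    case False
    then obtain x0 y0 where xy: "x0 > 0" "\<psi> (x0, y0) \<noteq> 0" by blast
    then have pos: "\<psi> (x0, y0) > 0" using \<psi>(2)[of "(x0, y0)"] by (simp add: less_le)
    have xB: "\<bar>x0\<bar> \<le> B" "\<bar>y0\<bar> \<le> B"
      using B(2)[OF xy(2)] norm_fst_le[of x0 y0] norm_snd_le[of y0 x0] by auto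
    obtain \<eta>' where \<eta>': "0 < \<eta>'" "\<eta>' \<le> 1" "\<And>p. dist p (x0, y0) \<le> \<eta>' \<Longrightarrow> \<psi> (x0, y0) / 2 \<le> \<psi> p"
      by (rule positive_near[OF test_functionD(1)[OF \<psi>(1)] pos]) blast
    \<comment> \<open>\<eta> \<le> x0 keeps the discs small compared with their distance from the
      degenerate point sin \<theta> = 0.\<close>
    define \<eta> where "\<eta> = min \<eta>' x0"
    have \<eta>: "0 < \<eta>" "\<eta> \<le> 1" "\<eta> \<le> x0" using \<eta>' xy(1) by (auto simp: \<eta>_def)
    have near: "\<psi> (x0, y0) / 2 \<le> \<psi> (x, y)" if "\<bar>x - x0\<bar> \<le> \<eta> / 2" "\<bar>y - y0\<bar> \<le> \<eta> / 2" for x y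
    proof (rule \<eta>'(3))
      have "dist (x, y) (x0, y0) \<le> dist x x0 + dist y y0"
        unfolding dist_Pair_Pair by (rule sqrt_sum_squares_le_sum) auto
      also have "\<dots> \<le> \<eta>'" using that by (simp add: dist_real_def \<eta>_def)
      finally show "dist (x, y) (x0, y0) \<le> \<eta>'" .
    qed
    define c where "c = \<psi> (x0, y0) / 2 * \<eta>\<^sup>2 / (72 * exp 1 * (16 + 16 / x0)\<^sup>2)"
    have "16 + 16 / x0 > 0" using xy(1) by (intro add_pos_pos) auto
    then have c: "c > 0" unfolding c_def using pos \<eta>(1) by (intro divide_pos_pos mult_pos_pos) auto
    define C where "C = B\<^sup>2 * (8 * norm h + 1)\<^sup>2 * (16 * B ^ 3 + 147456 * B ^ 6 * (norm h)\<^sup>2)"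
    have C0: "C \<ge> 0" using B(1) by (simp add: C_def)
    show thesis
    proof (rule that[of "C / c\<^sup>2"])
      fix lam v and f :: "complex^2^2 \<Rightarrow> real"
      assume lam: "lam \<ge> lam1" and cont: "continuous_on (carrier SL2) f"
        and f: "\<And>q g. q \<in> subgroup_Q \<Longrightarrow> g \<in> carrier SL2 \<Longrightarrow> f (q ** g) = f g"
        and fk: "\<And>t k. k \<in> SU2 \<Longrightarrow> f (a_mat (t / 2) ** k) = v t * \<psi> (?c lam k)"
        and v: "cutoff ((3 + \<epsilon>) * ln lam) v"
      define E where "E = exp (\<epsilon> * ln lam)"
      define L where "L = (3 + \<epsilon>) * ln lam"
      have B2: "B \<le> B\<^sup>2" using B(1) by (simp add: power2_eq_square)
      have lB: "lam \<ge> 8 * B\<^sup>2" "lam \<ge> 8 * B" "lam \<ge> exp 3" "lam > 0"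
        using lam B(1) B2 exp_gt_zero[of "3::real"] unfolding lam1_def by linarith+
      have ln3: "ln lam \<ge> 3" using lB(3,4) by (simp add: ln_ge_iff)
      have "lam powr 3 = lam ^ 3" using lB(4) powr_realpow[of lam 3] by simp
      then have EL: "exp L = lam ^ 3 * E" using exp_exponent_split[OF lB(4), of 3 \<epsilon>] by (simp add: L_def E_def)
      have E1: "E \<ge> 1" using ln3 \<epsilon> by (simp add: E_def)
      have "1 * 3 \<le> (3 + \<epsilon>) * ln lam" using ln3 \<epsilon> by (intro mult_mono) auto
      then have L3: "L \<ge> 3" by (simp add: L_def)
      then have L0: "L \<ge> 0" by simp
      note vd = cutoffD[OF v, folded L_def]
      have up: "Theta_norm_sq \<Gamma> \<sigma> f \<le> ennreal (C * E\<^sup>2)"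
        unfolding C_def by (rule Theta_norm_sq_le_large_complex[OF lat mc f fk vd(4,2,3) \<psi>(2) B(3) B(2) B(1) lB(1) EL E1 L0])
      have "\<psi> (x0, y0) / 2 * \<eta>\<^sup>2 / (72 * exp 1 * (16 + 16 / x0)\<^sup>2) * E \<le> Q_norm 2 \<kappa> 1 f"
        using pos
        by (intro Q_norm_1_ge_large_complex[OF mc cont fk v[folded L_def] L3 \<psi>(2) B(3) \<eta> near _ xB lB(2) B(1) EL]) auto
      then have "c * E \<le> Q_norm 2 \<kappa> 1 f" by (simp add: c_def)
      then have "E \<le> Q_norm 2 \<kappa> 1 f / c" using c by (simp add: field_simps)
      then have "C * E\<^sup>2 \<le> C * (Q_norm 2 \<kappa> 1 f / c)\<^sup>2"
        using C0 E1 by (intro mult_left_mono power_mono) auto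
      also have "\<dots> = C / c\<^sup>2 * (Q_norm 2 \<kappa> 1 f)\<^sup>2" by (simp add: power_divide)
      finally show "Theta_norm_sq \<Gamma> \<sigma> f \<le> ennreal (C / c\<^sup>2 * (Q_norm 2 \<kappa> 1 f)\<^sup>2)"
        using up by (meson ennreal_leI order_trans)
    qed (use C0 in simp)
  qed
  have "\<exists>C. \<forall>lam\<ge>1. \<forall>f\<in>Cc_smooth_Q. (\<exists>v. cutoff ((3 + \<epsilon>) * ln lam) v \<and>
      (\<forall>t. \<forall>k\<in>SU2. f (a_mat (t / 2) ** k) = v t * \<psi> (?c lam k))) \<longrightarrow>
    Theta_norm_sq \<Gamma> \<sigma> f \<le> ennreal (C * ((Q_norm 2 \<kappa> 2 f)\<^sup>2 + (Q_norm 2 \<kappa> 1 f)\<^sup>2))"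
    using \<epsilon> by (intro theta_bound_if_large[where \<Psi> = "\<lambda>lam k. \<psi> (?c lam k)", OF \<psi>(2) B(3) _ _ lam1 C2]) auto
  then obtain C where C: "\<And>lam f v. lam \<ge> 1 \<Longrightarrow> f \<in> Cc_smooth_Q \<Longrightarrow> cutoff ((3 + \<epsilon>) * ln lam) v \<Longrightarrow>
      (\<forall>t. \<forall>k\<in>SU2. f (a_mat (t / 2) ** k) = v t * \<psi> (?c lam k)) \<Longrightarrow>
    Theta_norm_sq \<Gamma> \<sigma> f \<le> ennreal (C * ((Q_norm 2 \<kappa> 2 f)\<^sup>2 + (Q_norm 2 \<kappa> 1 f)\<^sup>2))"
    by blast
  show ?thesis
  proof (intro exI[of _ C] allI ballI impI)
    fix lam :: real and f :: "complex^2^2 \<Rightarrow> real"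
    assume lam: "lam \<ge> 1" and fC: "f \<in> Cc_smooth_Q" and fl: "f_lambda_complex \<epsilon> \<psi> lam f"
    have f: "f (q ** g) = f g" if "q \<in> subgroup_Q" "g \<in> carrier SL2" for q g
      using fC that by (simp add: Cc_smooth_Q_def)
    obtain v where v: "cutoff ((3 + \<epsilon>) * ln lam) v"
      and formula: "\<And>x t \<theta> \<alpha> \<beta>. \<theta> \<in> {0..pi/2} \<Longrightarrow> \<alpha> - \<beta> \<in> {-pi<..pi} \<Longrightarrow>
        f (n_mat x ** a_mat t ** k_complex \<theta> \<alpha> \<beta>) = v (2 * t) * \<psi> (lam * sin \<theta>, lam * (\<alpha> - \<beta>))"
      using fl unfolding f_lambda_complex_def by blast
    have "f (a_mat (t / 2) ** k) = v t * \<psi> (?c lam k)" if "k \<in> SU2" for t k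
      by (rule f_lambda_complex_on_SU2[OF f formula that])
    then show "Theta_norm_sq \<Gamma> \<sigma> f \<le> ennreal (C * ((Q_norm 2 \<kappa> 2 f)\<^sup>2 + (Q_norm 2 \<kappa> 1 f)\<^sup>2))"
      by (intro C[OF lam fC v]) blast
  qed
qed

theorem theorem3:
  shows
    "(\<forall>(\<Gamma> :: (real^2^2) set) \<sigma> \<kappa> (\<epsilon> :: real) (\<psi> :: real \<Rightarrow> real).
        SL2_lattice \<Gamma> \<and> cusp_at_infinity \<Gamma> \<and> invariant_probability \<Gamma> \<sigma> \<and> haar_probability SO2 \<kappa> \<and>
        \<epsilon> > 0 \<and> test_function \<psi> \<and> (\<forall>x. 0 \<le> \<psi> x \<and> \<psi> x \<le> 1) \<longrightarrow>
        (\<exists>C :: real. \<forall>lam \<ge> 1. \<forall>f \<in> Cc_smooth_Q. f_lambda_real \<epsilon> \<psi> lam f \<longrightarrow>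
           Theta_norm_sq \<Gamma> \<sigma> f \<le>
             ennreal (C * ((Q_norm 1 \<kappa> 2 f)\<^sup>2 + (Q_norm 1 \<kappa> 1 f)\<^sup>2)))) \<and>
     (\<forall>(\<Gamma> :: (complex^2^2) set) \<sigma> \<kappa> (\<epsilon> :: real) (\<psi> :: real \<times> real \<Rightarrow> real).
        SL2_lattice \<Gamma> \<and> cusp_at_infinity \<Gamma> \<and> invariant_probability \<Gamma> \<sigma> \<and> haar_probability SU2 \<kappa> \<and>
        \<epsilon> > 0 \<and> test_function \<psi> \<and> (\<forall>x. 0 \<le> \<psi> x) \<longrightarrow>
        (\<exists>C :: real. \<forall>lam \<ge> 1. \<forall>f \<in> Cc_smooth_Q. f_lambda_complex \<epsilon> \<psi> lam f \<longrightarrow>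
           Theta_norm_sq \<Gamma> \<sigma> f \<le>
             ennreal (C * ((Q_norm 2 \<kappa> 2 f)\<^sup>2 + (Q_norm 2 \<kappa> 1 f)\<^sup>2))))"
  using theta_bound_real theta_bound_complex by blast

end
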